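(* Let $p$ be a prime, let $A\cong C_{p^3}\times C_p$, and let $G$ be a finite group satisfying $C(G)=C(A)$. Then $G\cong A$.
   Context: All groups are finite. $C_m$ denotes the cyclic group of order $m$. ${\rm Irr}(G)$ denotes the set of complex irreducible characters of $G$. For $\chi\in{\rm Irr}(G)$ the codegree of $\chi$ is ${\rm cod}\,\chi=\frac{|G:\ker\chi|}{\chi(1)}$, and ${\rm Cod}(G)=\{{\rm cod}\,\chi\mid\chi\in{\rm Irr}(G)\}$. The group pseudo-algebra of $G$ is $C(G)=\{(d,m_G(d))\mid d\in{\rm Cod}(G)\}$, where $m_G(d)$ is the number of irreducible characters of $G$ with codegree $d$. *)

theory Defs
  imports
    "HOL-Algebra.Coset"
    "HOL-Algebra.Elementary_Groups"
    "HOL-Computational_Algebra.Primes"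
    "Jordan_Normal_Form.VS_Connect"
begin

definition general_linear_group :: "nat \<Rightarrow> complex mat monoid" where
  "general_linear_group n = units_of (ring_mat TYPE(complex) n ())"

definition is_representation ::
    "('a, 'b) monoid_scheme \<Rightarrow> nat \<Rightarrow> ('a \<Rightarrow> complex mat) \<Rightarrow> bool" where
  "is_representation G n \<rho> \<longleftrightarrow> \<rho> \<in> hom G (general_linear_group n)"

definition is_invariant_subspace ::
    "('a, 'b) monoid_scheme \<Rightarrow> nat \<Rightarrow> ('a \<Rightarrow> complex mat) \<Rightarrow> complex vec set \<Rightarrow> bool" where
  "is_invariant_subspace G n \<rho> W \<longleftrightarrow>
     VectorSpace.subspace class_ring W (module_vec TYPE(complex) n) \<and>
     (\<forall>g \<in> carrier G. \<forall>w \<in> W. \<rho> g *\<^sub>v w \<in> W)"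

definition is_irreducible_representation ::
    "('a, 'b) monoid_scheme \<Rightarrow> nat \<Rightarrow> ('a \<Rightarrow> complex mat) \<Rightarrow> bool" where
  "is_irreducible_representation G n \<rho> \<longleftrightarrow>
     is_representation G n \<rho> \<and> n > 0 \<and>
     (\<forall>W. is_invariant_subspace G n \<rho> W \<longrightarrow> W = {0\<^sub>v n} \<or> W = carrier_vec n)"

definition mat_trace :: "complex mat \<Rightarrow> complex" where
  "mat_trace M = (\<Sum>i < dim_row M. M $$ (i, i))"

text \<open>
  A character is made extensional outside the carrier, so that equality of characters as HOL
  functions is equality on the group; this matters when characters are counted.
\<close>

definition character_of ::
    "('a, 'b) monoid_scheme \<Rightarrow> ('a \<Rightarrow> complex mat) \<Rightarrow> 'a \<Rightarrow> complex" where
  "character_of G \<rho> = (\<lambda>g \<in> carrier G. mat_trace (\<rho> g))"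

definition Irr :: "('a, 'b) monoid_scheme \<Rightarrow> ('a \<Rightarrow> complex) set" where
  "Irr G = {character_of G \<rho> | n \<rho>. is_irreducible_representation G n \<rho>}"

definition char_kernel :: "('a, 'b) monoid_scheme \<Rightarrow> ('a \<Rightarrow> complex) \<Rightarrow> 'a set" where
  "char_kernel G \<chi> = {g \<in> carrier G. \<chi> g = \<chi> \<one>\<^bsub>G\<^esub>}"

text \<open>
  The degree of a character is a complex number here, so codegrees are complex numbers and the
  quotient is an exact one.
\<close>

definition codegree :: "('a, 'b) monoid_scheme \<Rightarrow> ('a \<Rightarrow> complex) \<Rightarrow> complex" where
  "codegree G \<chi> = of_nat (card (rcosets\<^bsub>G\<^esub> (char_kernel G \<chi>))) / \<chi> \<one>\<^bsub>G\<^esub>"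

definition Cod :: "('a, 'b) monoid_scheme \<Rightarrow> complex set" where
  "Cod G = {codegree G \<chi> | \<chi>. \<chi> \<in> Irr G}"

definition codegree_mult :: "('a, 'b) monoid_scheme \<Rightarrow> complex \<Rightarrow> nat" where
  "codegree_mult G d = card {\<chi> \<in> Irr G. codegree G \<chi> = d}"

definition group_pseudo_algebra :: "('a, 'b) monoid_scheme \<Rightarrow> (complex \<times> nat) set" where
  "group_pseudo_algebra G = {(d, codegree_mult G d) | d. d \<in> Cod G}"

end

theory Submission
  imports Defs
    "HOL-Algebra.Generated_Groups"
    "HOL-Algebra.Group_Action"
    "HOL-Algebra.Multiplicative_Group"
    "HOL-Algebra.Sylow"
    "Jordan_Normal_Form.DL_Rank"
    "Jordan_Normal_Form.Spectral_Radius"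
begin

text \<open>
  All codegrees of \<open>G\<close> are powers of \<open>p\<close>, so \<open>G\<close> is a \<open>p\<close>-group, and a character of codegree
  \<open>p ^ i\<close> with \<open>i > 0\<close> has degree less than \<open>p ^ i\<close>. The characters of codegree at most \<open>p\<close> are
  therefore linear, and counting them shows that \<open>G/G'\<close> has two generators, one of which can be
  chosen of order dividing \<open>p\<close>. Consequently \<open>G'/M\<close> has order at most \<open>p\<close> whenever it is central
  in \<open>G/M\<close>.

  If \<open>G/G'\<close> is elementary abelian, all characters of codegree \<open>p\<^sup>2\<close> have degree \<open>p\<close> and a kernel of
  index \<open>p\<^sup>3\<close>, and these kernels coincide; this is impossible, as there are at least \<open>p\<^sup>2\<close> such
  characters. Otherwise all characters of codegree \<open>p\<^sup>2\<close> are linear, so quotients of order at most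
  \<open>p\<^sup>3\<close> are abelian. If moreover \<open>|G/G'| = p\<^sup>3\<close>, this forces \<open>|G'| \<le> p\<close>. In all cases
  \<open>|G| \<le> p ^ 4\<close>, the number of irreducible characters; hence \<open>G\<close> is abelian.

  The character theory needed is the formula \<open>|G/N| = \<Sum> \<chi>(1)\<^sup>2\<close>, summed over the irreducible
  characters with \<open>N\<close> in their kernel: it follows from Schur orthogonality and from the decomposition
  of the permutation character on \<open>G/N\<close> along a composition series.
\<close>

section \<open>Matrix representations\<close>

text \<open>\<open>C(G)\<close> does not display |G|. It fixes the number of irreducible characters
  of codegree at most p^i, namely p^2, p^3, p^4 for i = 1, 2, 3; these are the numbers of elements
  of A of order dividing p^i. The work therefore lies in bounding G'.

  The codegree of a linear character is its order, so a count restricted to linear characters of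
  codegree at most p^i is the index of G' G^(p^i). Nonlinear characters could contribute to the
  count for i = 2, and this is the source of the case distinction. They cannot contribute for i = 1,
  since degrees are powers of p and chi(1)^2 < |G : ker chi| = p^i chi(1).

  The obstacle when |G/G'| = p^3 is a large G'. Suppose that M1 < M < G' are steps of index p. Then
  x^(p^2) generates G' modulo M, since otherwise x^p and M would give a nonabelian quotient of order
  p^3. Being the p-th power of an element central modulo M, it is central modulo M1. So G' is
  central modulo M1, although |G'/M1| = p^2.

  Commutativity at the end comes from |G| being the sum of |Irr G| squares: |G| at most |Irr G|
  leaves only degree 1.\<close>

lemma mat_trace_mult_commute:
  assumes "A \<in> carrier_mat n m" "B \<in> carrier_mat m n"
  shows "mat_trace (A * B) = mat_trace (B * A)"
proof -
  have "mat_trace (A * B) = (\<Sum>i<n. \<Sum>j<m. A $$ (i,j) * B $$ (j,i))"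
    using assms by (auto simp: mat_trace_def scalar_prod_def atLeast0LessThan intro!: sum.cong)
  also have "\<dots> = (\<Sum>j<m. \<Sum>i<n. B $$ (j,i) * A $$ (i,j))"
    by (subst sum.swap) (simp add: mult.commute)
  also have "\<dots> = mat_trace (B * A)"
    using assms by (auto simp: mat_trace_def scalar_prod_def atLeast0LessThan intro!: sum.cong)
  finally show ?thesis .
qed

lemma mat_trace_smult_one: "mat_trace (c \<cdot>\<^sub>m 1\<^sub>m n) = of_nat n * c"
  by (simp add: mat_trace_def)

lemma subspace_of_closed:
  fixes W :: "complex vec set"
  assumes "W \<subseteq> carrier_vec n" "0\<^sub>v n \<in> W"
    and "\<And>v w. v \<in> W \<Longrightarrow> w \<in> W \<Longrightarrow> v + w \<in> W"
    and "\<And>c v. v \<in> W \<Longrightarrow> c \<cdot>\<^sub>v v \<in> W"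
  shows "VectorSpace.subspace class_ring W (module_vec TYPE(complex) n)"
proof -
  interpret vec_space "TYPE(complex)" n .
  show ?thesis
    using assms vec_vs vec_module
    by (auto intro!: vec_vs vec_module simp: VectorSpace.subspace_def LinearCombinations.submodule_def module_vec_simps class_ring_simps)
qed

text \<open>An equational form of \<open>is_representation\<close>. Invertibility is implicit, as
  \<open>\<rho> (inv g)\<close> inverts \<open>\<rho> g\<close>, so conjugates and diagonal blocks
  can be checked by matrix computation alone.\<close>

definition mat_rep :: "('a, 'b) monoid_scheme \<Rightarrow> nat \<Rightarrow> ('a \<Rightarrow> complex mat) \<Rightarrow> bool" where
  "mat_rep G n \<rho> \<longleftrightarrow> (\<forall>g \<in> carrier G. \<rho> g \<in> carrier_mat n n) \<and> \<rho> \<one>\<^bsub>G\<^esub> = 1\<^sub>m n \<and>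
     (\<forall>g \<in> carrier G. \<forall>h \<in> carrier G. \<rho> (g \<otimes>\<^bsub>G\<^esub> h) = \<rho> g * \<rho> h)"

locale finite_group = group G for G (structure) +
  assumes fin: "finite (carrier G)"

lemma (in group) is_representation_iff: "is_representation G n \<rho> \<longleftrightarrow> mat_rep G n \<rho>"
proof
  assume "is_representation G n \<rho>"
  then have h: "\<rho> \<in> hom G (units_of (ring_mat TYPE(complex) n ()))"
    by (simp add: is_representation_def general_linear_group_def)
  interpret R: ring "ring_mat TYPE(complex) n ()" by (rule ring_mat)
  interpret U: group "units_of (ring_mat TYPE(complex) n ())" by (rule R.units_group)
  interpret group_hom G "units_of (ring_mat TYPE(complex) n ())" \<rho>
    using h by unfold_locales auto
  have "\<rho> \<one> = 1\<^sub>m n" using hom_one by (simp add: units_of_one ring_mat_simps)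
  moreover have "\<rho> g \<in> carrier_mat n n" if "g \<in> carrier G" for g
    using hom_closed[OF that] by (auto simp: units_of_carrier Units_def ring_mat_simps)
  moreover have "\<rho> (g \<otimes> k) = \<rho> g * \<rho> k" if "g \<in> carrier G" "k \<in> carrier G" for g k
    using hom_mult[OF that] by (simp add: units_of_mult ring_mat_simps)
  ultimately show "mat_rep G n \<rho>" by (auto simp: mat_rep_def)
next
  assume r: "mat_rep G n \<rho>"
  have "\<rho> g \<in> Units (ring_mat TYPE(complex) n ())" if "g \<in> carrier G" for g
  proof -
    have "\<rho> g * \<rho> (inv g) = 1\<^sub>m n" "\<rho> (inv g) * \<rho> g = 1\<^sub>m n"
      using r that unfolding mat_rep_def by (metis inv_closed r_inv, metis inv_closed l_inv)
    then show ?thesis using r that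
      by (auto simp: Units_def ring_mat_simps mat_rep_def)
  qed
  then show "is_representation G n \<rho>" using r
    by (auto simp: is_representation_def general_linear_group_def hom_def mat_rep_def
        units_of_carrier units_of_mult ring_mat_simps)
qed

lemma (in group) irreducible_mat_rep:
  "is_irreducible_representation G n \<rho> \<Longrightarrow> mat_rep G n \<rho>"
  by (simp add: is_irreducible_representation_def is_representation_iff)

lemma (in group) irreducible_invariant_subspace:
  assumes "is_irreducible_representation G n \<rho>"
    and "W \<subseteq> carrier_vec n" "0\<^sub>v n \<in> W"
    and "\<And>v w. v \<in> W \<Longrightarrow> w \<in> W \<Longrightarrow> v + w \<in> W"
    and "\<And>c v. v \<in> W \<Longrightarrow> c \<cdot>\<^sub>v v \<in> W"
    and "\<And>g w. g \<in> carrier G \<Longrightarrow> w \<in> W \<Longrightarrow> \<rho> g *\<^sub>v w \<in> W"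
  shows "W = {0\<^sub>v n} \<or> W = carrier_vec n"
proof -
  have "is_invariant_subspace G n \<rho> W"
    unfolding is_invariant_subspace_def using subspace_of_closed[OF assms(2-5)] assms(6) by simp
  then show ?thesis using assms(1) by (simp add: is_irreducible_representation_def)
qed

section \<open>Schur's lemma\<close>

abbreviation (in group) irrep where "irrep \<equiv> is_irreducible_representation G"

text \<open>Schur's argument: the kernel of \<open>T\<close> is invariant under
  \<open>\<sigma>\<close> and its image under \<open>\<rho>\<close>, and \<open>T\<close> being
  nonzero excludes one of the two alternatives that irreducibility leaves for each.\<close>

lemma (in group) intertwiner_kernel_and_image:
  assumes \<rho>: "irrep n \<rho>" and \<sigma>: "irrep m \<sigma>"
    and T: "T \<in> carrier_mat n m" and comm: "\<And>g. g \<in> carrier G \<Longrightarrow> \<rho> g * T = T * \<sigma> g"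
    and nz: "T \<noteq> 0\<^sub>m n m"
  shows "{v \<in> carrier_vec m. T *\<^sub>v v = 0\<^sub>v n} = {0\<^sub>v m}" (is "?K = _")
    and "(\<lambda>v. T *\<^sub>v v) ` carrier_vec m = carrier_vec n" (is "?I = _")
proof -
  have r: "\<rho> g \<in> carrier_mat n n" "\<sigma> g \<in> carrier_mat m m" if "g \<in> carrier G" for g
    using irreducible_mat_rep[OF \<rho>] irreducible_mat_rep[OF \<sigma>] that by (auto simp: mat_rep_def)
  have sw: "T *\<^sub>v (\<sigma> g *\<^sub>v v) = \<rho> g *\<^sub>v (T *\<^sub>v v)" if "g \<in> carrier G" "v \<in> carrier_vec m" for g v
    using that r[OF that(1)] T comm[OF that(1)] by (metis assoc_mult_mat_vec)
  have col: "T *\<^sub>v unit_vec m j = col T j" if "j < m" for j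
    using T that by (intro eq_vecI) auto
  \<comment> \<open>The columns of \<open>T\<close> are the images of the unit vectors, so a matrix
    annihilating every vector is zero.\<close>
  have "\<exists>v \<in> carrier_vec m. T *\<^sub>v v \<noteq> 0\<^sub>v n"
  proof (rule ccontr)
    assume "\<not> ?thesis"
    then have "col T j = 0\<^sub>v n" if "j < m" for j using col[OF that] that by auto
    then have "T = 0\<^sub>m n m" using T
      by (intro mat_col_eqI) auto
    then show False using nz by simp
  qed
  then obtain v0 where v0: "v0 \<in> carrier_vec m" "T *\<^sub>v v0 \<noteq> 0\<^sub>v n" by auto
  have "?K = {0\<^sub>v m} \<or> ?K = carrier_vec m"
  proof (rule irreducible_invariant_subspace[OF \<sigma>])
    show "\<And>v w. v \<in> ?K \<Longrightarrow> w \<in> ?K \<Longrightarrow> v + w \<in> ?K"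
      using T by (auto simp: mult_add_distrib_mat_vec)
    show "\<And>c v. v \<in> ?K \<Longrightarrow> c \<cdot>\<^sub>v v \<in> ?K"
      using T by (auto simp: mult_mat_vec)
    show "\<sigma> g *\<^sub>v w \<in> ?K" if g: "g \<in> carrier G" and w: "w \<in> ?K" for g w
      using sw[OF g, of w] w r[OF g] by auto
  qed (use T in auto)
  then show "?K = {0\<^sub>v m}" using v0 by auto
  have "?I = {0\<^sub>v n} \<or> ?I = carrier_vec n"
  proof (rule irreducible_invariant_subspace[OF \<rho>])
    show "?I \<subseteq> carrier_vec n" using T by auto
    show "0\<^sub>v n \<in> ?I" using T by (intro image_eqI[of _ _ "0\<^sub>v m"]) auto
    show "v + w \<in> ?I" if "v \<in> ?I" "w \<in> ?I" for v w
    proof -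
      from that obtain a b where "a \<in> carrier_vec m" "b \<in> carrier_vec m" "v = T *\<^sub>v a" "w = T *\<^sub>v b" by auto
      then show ?thesis using T by (intro image_eqI[of _ _ "a + b"]) (auto simp: mult_add_distrib_mat_vec)
    qed
    show "c \<cdot>\<^sub>v v \<in> ?I" if "v \<in> ?I" for c v
    proof -
      from that obtain a where "a \<in> carrier_vec m" "v = T *\<^sub>v a" by auto
      then show ?thesis using T by (intro image_eqI[of _ _ "c \<cdot>\<^sub>v a"]) (auto simp: mult_mat_vec)
    qed
    show "\<rho> g *\<^sub>v w \<in> ?I" if "g \<in> carrier G" "w \<in> ?I" for g w
    proof -
      from that obtain a where "a \<in> carrier_vec m" "w = T *\<^sub>v a" by auto
      then show ?thesis using T sw[OF that(1)] r(2)[OF that(1)]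
        by (intro image_eqI[of _ _ "\<sigma> g *\<^sub>v a"]) auto
    qed
  qed
  then show "?I = carrier_vec n" using v0 by auto
qed

text \<open>By Schur's argument \<open>T\<close> has a two-sided inverse \<open>S\<close>, so
  \<open>\<rho> g = T * \<sigma> g * S\<close>; commuting the rectangular factors under the trace
  removes \<open>T\<close> and \<open>S\<close>.\<close>

lemma (in group) nonzero_intertwiner_imp_same_trace:
  assumes \<rho>: "irrep n \<rho>" and \<sigma>: "irrep m \<sigma>"
    and T: "T \<in> carrier_mat n m" and comm: "\<And>g. g \<in> carrier G \<Longrightarrow> \<rho> g * T = T * \<sigma> g"
    and nz: "T \<noteq> 0\<^sub>m n m" and g: "g \<in> carrier G"
  shows "mat_trace (\<rho> g) = mat_trace (\<sigma> g)"
proof -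
  note KI = intertwiner_kernel_and_image[OF \<rho> \<sigma> T comm nz]
  have "\<exists>v \<in> carrier_vec m. T *\<^sub>v v = unit_vec n j" for j
    using KI(2) unit_vec_carrier[of n j] by (metis (no_types, lifting) imageE)
  then obtain s where s: "\<And>j. s j \<in> carrier_vec m" "\<And>j. T *\<^sub>v s j = unit_vec n j" by metis
  \<comment> \<open>Column j of \<open>S\<close> is a preimage under \<open>T\<close> of the j-th
    unit vector, which makes \<open>S\<close> a right inverse.\<close>
  define S where "S = mat m n (\<lambda>(i,j). s j $ i)"
  have S: "S \<in> carrier_mat m n" by (simp add: S_def)
  have colS: "col S j = s j" if "j < n" for j
    using s(1)[of j] that by (intro eq_vecI) (auto simp: S_def)
  have TS: "T * S = 1\<^sub>m n"
  proof (rule mat_col_eqI)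
    fix j assume "j < dim_col (1\<^sub>m n :: complex mat)"
    then show "col (T * S) j = col (1\<^sub>m n) j" using col_mult2[OF T S, of j] colS[of j] s by simp
  qed (use T S in auto)
  have ST: "S * T = 1\<^sub>m m"
  proof (rule mat_col_eqI)
    fix j assume "j < dim_col (1\<^sub>m m :: complex mat)"
    then have j: "j < m" by simp
    \<comment> \<open>\<open>T\<close> maps this difference to 0 because
      \<open>T * (S * T) = T\<close>; injectivity of \<open>T\<close> then makes \<open>S\<close> a
      left inverse as well.\<close>
    let ?v = "col (S * T) j - unit_vec m j"
    have c: "col (S * T) j \<in> carrier_vec m" using S T by (intro carrier_vecI) simp
    have "T *\<^sub>v col (S * T) j = col (T * (S * T)) j"
      using S T j by (intro col_mult2[symmetric]) auto
    also have "T * (S * T) = T" using TS T S by (metis assoc_mult_mat left_mult_one_mat)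
    also have "col T j = T *\<^sub>v unit_vec m j" using T j by (intro eq_vecI) auto
    finally have "T *\<^sub>v ?v = 0\<^sub>v n"
      using T c by (subst mult_minus_distrib_mat_vec) auto
    moreover have "?v \<in> carrier_vec m" using c by auto
    ultimately have v0: "?v = 0\<^sub>v m" using KI(1) by blast
    show "col (S * T) j = col (1\<^sub>m m) j"
    proof (rule eq_vecI)
      fix i assume "i < dim_vec (col (1\<^sub>m m :: complex mat) j)"
      then have i: "i < m" by simp
      have "?v $ i = 0" using v0 i by simp
      then show "col (S * T) j $ i = col (1\<^sub>m m) j $ i" using i j c by auto
    qed (use S T in auto)
  qed (use S T in auto)
  have r: "\<rho> g \<in> carrier_mat n n" "\<sigma> g \<in> carrier_mat m m"
    using irreducible_mat_rep[OF \<rho>] irreducible_mat_rep[OF \<sigma>] g by (auto simp: mat_rep_def)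
  have "mat_trace (\<rho> g) = mat_trace (\<rho> g * T * S)"
    using r T S TS by (simp add: assoc_mult_mat[OF r(1) T S])
  also have "\<dots> = mat_trace (T * (\<sigma> g * S))"
    using r T S comm[OF g] by (simp add: assoc_mult_mat[OF T r(2) S])
  also have "\<dots> = mat_trace (\<sigma> g * S * T)"
    using r T S by (intro mat_trace_mult_commute) auto
  also have "\<dots> = mat_trace (\<sigma> g)"
    using r T S ST by (simp add: assoc_mult_mat[OF r(2) S T])
  finally show ?thesis .
qed

text \<open>For an eigenvalue \<open>c\<close> of \<open>T\<close> the matrix \<open>T - c 1\<close>
  still commutes with the representation but has a nonzero kernel vector, so it must vanish.\<close>

lemma (in group) commuting_matrix_is_scalar:
  assumes \<rho>: "irrep n \<rho>"
    and T: "T \<in> carrier_mat n n" and comm: "\<And>g. g \<in> carrier G \<Longrightarrow> \<rho> g * T = T * \<rho> g"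
  obtains c where "T = c \<cdot>\<^sub>m 1\<^sub>m n"
proof -
  have n: "n > 0" using \<rho> by (simp add: is_irreducible_representation_def)
  obtain c where "c \<in> spectrum T" using spectrum_non_empty[OF T n] by auto
  then have "eigenvalue T c" by (simp add: spectrum_def)
  then obtain v where v: "v \<in> carrier_vec n" "v \<noteq> 0\<^sub>v n" "T *\<^sub>v v = c \<cdot>\<^sub>v v"
    using T by (auto simp: eigenvalue_def eigenvector_def)
  let ?S = "T - c \<cdot>\<^sub>m 1\<^sub>m n"
  have S: "?S \<in> carrier_mat n n" using T by auto
  have "?S = 0\<^sub>m n n"
  proof (rule ccontr)
    assume nz: "?S \<noteq> 0\<^sub>m n n"
    have "\<rho> g * ?S = ?S * \<rho> g" if g: "g \<in> carrier G" for g
    proof -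
      have r: "\<rho> g \<in> carrier_mat n n" using irreducible_mat_rep[OF \<rho>] g by (auto simp: mat_rep_def)
      show ?thesis using r T comm[OF g]
        by (subst mult_minus_distrib_mat[of _ n n], auto, subst minus_mult_distrib_mat[of _ n n], auto)
    qed
    from intertwiner_kernel_and_image(1)[OF \<rho> \<rho> S this nz]
    have "{v \<in> carrier_vec n. ?S *\<^sub>v v = 0\<^sub>v n} = {0\<^sub>v n}" by blast
    moreover have "?S *\<^sub>v v = T *\<^sub>v v - (c \<cdot>\<^sub>m 1\<^sub>m n) *\<^sub>v v"
      using T v by (intro minus_mult_distrib_mat_vec) auto
    then have "?S *\<^sub>v v = 0\<^sub>v n" using T v by auto
    ultimately show False using v by blast
  qed
  then have "T = c \<cdot>\<^sub>m 1\<^sub>m n"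
  proof (intro eq_matI)
    fix i j assume z: "?S = 0\<^sub>m n n" and ij: "i < dim_row (c \<cdot>\<^sub>m 1\<^sub>m n)" "j < dim_col (c \<cdot>\<^sub>m 1\<^sub>m n)"
    have "?S $$ (i,j) = 0" using z ij by simp
    then show "T $$ (i,j) = (c \<cdot>\<^sub>m 1\<^sub>m n) $$ (i,j)" using ij T by auto
  qed (use T in auto)
  then show thesis by (rule that)
qed

section \<open>Orthogonality of characters\<close>

lemma adapted_basis:
  fixes W :: "complex vec set"
  assumes sub: "VectorSpace.subspace class_ring W (module_vec TYPE(complex) n)"
    and nz: "W \<noteq> {0\<^sub>v n}" and nf: "W \<noteq> carrier_vec n"
  obtains P Q k where "P \<in> carrier_mat n n" "Q \<in> carrier_mat n n" "P * Q = 1\<^sub>m n" "Q * P = 1\<^sub>m n"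
    "0 < k" "k < n" "\<And>j. j < k \<Longrightarrow> col P j \<in> W"
    "\<And>w i. w \<in> W \<Longrightarrow> k \<le> i \<Longrightarrow> i < n \<Longrightarrow> (Q *\<^sub>v w) $ i = 0"
proof -
  interpret vec_space "TYPE(complex)" n .
  have WC: "W \<subseteq> carrier_vec n" and W0: "0\<^sub>v n \<in> W" and smW: "LinearCombinations.submodule class_ring W V"
    using sub by (auto simp: VectorSpace.subspace_def LinearCombinations.submodule_def module_vec_simps)
  have bnd: "finite S \<and> card S \<le> n" if "S \<subseteq> carrier_vec n" "lin_indpt S" for S
    using li_le_dim[of S] that dim_is_n fin_dim by auto
  have "lin_indpt {}" by (simp add: lin_dep_def)
  \<comment> \<open>A maximal independent subset \<open>A\<close> of \<open>W\<close> spans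
    \<open>W\<close>; enlarging it to a maximal independent set \<open>B\<close> gives a basis of
    the whole space. Independent sets have at most n elements, so both exist.\<close>
  then have "\<exists>A. finite A \<and> maximal A (\<lambda>S. S \<subseteq> W \<and> lin_indpt S)"
    using bnd WC by (intro maximal_exists[where N = n and B = "{}"]) (blast+)
  then obtain A where fA: "finite A" and mA: "maximal A (\<lambda>S. S \<subseteq> W \<and> lin_indpt S)" by blast
  have A: "finite A" "A \<subseteq> W" "lin_indpt A" using fA mA by (simp_all add: maximal_def)
  have Amax: "S = A" if "A \<subseteq> S" "S \<subseteq> W" "lin_indpt S" for S
    using mA that by (simp add: maximal_def)
  have "\<exists>B. finite B \<and> maximal B (\<lambda>S. A \<subseteq> S \<and> S \<subseteq> carrier_vec n \<and> lin_indpt S)"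
    using bnd A WC by (intro maximal_exists[where N = n and B = A]) (blast+)
  then obtain B where fB: "finite B"
    and mB: "maximal B (\<lambda>S. A \<subseteq> S \<and> S \<subseteq> carrier_vec n \<and> lin_indpt S)" by blast
  have B: "finite B" "A \<subseteq> B" "B \<subseteq> carrier_vec n" "lin_indpt B" using fB mB by (simp_all add: maximal_def)
  have Bmax: "S = B" if "B \<subseteq> S" "S \<subseteq> carrier_vec n" "lin_indpt S" for S
    using mB that subset_trans[OF B(2) that(1)] by (simp add: maximal_def)
  have basisB: "basis B"
    by (rule max_li_is_basis) (use B Bmax in \<open>auto simp: maximal_def\<close>)
  have cB: "card B = n" using dim_basis[OF B(1) basisB] dim_is_n by simp
  have spanA: "w \<in> span A" if w: "w \<in> W" for w
  proof (cases "w \<in> A")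
    case True
    then show ?thesis using A WC in_own_span[of A] by auto
  next
    case False
    have "\<not> lin_indpt (A \<union> {w})" using Amax[of "A \<union> {w}"] False A w by auto
    then show ?thesis using lin_dep_iff_in_span[of A w] A WC w False by auto
  qed
  have spanW: "span A \<subseteq> W" using span_is_subset[OF A(2) smW] by simp
  have "A \<noteq> {}"
  proof
    assume "A = {}"
    then have "W \<subseteq> {0\<^sub>v n}" using spanA span_empty by auto
    then show False using nz W0 by auto
  qed
  moreover have "A \<noteq> B" using basisB spanW WC nf by (auto simp: basis_def)
  ultimately have k: "0 < card A" "card A < n"
    using A(1) B(1,2) cB psubset_card_mono[of B A] by (auto simp: card_gt_0_iff)
  obtain xs where xs: "set xs = A" "distinct xs" using finite_distinct_list[OF A(1)] by auto
  obtain ys where ys: "set ys = B - A" "distinct ys" using finite_distinct_list[of "B - A"] B(1) by auto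
  have lx: "length xs = card A" using distinct_card[OF xs(2)] xs(1) by simp
  have zs: "set (xs @ ys) = B" "distinct (xs @ ys)" using xs ys B(2) by auto
  have lz: "length (xs @ ys) = n" using distinct_card[OF zs(2)] zs(1) cB by simp
  define P where "P = mat_of_cols n (xs @ ys)"
  have P: "P \<in> carrier_mat n n" using mat_of_cols_carrier(1)[of n "xs @ ys"] unfolding lz P_def .
  have colsP: "cols P = xs @ ys" unfolding P_def using zs(1) B(3) by (intro cols_mat_of_cols) auto
  have "rank P = n" using lin_indpt_full_rank[OF P] colsP zs B(4) by simp
  then have "det P \<noteq> 0" using det_rank_iff[OF P] by simp
  then have "P \<in> Units (ring_mat TYPE(complex) n ())" by (rule det_non_zero_imp_unit[OF P])
  then obtain Q where Q: "Q \<in> carrier_mat n n" "P * Q = 1\<^sub>m n" "Q * P = 1\<^sub>m n"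
    by (auto simp: Units_def ring_mat_simps)
  show thesis
  proof (rule that[OF P Q k])
    fix j assume j: "j < card A"
    have "col P j = xs ! j" using j lx lz k colsP P
      by (metis carrier_matD(2) cols_nth less_trans nth_append)
    then show "col P j \<in> W" using j lx xs(1) A(2) nth_mem[of j xs] by auto
  next
    fix w i assume w: "w \<in> W" and i: "card A \<le> i" "i < n"
    have "w \<in> span_list xs" using spanA[OF w] span_list_as_span[of xs] xs(1) A(2) WC by auto
    then obtain c where c: "w = lincomb_list c xs" by (auto simp: span_list_def)
    \<comment> \<open>The coordinates of \<open>w\<close> in the basis \<open>A\<close>, padded with
      zeros; they turn out to be \<open>Q *\<^sub>v w\<close>.\<close>
    define v where "v = vec n (\<lambda>i. if i < card A then c i else 0)"
    have "w = mat_of_cols n xs *\<^sub>v vec (length xs) c"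
      unfolding c using xs(1) A(2) WC
      by (intro lincomb_list_as_mat_mult ballI carrier_vecD) blast
    also have "\<dots> = P *\<^sub>v v"
    proof (rule eq_vecI)
      fix a assume "a < dim_vec (P *\<^sub>v v)"
      then have a: "a < n" using P by simp
      have "(P *\<^sub>v v) $ a = (\<Sum>j<n. P $$ (a,j) * v $ j)"
        using P a by (simp add: scalar_prod_def v_def atLeast0LessThan)
      also have "\<dots> = (\<Sum>j<card A. P $$ (a,j) * v $ j)"
        using k(2) by (intro sum.mono_neutral_right) (auto simp: v_def)
      also have "\<dots> = (\<Sum>j<card A. xs ! j $ a * c j)"
        using k(2) lx lz a by (intro sum.cong) (auto simp: v_def P_def mat_of_cols_def nth_append)
      finally show "(mat_of_cols n xs *\<^sub>v vec (length xs) c) $ a = (P *\<^sub>v v) $ a"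
        using a lx by (simp add: scalar_prod_def atLeast0LessThan mat_of_cols_def)
    qed (use P in simp)
    finally have w': "w = P *\<^sub>v v" .
    have v: "v \<in> carrier_vec n" by (simp add: v_def)
    have "Q *\<^sub>v w = (Q * P) *\<^sub>v v" unfolding w' by (rule assoc_mult_mat_vec[OF Q(1) P v, symmetric])
    also have "\<dots> = v" unfolding Q(3) using v by simp
    finally have "Q *\<^sub>v w = v" .
    then show "(Q *\<^sub>v w) $ i = 0" using i by (simp add: v_def)
  qed
qed

lemma (in group) mat_rep_entry_mult:
  assumes "mat_rep G n \<rho>" "g \<in> carrier G" "h \<in> carrier G" "i < n" "j < n"
  shows "\<rho> (g \<otimes> h) $$ (i,j) = (\<Sum>a<n. \<rho> g $$ (i,a) * \<rho> h $$ (a,j))"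
proof -
  have "\<rho> g \<in> carrier_mat n n" "\<rho> h \<in> carrier_mat n n"
    and "\<rho> (g \<otimes> h) = \<rho> g * \<rho> h" using assms(1-3) by (auto simp: mat_rep_def)
  then show ?thesis using assms(4,5) by (simp add: scalar_prod_def atLeast0LessThan)
qed

lemma (in group) mat_rep_conjugate:
  assumes \<rho>: "mat_rep G n \<rho>" and P: "P \<in> carrier_mat n n" and Q: "Q \<in> carrier_mat n n"
    and PQ: "P * Q = 1\<^sub>m n" and QP: "Q * P = 1\<^sub>m n"
  shows "mat_rep G n (\<lambda>g. Q * \<rho> g * P)"
    and "g \<in> carrier G \<Longrightarrow> mat_trace (Q * \<rho> g * P) = mat_trace (\<rho> g)"
proof -
  have r: "\<rho> g \<in> carrier_mat n n" if "g \<in> carrier G" for g using \<rho> that by (auto simp: mat_rep_def)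
  show "mat_rep G n (\<lambda>g. Q * \<rho> g * P)"
    unfolding mat_rep_def
  proof (intro conjI ballI)
    show "Q * \<rho> g * P \<in> carrier_mat n n" if "g \<in> carrier G" for g using r[OF that] P Q by auto
    show "Q * \<rho> \<one> * P = 1\<^sub>m n" using \<rho> P Q QP by (simp add: mat_rep_def)
    fix g h assume gh: "g \<in> carrier G" "h \<in> carrier G"
    note c = r[OF gh(1)] r[OF gh(2)]
    have "Q * \<rho> g * P * (Q * \<rho> h * P) = Q * \<rho> g * (P * Q) * (\<rho> h * P)"
      using c P Q by (simp add: assoc_mult_mat[of _ n n _ n _ n])
    also have "\<dots> = Q * (\<rho> g * \<rho> h) * P"
      unfolding PQ(1) using c P Q by (simp add: assoc_mult_mat[of _ n n _ n _ n])
    also have "\<rho> g * \<rho> h = \<rho> (g \<otimes> h)" using \<rho> gh by (simp add: mat_rep_def)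
    finally show "Q * \<rho> (g \<otimes> h) * P = Q * \<rho> g * P * (Q * \<rho> h * P)" by simp
  qed
  assume g: "g \<in> carrier G"
  have "mat_trace (Q * \<rho> g * P) = mat_trace (P * (Q * \<rho> g))"
    using r[OF g] P Q by (intro mat_trace_mult_commute) auto
  also have "P * (Q * \<rho> g) = \<rho> g" using r[OF g] P Q PQ by (simp add: assoc_mult_mat[of _ n n _ n _ n, symmetric])
  finally show "mat_trace (Q * \<rho> g * P) = mat_trace (\<rho> g)" .
qed

text \<open>The condition \<open>zero\<close> discards the terms of a matrix product that leave the
  block. Stated as a product, it serves both diagonal blocks of a block triangular representation:
  for one the right factor vanishes, for the other the left factor.\<close>

lemma (in group) mat_rep_diagonal_block:
  assumes \<rho>: "mat_rep G n \<rho>" and m: "r + m \<le> n"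
    and zero: "\<And>g h i a j. g \<in> carrier G \<Longrightarrow> h \<in> carrier G \<Longrightarrow> i < m \<Longrightarrow> j < m \<Longrightarrow> a < n \<Longrightarrow>
      a < r \<or> r + m \<le> a \<Longrightarrow> \<rho> g $$ (r + i, a) * \<rho> h $$ (a, r + j) = 0"
  shows "mat_rep G m (\<lambda>g. mat m m (\<lambda>(i,j). \<rho> g $$ (r + i, r + j)))" (is "mat_rep G m ?M")
  unfolding mat_rep_def
proof (intro conjI ballI)
  show "?M \<one> = 1\<^sub>m m"
    using \<rho> m by (intro eq_matI) (auto simp: mat_rep_def)
  fix g h assume gh: "g \<in> carrier G" "h \<in> carrier G"
  show "?M (g \<otimes> h) = ?M g * ?M h"
  proof (rule eq_matI)
    fix i j assume "i < dim_row (?M g * ?M h)" "j < dim_col (?M g * ?M h)"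
    then have ij: "i < m" "j < m" by auto
    have "\<rho> (g \<otimes> h) $$ (r + i, r + j) = (\<Sum>a<n. \<rho> g $$ (r + i, a) * \<rho> h $$ (a, r + j))"
      using mat_rep_entry_mult[OF \<rho> gh] ij m by simp
    also have "\<dots> = (\<Sum>a\<in>{r..<r + m}. \<rho> g $$ (r + i, a) * \<rho> h $$ (a, r + j))"
    proof (rule sum.mono_neutral_right)
      show "\<forall>a\<in>{..<n} - {r..<r + m}. \<rho> g $$ (r + i, a) * \<rho> h $$ (a, r + j) = 0"
      proof
        fix a assume "a \<in> {..<n} - {r..<r + m}"
        then have "a < n" "a < r \<or> r + m \<le> a" by auto
        then show "\<rho> g $$ (r + i, a) * \<rho> h $$ (a, r + j) = 0" by (rule zero[OF gh ij])
      qed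
    qed (use m in auto)
    also have "\<dots> = (\<Sum>a<m. \<rho> g $$ (r + i, r + a) * \<rho> h $$ (r + a, r + j))"
      by (rule sum.reindex_bij_witness[of _ "\<lambda>a. r + a" "\<lambda>a. a - r"]) auto
    finally show "?M (g \<otimes> h) $$ (i,j) = (?M g * ?M h) $$ (i,j)"
      using ij by (simp add: scalar_prod_def atLeast0LessThan)
  qed auto
qed auto

lemma mat_trace_diagonal_blocks:
  assumes "M \<in> carrier_mat n n" "k \<le> n"
  shows "mat_trace M = mat_trace (mat k k (\<lambda>(i,j). M $$ (0 + i, 0 + j))) +
    mat_trace (mat (n - k) (n - k) (\<lambda>(i,j). M $$ (k + i, k + j)))"
proof -
  have "(\<Sum>a<n. M $$ (a,a)) = (\<Sum>a<k. M $$ (a,a)) + (\<Sum>a\<in>{k..<n}. M $$ (a,a))"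
    using assms(2) by (subst sum.union_disjoint[symmetric]) (auto intro!: sum.cong)
  also have "(\<Sum>a\<in>{k..<n}. M $$ (a,a)) = (\<Sum>a<n - k. M $$ (k + a, k + a))"
    using assms(2) by (intro sum.reindex_bij_witness[of _ "\<lambda>a. k + a" "\<lambda>a. a - k"]) auto
  finally show ?thesis using assms(1) by (simp add: mat_trace_def)
qed

text \<open>In a basis adapted to an invariant subspace the matrices are block triangular, and the
  trace sees only the two diagonal blocks, which are smaller representations. The list keeps
  multiplicities.\<close>

lemma (in group) trace_sum_of_irreducibles:
  assumes "mat_rep G n \<rho>"
  shows "\<exists>xs. set xs \<subseteq> Irr G \<and> (\<forall>g \<in> carrier G. mat_trace (\<rho> g) = (\<Sum>\<chi>\<leftarrow>xs. \<chi> g))"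
  using assms
proof (induction n arbitrary: \<rho> rule: less_induct)
  case (less n \<rho>)
  note \<rho> = less.prems
  have r: "\<rho> g \<in> carrier_mat n n" if "g \<in> carrier G" for g using \<rho> that by (auto simp: mat_rep_def)
  consider "n = 0" | "irrep n \<rho>" | "n > 0" "\<not> irrep n \<rho>"
    by auto
  then show ?case
  proof cases
    case 1
    then have "mat_trace (\<rho> g) = 0" if "g \<in> carrier G" for g using r[OF that] by (simp add: mat_trace_def)
    then show ?thesis by (intro exI[of _ "[]"]) simp
  next
    case 2
    then show ?thesis
      by (intro exI[of _ "[character_of G \<rho>]"]) (auto simp: Irr_def character_of_def)
  next
    case 3
    then obtain W where W: "is_invariant_subspace G n \<rho> W" "W \<noteq> {0\<^sub>v n}" "W \<noteq> carrier_vec n"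
      using \<rho> by (auto simp: is_irreducible_representation_def is_representation_iff)
    from W(1) have sub: "VectorSpace.subspace class_ring W (module_vec TYPE(complex) n)"
      and inv: "\<And>g w. g \<in> carrier G \<Longrightarrow> w \<in> W \<Longrightarrow> \<rho> g *\<^sub>v w \<in> W"
      by (auto simp: is_invariant_subspace_def)
    from adapted_basis[OF sub W(2,3)] obtain P Q k where
      P: "P \<in> carrier_mat n n" and Q: "Q \<in> carrier_mat n n" and PQ: "P * Q = 1\<^sub>m n" "Q * P = 1\<^sub>m n"
      and k: "0 < k" "k < n" and cP: "\<And>j. j < k \<Longrightarrow> col P j \<in> W"
      and zQ: "\<And>w i. w \<in> W \<Longrightarrow> k \<le> i \<Longrightarrow> i < n \<Longrightarrow> (Q *\<^sub>v w) $ i = 0" by metis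
    define \<sigma> where "\<sigma> = (\<lambda>g. Q * \<rho> g * P)"
    have \<sigma>: "mat_rep G n \<sigma>" unfolding \<sigma>_def by (rule mat_rep_conjugate[OF \<rho> P Q PQ])
    have tr: "mat_trace (\<sigma> g) = mat_trace (\<rho> g)" if "g \<in> carrier G" for g
      unfolding \<sigma>_def by (rule mat_rep_conjugate(2)[OF \<rho> P Q PQ that])
    \<comment> \<open>The lower left block vanishes: column j of \<open>P\<close> lies in
      \<open>W\<close>, so does its image under \<open>\<rho> g\<close>, and \<open>Q\<close> gives
      elements of \<open>W\<close> zero coordinates from k on.\<close>
    have z: "\<sigma> g $$ (i,j) = 0" if g: "g \<in> carrier G" and i: "k \<le> i" "i < n" and j: "j < k" for g i j
    proof -
      have "\<sigma> g = Q * (\<rho> g * P)" using P Q r[OF g] by (simp add: \<sigma>_def)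
      moreover have "(Q * (\<rho> g * P)) $$ (i,j) = (Q *\<^sub>v col (\<rho> g * P) j) $ i"
        using P Q r[OF g] i j k by simp
      moreover have "col (\<rho> g * P) j = \<rho> g *\<^sub>v col P j"
        using P r[OF g] j k by (intro col_mult2[where n = n and nc = n]) auto
      ultimately show ?thesis using zQ[OF inv[OF g cP[OF j]] i] by simp
    qed
    have bl: "mat_rep G k (\<lambda>g. mat k k (\<lambda>(i,j). \<sigma> g $$ (0 + i, 0 + j)))"
      using k z by (intro mat_rep_diagonal_block[OF \<sigma>]) auto
    have br: "mat_rep G (n - k) (\<lambda>g. mat (n - k) (n - k) (\<lambda>(i,j). \<sigma> g $$ (k + i, k + j)))"
      using k z by (intro mat_rep_diagonal_block[OF \<sigma>]) auto
    obtain xs where xs: "set xs \<subseteq> Irr G" "\<forall>g \<in> carrier G.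
        mat_trace (mat k k (\<lambda>(i,j). \<sigma> g $$ (0 + i, 0 + j))) = (\<Sum>\<chi>\<leftarrow>xs. \<chi> g)"
      using less.IH[OF k(2) bl] by blast
    have "n - k < n" using k by auto
    from less.IH[OF this br] obtain ys where ys: "set ys \<subseteq> Irr G" "\<forall>g \<in> carrier G.
        mat_trace (mat (n - k) (n - k) (\<lambda>(i,j). \<sigma> g $$ (k + i, k + j))) = (\<Sum>\<chi>\<leftarrow>ys. \<chi> g)" by blast
    have "mat_trace (\<rho> g) = (\<Sum>\<chi>\<leftarrow>xs @ ys. \<chi> g)" if g: "g \<in> carrier G" for g
      using mat_trace_diagonal_blocks[of "\<sigma> g" n k] \<sigma> k xs(2) ys(2) tr[OF g] g by (simp add: mat_rep_def)
    then show ?thesis using xs(1) ys(1) by (intro exI[of _ "xs @ ys"]) simp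
  qed
qed

section \<open>Averaged matrix units and the orthogonality relations\<close>

context finite_group
begin

lemma sum_left_translate:
  "h \<in> carrier G \<Longrightarrow> (\<Sum>g\<in>carrier G. f (h \<otimes> g)) = (\<Sum>g\<in>carrier G. f g)"
  by (rule sum.reindex_bij_witness[of _ "\<lambda>g. inv h \<otimes> g" "\<lambda>g. h \<otimes> g"]) (auto simp: m_assoc[symmetric])

lemma sum_right_translate:
  "h \<in> carrier G \<Longrightarrow> (\<Sum>g\<in>carrier G. f (g \<otimes> h)) = (\<Sum>g\<in>carrier G. f g)"
  by (rule sum.reindex_bij_witness[of _ "\<lambda>g. g \<otimes> inv h" "\<lambda>g. g \<otimes> h"]) (auto simp: m_assoc)

text \<open>The matrix sum over g of \<open>\<rho> g * E * \<sigma> (inv g)\<close>, where E is the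
  matrix unit with its single 1 at (k,l).\<close>

definition avg_unit where
  "avg_unit n m \<rho> \<sigma> k l =
     mat n m (\<lambda>(i,j). \<Sum>g\<in>carrier G. \<rho> g $$ (i,k) * \<sigma> (inv g) $$ (l,j) :: complex)"

lemma avg_unit_intertwines:
  assumes \<rho>: "mat_rep G n \<rho>" and \<sigma>: "mat_rep G m \<sigma>" and kl: "k < n" "l < m" and h: "h \<in> carrier G"
  shows "\<rho> h * avg_unit n m \<rho> \<sigma> k l = avg_unit n m \<rho> \<sigma> k l * \<sigma> h"
proof (rule eq_matI)
  have r: "\<rho> h \<in> carrier_mat n n" "\<sigma> h \<in> carrier_mat m m"
    using \<rho> \<sigma> h by (auto simp: mat_rep_def)
  let ?T = "avg_unit n m \<rho> \<sigma> k l"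
  fix i j assume "i < dim_row (?T * \<sigma> h)" "j < dim_col (?T * \<sigma> h)"
  then have ij: "i < n" "j < m" using r by (auto simp: avg_unit_def)
  have "(\<rho> h * ?T) $$ (i,j) = (\<Sum>a<n. \<Sum>g\<in>carrier G. \<rho> h $$ (i,a) * (\<rho> g $$ (a,k) * \<sigma> (inv g) $$ (l,j)))"
    using r ij by (simp add: avg_unit_def scalar_prod_def atLeast0LessThan sum_distrib_left)
  also have "\<dots> = (\<Sum>g\<in>carrier G. (\<Sum>a<n. \<rho> h $$ (i,a) * \<rho> g $$ (a,k)) * \<sigma> (inv g) $$ (l,j))"
    by (subst sum.swap) (simp add: sum_distrib_right mult.assoc)
  also have "\<dots> = (\<Sum>g\<in>carrier G. \<rho> (h \<otimes> g) $$ (i,k) * \<sigma> (inv g) $$ (l,j))"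
    using mat_rep_entry_mult[OF \<rho> h] ij kl by (intro sum.cong) auto
  \<comment> \<open>Writing \<open>inv g\<close> as \<open>inv (h \<otimes> g) \<otimes> h\<close>
    makes the summand a function of \<open>h \<otimes> g\<close>, so that left translation
    applies.\<close>
  also have "\<dots> = (\<Sum>g\<in>carrier G. \<rho> (h \<otimes> g) $$ (i,k) * \<sigma> (inv (h \<otimes> g) \<otimes> h) $$ (l,j))"
    using h by (intro sum.cong) (auto simp: inv_mult_group m_assoc)
  also have "\<dots> = (\<Sum>g\<in>carrier G. \<rho> g $$ (i,k) * \<sigma> (inv g \<otimes> h) $$ (l,j))"
    by (rule sum_left_translate[OF h, of "\<lambda>g. \<rho> g $$ (i,k) * \<sigma> (inv g \<otimes> h) $$ (l,j)"])
  also have "\<dots> = (\<Sum>g\<in>carrier G. \<Sum>a<m. \<rho> g $$ (i,k) * \<sigma> (inv g) $$ (l,a) * \<sigma> h $$ (a,j))"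
    using mat_rep_entry_mult[OF \<sigma> _ h] ij kl by (intro sum.cong) (auto simp: sum_distrib_left mult.assoc)
  also have "\<dots> = (?T * \<sigma> h) $$ (i,j)"
    using r ij
    by (subst sum.swap) (simp add: avg_unit_def scalar_prod_def atLeast0LessThan sum_distrib_right)
  finally show "(\<rho> h * ?T) $$ (i,j) = (?T * \<sigma> h) $$ (i,j)" .
next
  have r: "\<rho> h \<in> carrier_mat n n" "\<sigma> h \<in> carrier_mat m m"
    using \<rho> \<sigma> h by (auto simp: mat_rep_def)
  show "dim_row (\<rho> h * avg_unit n m \<rho> \<sigma> k l) = dim_row (avg_unit n m \<rho> \<sigma> k l * \<sigma> h)"
   "dim_col (\<rho> h * avg_unit n m \<rho> \<sigma> k l) = dim_col (avg_unit n m \<rho> \<sigma> k l * \<sigma> h)"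
    using r by (auto simp: avg_unit_def)
qed

text \<open>The (k,l) entry of \<open>\<rho> g * E * \<sigma> (inv g)\<close>, with E the matrix
  unit at (k,l), is the product of the k-th and l-th diagonal entries; summing over k and l gives
  the product of the traces.\<close>

lemma trace_product_sum:
  assumes \<rho>: "mat_rep G n \<rho>" and \<sigma>: "mat_rep G m \<sigma>"
  shows "(\<Sum>g\<in>carrier G. mat_trace (\<rho> g) * mat_trace (\<sigma> (inv g))) =
    (\<Sum>k<n. \<Sum>l<m. avg_unit n m \<rho> \<sigma> k l $$ (k,l))"
proof -
  have r: "dim_row (\<rho> g) = n" "dim_row (\<sigma> g) = m" if "g \<in> carrier G" for g
    using \<rho> \<sigma> that by (auto simp: mat_rep_def)
  have "(\<Sum>g\<in>carrier G. mat_trace (\<rho> g) * mat_trace (\<sigma> (inv g))) =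
    (\<Sum>g\<in>carrier G. \<Sum>k<n. \<Sum>l<m. \<rho> g $$ (k,k) * \<sigma> (inv g) $$ (l,l))"
    using r by (intro sum.cong) (auto simp: mat_trace_def sum_product)
  also have "\<dots> = (\<Sum>k<n. \<Sum>g\<in>carrier G. \<Sum>l<m. \<rho> g $$ (k,k) * \<sigma> (inv g) $$ (l,l))"
    by (rule sum.swap)
  also have "\<dots> = (\<Sum>k<n. \<Sum>l<m. \<Sum>g\<in>carrier G. \<rho> g $$ (k,k) * \<sigma> (inv g) $$ (l,l))"
    by (intro sum.cong refl sum.swap)
  also have "\<dots> = (\<Sum>k<n. \<Sum>l<m. avg_unit n m \<rho> \<sigma> k l $$ (k,l))"
    by (intro sum.cong) (auto simp: avg_unit_def)
  finally show ?thesis .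
qed

text \<open>Distinct characters admit no nonzero intertwiner, so all averaged matrix units vanish.
  The value at \<open>inv g\<close> stands where the usual inner product has a complex
  conjugate.\<close>

lemma Irr_orthogonal:
  assumes "\<chi> \<in> Irr G" "\<psi> \<in> Irr G" "\<chi> \<noteq> \<psi>"
  shows "(\<Sum>g\<in>carrier G. \<chi> g * \<psi> (inv g)) = 0"
proof -
  from assms obtain n m \<rho> \<sigma> where \<rho>: "irrep n \<rho>" "\<chi> = character_of G \<rho>"
    and \<sigma>: "irrep m \<sigma>" "\<psi> = character_of G \<sigma>"
    by (auto simp: Irr_def)
  note r = irreducible_mat_rep[OF \<rho>(1)] irreducible_mat_rep[OF \<sigma>(1)]
  have "avg_unit n m \<rho> \<sigma> k l = 0\<^sub>m n m" if kl: "k < n" "l < m" for k l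
  proof (rule ccontr)
    assume nz: "avg_unit n m \<rho> \<sigma> k l \<noteq> 0\<^sub>m n m"
    have "mat_trace (\<rho> g) = mat_trace (\<sigma> g)" if "g \<in> carrier G" for g
      by (rule nonzero_intertwiner_imp_same_trace[OF \<rho>(1) \<sigma>(1) _ _ nz that])
        (auto simp: avg_unit_intertwines[OF r kl], simp add: avg_unit_def)
    then show False using assms(3) \<rho>(2) \<sigma>(2) by (auto simp: character_of_def)
  qed
  then have "(\<Sum>g\<in>carrier G. mat_trace (\<rho> g) * mat_trace (\<sigma> (inv g))) = 0"
    by (simp add: trace_product_sum[OF r])
  then show ?thesis unfolding \<rho>(2) \<sigma>(2) by (simp add: character_of_def)
qed

lemma Irr_norm:
  assumes "\<chi> \<in> Irr G"
  shows "(\<Sum>g\<in>carrier G. \<chi> g * \<chi> (inv g)) = of_nat (card (carrier G))"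
proof -
  from assms obtain n \<rho> where \<rho>: "irrep n \<rho>" "\<chi> = character_of G \<rho>"
    by (auto simp: Irr_def)
  note r = irreducible_mat_rep[OF \<rho>(1)]
  have n: "n > 0" using \<rho>(1) by (simp add: is_irreducible_representation_def)
  have "avg_unit n n \<rho> \<rho> k l $$ (k,l) = (if k = l then of_nat (card (carrier G)) / of_nat n else 0)"
    if kl: "k < n" "l < n" for k l
  proof -
    let ?T = "avg_unit n n \<rho> \<rho> k l"
    obtain c where c: "?T = c \<cdot>\<^sub>m 1\<^sub>m n"
      by (rule commuting_matrix_is_scalar[OF \<rho>(1), of ?T])
        (auto simp: avg_unit_intertwines[OF r r kl], simp add: avg_unit_def)
    \<comment> \<open>The scalar is read off from the trace:
      \<open>\<rho> (inv g) * \<rho> g\<close> is the identity, so each group element contributes 1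
      if k = l and 0 otherwise.\<close>
    have "of_nat n * c = mat_trace ?T" by (simp add: c mat_trace_smult_one)
    also have "\<dots> = (\<Sum>i<n. \<Sum>g\<in>carrier G. \<rho> g $$ (i,k) * \<rho> (inv g) $$ (l,i))"
      by (simp add: avg_unit_def mat_trace_def)
    also have "\<dots> = (\<Sum>g\<in>carrier G. \<Sum>i<n. \<rho> (inv g) $$ (l,i) * \<rho> g $$ (i,k))"
      by (subst sum.swap) (simp add: mult.commute)
    also have "\<dots> = (\<Sum>g\<in>carrier G. \<rho> (inv g \<otimes> g) $$ (l,k))"
      using kl mat_rep_entry_mult[OF r, of "inv _", symmetric] by (intro sum.cong) (simp_all del: l_inv)
    also have "\<dots> = (\<Sum>g\<in>carrier G. if k = l then 1 else 0)"
      using kl r by (intro sum.cong) (auto simp: mat_rep_def)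
    finally have "c = (if k = l then of_nat (card (carrier G)) / of_nat n else 0)"
      using n by (auto simp: field_simps)
    then show ?thesis using kl by (simp add: c)
  qed
  then have "(\<Sum>g\<in>carrier G. mat_trace (\<rho> g) * mat_trace (\<rho> (inv g))) =
     (\<Sum>k<n. \<Sum>l<n. if k = l then of_nat (card (carrier G)) / of_nat n else 0)"
    by (simp add: trace_product_sum[OF r r])
  also have "\<dots> = of_nat (card (carrier G))" using n by (simp add: sum.delta')
  finally show ?thesis unfolding \<rho>(2) by (simp add: character_of_def)
qed

end

section \<open>Kernels, degrees and the sum of squares\<close>

lemma sum_list_by_count:
  fixes f :: "'a \<Rightarrow> 'b::semiring_1"
  assumes "finite A" "set xs \<subseteq> A"
  shows "(\<Sum>x\<leftarrow>xs. f x) = (\<Sum>x\<in>A. of_nat (count_list xs x) * f x)"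
  using assms(2)
proof (induction xs)
  case (Cons a xs)
  have "(\<Sum>x\<in>A. of_nat (count_list (a # xs) x) * f x) =
      (\<Sum>x\<in>A. (if a = x then f x else 0) + of_nat (count_list xs x) * f x)"
    by (intro sum.cong) (auto simp: distrib_right)
  also have "\<dots> = f a + (\<Sum>x\<in>A. of_nat (count_list xs x) * f x)"
    using assms(1) Cons.prems by (simp add: sum.distrib)
  finally show ?case using Cons by simp
qed simp

text \<open>A natural number version of the complex value at the identity; \<open>Irr_one\<close>
  shows that rounding loses nothing for irreducible characters.\<close>

definition chi_degree :: "('a, 'b) monoid_scheme \<Rightarrow> ('a \<Rightarrow> complex) \<Rightarrow> nat" where
  "chi_degree G \<chi> = nat \<lfloor>Re (\<chi> \<one>\<^bsub>G\<^esub>)\<rfloor>"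

lemma (in group) trace_conjugate:
  assumes \<rho>: "mat_rep G n \<rho>" and gh: "g \<in> carrier G" "h \<in> carrier G"
  shows "mat_trace (\<rho> (h \<otimes> g \<otimes> inv h)) = mat_trace (\<rho> g)"
proof -
  have r: "\<rho> x \<in> carrier_mat n n" if "x \<in> carrier G" for x using \<rho> that by (auto simp: mat_rep_def)
  have "mat_trace (\<rho> (h \<otimes> g \<otimes> inv h)) = mat_trace (\<rho> (h \<otimes> g) * \<rho> (inv h))"
    using \<rho> gh by (simp add: mat_rep_def)
  also have "\<dots> = mat_trace (\<rho> (inv h) * \<rho> (h \<otimes> g))"
    using r gh by (intro mat_trace_mult_commute[where n = n and m = n]) auto
  also have "\<rho> (inv h) * \<rho> (h \<otimes> g) = \<rho> (inv h \<otimes> (h \<otimes> g))"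
    using \<rho> gh by (simp add: mat_rep_def del: inv_solve_left inv_solve_left')
  also have "inv h \<otimes> (h \<otimes> g) = g" using gh by (simp add: m_assoc[symmetric])
  finally show ?thesis .
qed

context finite_group
begin

abbreviation ker where "ker \<equiv> char_kernel G"
abbreviation deg where "deg \<equiv> chi_degree G"
abbreviation idx where "idx H \<equiv> card (rcosets H)"

text \<open>The hypothesis \<open>inv\<close> makes the sum of the matrices
  \<open>\<rho> (u x)\<close> commute with the representation, so Schur's lemma makes it scalar. An
  indexed family is used because it is applied both to the conjugates of one element, with
  repetitions, and to a normal subgroup.\<close>

lemma irreducible_sum_scalar:
  assumes \<rho>: "irrep n \<rho>" and u: "\<And>x. x \<in> I \<Longrightarrow> u x \<in> carrier G"
    and inv: "\<And>k f. k \<in> carrier G \<Longrightarrow> (\<Sum>x\<in>I. f (k \<otimes> u x) :: complex) = (\<Sum>x\<in>I. f (u x \<otimes> k))"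
  obtains c where "of_nat n * c = (\<Sum>x\<in>I. mat_trace (\<rho> (u x)))"
    "\<And>i j. i < n \<Longrightarrow> j < n \<Longrightarrow> (\<Sum>x\<in>I. \<rho> (u x) $$ (i,j)) = (if i = j then c else 0)"
    "\<And>k i j. k \<in> carrier G \<Longrightarrow> i < n \<Longrightarrow> j < n \<Longrightarrow> (\<Sum>x\<in>I. \<rho> (u x \<otimes> k) $$ (i,j)) = c * \<rho> k $$ (i,j)"
proof -
  note r = irreducible_mat_rep[OF \<rho>]
  define M where "M = mat n n (\<lambda>(i,j). \<Sum>x\<in>I. \<rho> (u x) $$ (i,j))"
  have M: "M \<in> carrier_mat n n" by (simp add: M_def)
  have rk: "\<rho> k \<in> carrier_mat n n" if "k \<in> carrier G" for k using r that by (auto simp: mat_rep_def)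
  have left: "(\<rho> k * M) $$ (i,j) = (\<Sum>x\<in>I. \<rho> (k \<otimes> u x) $$ (i,j))"
    and right: "(M * \<rho> k) $$ (i,j) = (\<Sum>x\<in>I. \<rho> (u x \<otimes> k) $$ (i,j))"
    if k: "k \<in> carrier G" and ij: "i < n" "j < n" for k i j
  proof -
    have "(\<rho> k * M) $$ (i,j) = (\<Sum>a<n. \<Sum>x\<in>I. \<rho> k $$ (i,a) * \<rho> (u x) $$ (a,j))"
      using rk[OF k] ij by (simp add: M_def scalar_prod_def atLeast0LessThan sum_distrib_left)
    also have "\<dots> = (\<Sum>x\<in>I. \<rho> (k \<otimes> u x) $$ (i,j))"
      using mat_rep_entry_mult[OF r k] ij u by (subst sum.swap) (intro sum.cong, auto)
    finally show "(\<rho> k * M) $$ (i,j) = (\<Sum>x\<in>I. \<rho> (k \<otimes> u x) $$ (i,j))" .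
    have "(M * \<rho> k) $$ (i,j) = (\<Sum>a<n. \<Sum>x\<in>I. \<rho> (u x) $$ (i,a) * \<rho> k $$ (a,j))"
      using rk[OF k] ij by (simp add: M_def scalar_prod_def atLeast0LessThan sum_distrib_right)
    also have "\<dots> = (\<Sum>x\<in>I. \<rho> (u x \<otimes> k) $$ (i,j))"
      using mat_rep_entry_mult[OF r _ k] ij u by (subst sum.swap) (intro sum.cong, auto)
    finally show "(M * \<rho> k) $$ (i,j) = (\<Sum>x\<in>I. \<rho> (u x \<otimes> k) $$ (i,j))" .
  qed
  have comm: "\<rho> k * M = M * \<rho> k" if k: "k \<in> carrier G" for k
  proof (rule eq_matI)
    show "dim_row (\<rho> k * M) = dim_row (M * \<rho> k)" "dim_col (\<rho> k * M) = dim_col (M * \<rho> k)"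
      using rk[OF k] M by auto
    fix i j assume "i < dim_row (M * \<rho> k)" "j < dim_col (M * \<rho> k)"
    then have ij: "i < n" "j < n" using rk[OF k] M by auto
    show "(\<rho> k * M) $$ (i,j) = (M * \<rho> k) $$ (i,j)"
      unfolding left[OF k ij] right[OF k ij] by (rule inv[OF k])
  qed
  obtain c where c: "M = c \<cdot>\<^sub>m 1\<^sub>m n" by (rule commuting_matrix_is_scalar[OF \<rho> M comm])
  show thesis
  proof (rule that[of c])
    have "of_nat n * c = mat_trace M" by (simp add: c mat_trace_smult_one)
    also have "\<dots> = (\<Sum>x\<in>I. \<Sum>i<n. \<rho> (u x) $$ (i,i))"
      by (subst sum.swap) (simp add: M_def mat_trace_def)
    also have "\<dots> = (\<Sum>x\<in>I. mat_trace (\<rho> (u x)))"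
      using rk u by (intro sum.cong refl) (simp add: mat_trace_def carrier_matD(1)[OF rk])
    finally show "of_nat n * c = (\<Sum>x\<in>I. mat_trace (\<rho> (u x)))" .
    show "(\<Sum>x\<in>I. \<rho> (u x) $$ (i,j)) = (if i = j then c else 0)" if ij: "i < n" "j < n" for i j
    proof -
      have "(\<Sum>x\<in>I. \<rho> (u x) $$ (i,j)) = M $$ (i,j)" using ij by (simp add: M_def)
      then show ?thesis using ij by (simp add: c)
    qed
    show "(\<Sum>x\<in>I. \<rho> (u x \<otimes> k) $$ (i,j)) = c * \<rho> k $$ (i,j)"
      if "k \<in> carrier G" "i < n" "j < n" for k i j
      using right[OF that] rk[OF that(1)] that(2,3) by (simp add: c)
  qed
qed

text \<open>
  If \<open>g\<close> has trace \<open>n\<close>, the sum of its conjugates is scalar by Schur's lemma, hence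
  \<open>|G|\<close> times the identity. For the norm averaged over \<open>G\<close> the conjugates are isometries, and
  isometries whose mean is the identity are all equal to the identity.
\<close>

lemma irreducible_kernel:
  assumes \<rho>: "irrep n \<rho>" and g: "g \<in> carrier G"
    and tr: "mat_trace (\<rho> g) = of_nat n"
  shows "\<rho> g = 1\<^sub>m n"
proof -
  note r = irreducible_mat_rep[OF \<rho>]
  have n: "n > 0" using \<rho> by (simp add: is_irreducible_representation_def)
  let ?x = "\<lambda>h. h \<otimes> g \<otimes> inv h"
  have conj: "(\<Sum>h\<in>carrier G. f (k \<otimes> ?x h) :: complex) = (\<Sum>h\<in>carrier G. f (?x h \<otimes> k))"
    if k: "k \<in> carrier G" for k f
  proof -
    have "k \<otimes> ?x h = ?x (k \<otimes> h) \<otimes> k" if "h \<in> carrier G" for h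
      using k g that by (simp add: inv_mult_group m_assoc)
    then have "(\<Sum>h\<in>carrier G. f (k \<otimes> ?x h)) = (\<Sum>h\<in>carrier G. f (?x (k \<otimes> h) \<otimes> k))" by simp
    also have "\<dots> = (\<Sum>h\<in>carrier G. f (?x h \<otimes> k))"
      by (rule sum_left_translate[OF k, of "\<lambda>h. f (?x h \<otimes> k)"])
    finally show ?thesis .
  qed
  obtain c where c: "of_nat n * c = (\<Sum>h\<in>carrier G. mat_trace (\<rho> (?x h)))"
    "\<And>i j. i < n \<Longrightarrow> j < n \<Longrightarrow> (\<Sum>h\<in>carrier G. \<rho> (?x h) $$ (i,j)) = (if i = j then c else 0)"
  proof (rule irreducible_sum_scalar[OF \<rho>, of "carrier G" ?x])
    show "?x h \<in> carrier G" if "h \<in> carrier G" for h using that g by simp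
  qed (rule conj, assumption, rule that)
  have "c = of_nat (card (carrier G))" using c(1) trace_conjugate[OF r g] tr n by simp
  note mean = c(2)[unfolded this]
  have "\<rho> g $$ (i,j) = \<rho> \<one> $$ (i,j)" if ij: "i < n" "j < n" for i j
  proof -
    let ?f = "\<lambda>u. \<rho> u $$ (i,j)"
    have sq: "(cmod (a - b))\<^sup>2 = (cmod a)\<^sup>2 + (cmod b)\<^sup>2 - 2 * Re (cnj b * a)" for a b :: complex
      unfolding cmod_power2 by (simp add: power2_eq_square algebra_simps)
    let ?S = "\<Sum>u\<in>carrier G. (cmod (?f u))\<^sup>2"
    have iso: "(\<Sum>u\<in>carrier G. (cmod (?f (u \<otimes> ?x h)))\<^sup>2) = ?S" if "h \<in> carrier G" for h
      using that g by (intro sum_right_translate[of "?x h" "\<lambda>u. (cmod (?f u))\<^sup>2"]) auto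
    have "(\<Sum>h\<in>carrier G. \<Sum>u\<in>carrier G. cnj (?f u) * ?f (u \<otimes> ?x h)) =
        (\<Sum>u\<in>carrier G. cnj (?f u) * (\<Sum>h\<in>carrier G. ?f (u \<otimes> ?x h)))"
      by (subst sum.swap) (simp add: sum_distrib_left)
    also have "\<dots> = (\<Sum>u\<in>carrier G. cnj (?f u) * (of_nat (card (carrier G)) * ?f u))"
    proof (intro sum.cong refl arg_cong2[where f = "(*)"])
      fix u assume u: "u \<in> carrier G"
      have "(\<Sum>h\<in>carrier G. ?f (u \<otimes> ?x h)) = (\<Sum>h\<in>carrier G. \<Sum>a<n. \<rho> u $$ (i,a) * \<rho> (?x h) $$ (a,j))"
        using mat_rep_entry_mult[OF r u] ij g by (intro sum.cong) auto
      also have "\<dots> = (\<Sum>a<n. \<rho> u $$ (i,a) * (\<Sum>h\<in>carrier G. \<rho> (?x h) $$ (a,j)))"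
        by (subst sum.swap) (simp add: sum_distrib_left)
      also have "\<dots> = (\<Sum>a<n. if a = j then \<rho> u $$ (i,a) * of_nat (card (carrier G)) else 0)"
        using mean ij by (intro sum.cong) auto
      also have "\<dots> = of_nat (card (carrier G)) * ?f u" using ij by (simp add: mult.commute)
      finally show "(\<Sum>h\<in>carrier G. ?f (u \<otimes> ?x h)) = of_nat (card (carrier G)) * ?f u" .
    qed
    also have "\<dots> = of_real (real (card (carrier G)) * ?S)"
      by (simp add: sum_distrib_left mult.left_commute flip: complex_norm_square mult.commute)
    finally have cross: "(\<Sum>h\<in>carrier G. \<Sum>u\<in>carrier G. cnj (?f u) * ?f (u \<otimes> ?x h)) =
        complex_of_real (real (card (carrier G)) * ?S)" .
    define S where "S = ?S"
    define T where "T = (\<lambda>h. \<Sum>u\<in>carrier G. Re (cnj (?f u) * ?f (u \<otimes> ?x h)))"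
    have sumT: "(\<Sum>h\<in>carrier G. T h) = real (card (carrier G)) * S"
      using arg_cong[OF cross, of Re] by (simp add: T_def S_def)
    \<comment> \<open>Expanding the squared distances between the coefficient function
      \<open>?f\<close> and its translates, the two norm terms give 2 |G| S and the cross terms
      cancel them, since the translates have mean \<open>?f\<close>.\<close>
    have "(\<Sum>h\<in>carrier G. \<Sum>u\<in>carrier G. (cmod (?f (u \<otimes> ?x h) - ?f u))\<^sup>2) =
      (\<Sum>h\<in>carrier G. S + S - 2 * T h)"
      by (intro sum.cong refl) (simp only: sq sum.distrib sum_subtractf iso S_def T_def sum_distrib_left)
    also have "\<dots> = 0" by (simp add: sum_subtractf sumT flip: sum_distrib_left)
    finally have "(\<Sum>h\<in>carrier G. \<Sum>u\<in>carrier G. (cmod (?f (u \<otimes> ?x h) - ?f u))\<^sup>2) = 0" .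
    then have "\<forall>h\<in>carrier G. \<forall>u\<in>carrier G. ?f (u \<otimes> ?x h) = ?f u"
      using fin by (simp add: sum_nonneg_eq_0_iff sum_nonneg)
    then have "?f (\<one> \<otimes> ?x \<one>) = ?f \<one>" by blast
    then show ?thesis using g by simp
  qed
  then show ?thesis
    using r g by (intro eq_matI) (auto simp: mat_rep_def)
qed

text \<open>The sum of \<open>\<rho>\<close> over \<open>N\<close> is a scalar c. Multiplication by
  y in \<open>N\<close> permutes the summands, so c times \<open>\<rho> y\<close> is c times the
  identity: either c = 0 or \<open>N\<close> acts trivially.\<close>

lemma irreducible_normal_sum:
  assumes \<rho>: "irrep n \<rho>" and N: "N \<lhd> G"
  shows "(\<forall>x \<in> N. \<rho> x = 1\<^sub>m n) \<or> (\<Sum>x\<in>N. mat_trace (\<rho> x)) = 0"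
proof -
  interpret N: normal N G by (rule N)
  note r = irreducible_mat_rep[OF \<rho>]
  have NG: "x \<in> carrier G" if "x \<in> N" for x using that N.subset by auto
  have conj: "(\<Sum>x\<in>N. f (k \<otimes> x) :: complex) = (\<Sum>x\<in>N. f (x \<otimes> k))" if k: "k \<in> carrier G" for k f
  proof (rule sum.reindex_bij_witness[of _ "\<lambda>x. inv k \<otimes> x \<otimes> k" "\<lambda>x. k \<otimes> x \<otimes> inv k"])
    fix x assume x: "x \<in> N"
    show "k \<otimes> x \<otimes> inv k \<in> N" using N.inv_op_closed2[OF k x] .
    show "inv k \<otimes> x \<otimes> k \<in> N" using N.inv_op_closed1[OF k x] .
  qed (use k NG in \<open>auto simp: m_assoc, simp_all add: m_assoc[symmetric]\<close>)
  obtain c where c: "of_nat n * c = (\<Sum>x\<in>N. mat_trace (\<rho> x))"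
    "\<And>i j. i < n \<Longrightarrow> j < n \<Longrightarrow> (\<Sum>x\<in>N. \<rho> x $$ (i,j)) = (if i = j then c else 0)"
    "\<And>k i j. k \<in> carrier G \<Longrightarrow> i < n \<Longrightarrow> j < n \<Longrightarrow> (\<Sum>x\<in>N. \<rho> (x \<otimes> k) $$ (i,j)) = c * \<rho> k $$ (i,j)"
    by (rule irreducible_sum_scalar[OF \<rho>, of N "\<lambda>x. x"]) (rule NG, assumption, rule conj, assumption, rule that)
  show ?thesis
  proof (cases "c = 0")
    case False
    have "\<rho> y = 1\<^sub>m n" if y: "y \<in> N" for y
    proof (rule eq_matI)
      have ry: "\<rho> y \<in> carrier_mat n n" using r NG[OF y] by (auto simp: mat_rep_def)
      then show "dim_row (\<rho> y) = dim_row (1\<^sub>m n :: complex mat)" "dim_col (\<rho> y) = dim_col (1\<^sub>m n :: complex mat)" by auto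
      fix i j assume "i < dim_row (1\<^sub>m n :: complex mat)" "j < dim_col (1\<^sub>m n :: complex mat)"
      then have ij: "i < n" "j < n" by auto
      have "(\<Sum>x\<in>N. \<rho> (x \<otimes> y) $$ (i,j)) = (\<Sum>x\<in>N. \<rho> x $$ (i,j))"
        using y NG by (intro sum.reindex_bij_witness[of _ "\<lambda>x. x \<otimes> inv y" "\<lambda>x. x \<otimes> y"]) (auto simp: m_assoc)
      then have "c * \<rho> y $$ (i,j) = (if i = j then c else 0)"
        unfolding c(2)[OF ij] c(3)[OF NG[OF y] ij] .
      then show "\<rho> y $$ (i,j) = 1\<^sub>m n $$ (i,j)" using ij False by (simp split: if_splits)
    qed
    then show ?thesis by blast
  qed (use c(1) in simp)
qed

text \<open>Joins the descriptions of one character: its values are traces, its degree is the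
  dimension, and by \<open>irreducible_kernel\<close> its kernel is that of the
  representation.\<close>

lemma IrrE:
  assumes "\<chi> \<in> Irr G"
  obtains n \<rho> where "irrep n \<rho>" "\<chi> = character_of G \<rho>" "n > 0"
    "mat_rep G n \<rho>" "deg \<chi> = n" "\<And>g. g \<in> carrier G \<Longrightarrow> \<chi> g = mat_trace (\<rho> g)"
    "\<And>g. g \<in> ker \<chi> \<longleftrightarrow> g \<in> carrier G \<and> \<rho> g = 1\<^sub>m n"
proof -
  from assms obtain n \<rho> where \<rho>: "irrep n \<rho>" and \<chi>: "\<chi> = character_of G \<rho>"
    by (auto simp: Irr_def)
  note r = irreducible_mat_rep[OF \<rho>]
  have v: "\<chi> g = mat_trace (\<rho> g)" if "g \<in> carrier G" for g using that \<chi> by (simp add: character_of_def)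
  have one: "mat_trace (1\<^sub>m n) = of_nat n" by (simp add: mat_trace_def)
  then have \<chi>1: "\<chi> \<one> = of_nat n" using v[of \<one>] r by (simp add: mat_rep_def)
  have "g \<in> ker \<chi> \<longleftrightarrow> g \<in> carrier G \<and> \<rho> g = 1\<^sub>m n" for g
    using irreducible_kernel[OF \<rho>, of g] v[of g] \<chi>1 one by (auto simp: char_kernel_def)
  moreover have "deg \<chi> = n" by (simp add: chi_degree_def \<chi>1)
  moreover have "n > 0" using \<rho> by (simp add: is_irreducible_representation_def)
  ultimately show thesis using that \<rho> \<chi> v r by blast
qed

lemma Irr_one: "\<chi> \<in> Irr G \<Longrightarrow> \<chi> \<one> = of_nat (deg \<chi>)"
  by (erule IrrE) (simp add: mat_rep_def mat_trace_def)

lemma chi_degree_pos: "\<chi> \<in> Irr G \<Longrightarrow> deg \<chi> > 0"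
  by (erule IrrE) simp

lemma char_kernel_normal:
  assumes "\<chi> \<in> Irr G" shows "ker \<chi> \<lhd> G"
proof -
  obtain n \<rho> where r: "mat_rep G n \<rho>" and
    k: "\<And>g. g \<in> ker \<chi> \<longleftrightarrow> g \<in> carrier G \<and> \<rho> g = 1\<^sub>m n"
    by (rule IrrE[OF assms]) (rule that)
  have m: "\<rho> (g \<otimes> h) = \<rho> g * \<rho> h" "\<rho> g \<in> carrier_mat n n" if "g \<in> carrier G" "h \<in> carrier G" for g h
    using r that by (auto simp: mat_rep_def)
  have o: "\<rho> \<one> = 1\<^sub>m n" using r by (simp add: mat_rep_def)
  have inv1: "\<rho> (inv g) = 1\<^sub>m n" if "g \<in> carrier G" "\<rho> g = 1\<^sub>m n" for g
    using m[of g "inv g"] m(2)[of "inv g" g] that o by simp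
  have sg: "subgroup (ker \<chi>) G"
    by (rule subgroupI) (use k m o inv1 in \<open>auto simp: mat_rep_def\<close>)
  show ?thesis
    unfolding normal_inv_iff
  proof (intro conjI ballI sg)
    fix x h assume x: "x \<in> carrier G" and "h \<in> ker \<chi>"
    then have h: "h \<in> carrier G" "\<rho> h = 1\<^sub>m n" using k by auto
    have "\<rho> (x \<otimes> h \<otimes> inv x) = \<rho> x * \<rho> (inv x)"
      using m[OF _ inv_closed[OF x]] m[OF x h(1)] m(2)[OF x x] x h by simp
    also have "\<dots> = 1\<^sub>m n" using m(1)[OF x inv_closed[OF x]] o x by simp
    finally show "x \<otimes> h \<otimes> inv x \<in> ker \<chi>" using k x h by simp
  qed
qed

lemma Irr_normal_sum:
  assumes "\<chi> \<in> Irr G" and N: "N \<lhd> G"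
  shows "(\<Sum>x\<in>N. \<chi> x) = (if N \<subseteq> ker \<chi> then of_nat (card N * deg \<chi>) else 0)"
proof -
  obtain n \<rho> where \<rho>: "irrep n \<rho>" and d: "deg \<chi> = n"
    and v: "\<And>g. g \<in> carrier G \<Longrightarrow> \<chi> g = mat_trace (\<rho> g)"
    and k: "\<And>g. g \<in> ker \<chi> \<longleftrightarrow> g \<in> carrier G \<and> \<rho> g = 1\<^sub>m n"
    by (rule IrrE[OF assms(1)]) (rule that)
  have NG: "N \<subseteq> carrier G" using N normal_imp_subgroup subgroup.subset by blast
  show ?thesis
  proof (cases "N \<subseteq> ker \<chi>")
    case True
    then have "\<chi> x = of_nat n" if "x \<in> N" for x
      using that Irr_one[OF assms(1)] d by (auto simp: char_kernel_def)
    then show ?thesis using True d by simp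
  next
    case False
    then have "\<not> (\<forall>x\<in>N. \<rho> x = 1\<^sub>m n)" using k NG by auto
    then have "(\<Sum>x\<in>N. mat_trace (\<rho> x)) = 0" using irreducible_normal_sum[OF \<rho> N] by blast
    moreover have "(\<Sum>x\<in>N. \<chi> x) = (\<Sum>x\<in>N. mat_trace (\<rho> x))"
      using v NG by (intro sum.cong) auto
    ultimately show ?thesis using False by simp
  qed
qed

text \<open>The regular representation of G/N, inflated to G. A group acts on itself by translation
  without fixed points unless the element is trivial, whence the trace.\<close>

lemma coset_permutation_representation:
  assumes N: "N \<lhd> G"
  obtains \<rho> where "mat_rep G (idx N) \<rho>"
    "\<And>g. g \<in> carrier G \<Longrightarrow> mat_trace (\<rho> g) = (if g \<in> N then of_nat (idx N) else 0)"
proof -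
  interpret N: normal N G by (rule N)
  interpret Q: group "G Mod N" by (rule N.factorgroup_is_group)
  have hom: "(\<lambda>g. N #> g) \<in> hom G (G Mod N)" by (rule N.r_coset_hom_Mod)
  let ?k = "idx N" and ?\<pi> = "\<lambda>g. N #> g"
  have cQ: "carrier (G Mod N) = rcosets N" by (simp add: FactGroup_def)
  have \<pi>: "?\<pi> g \<in> carrier (G Mod N)" if "g \<in> carrier G" for g using hom that by (auto simp: hom_def)
  have \<pi>m: "?\<pi> (g \<otimes> h) = ?\<pi> g \<otimes>\<^bsub>G Mod N\<^esub> ?\<pi> h" if "g \<in> carrier G" "h \<in> carrier G" for g h
    using hom that by (auto simp: hom_def)
  have \<pi>1: "?\<pi> \<one> = \<one>\<^bsub>G Mod N\<^esub>" using N.subset by (simp add: FactGroup_def coset_mult_one)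
  have "finite (rcosets N)" using finite_subset[OF rcosets_subset_PowG[OF N.subgroup_axioms]] fin by simp
  then obtain e where e: "bij_betw e {0..<?k} (rcosets N)" using ex_bij_betw_nat_finite by blast
  have ec: "e i \<in> carrier (G Mod N)" if "i < ?k" for i
    using bij_betwE[OF e] that cQ by auto
  have einj: "e i = e j \<longleftrightarrow> i = j" if "i < ?k" "j < ?k" for i j
    using e that unfolding bij_betw_def inj_on_def by auto
  have esurj: "\<exists>a<?k. e a = q" if "q \<in> carrier (G Mod N)" for q
    using e that cQ unfolding bij_betw_def by (metis atLeastLessThan_iff imageE)
  define \<rho> where "\<rho> = (\<lambda>g. mat ?k ?k (\<lambda>(i,j). if e i = ?\<pi> g \<otimes>\<^bsub>G Mod N\<^esub> e j then 1 else 0 :: complex))"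
  have "mat_rep G ?k \<rho>"
    unfolding mat_rep_def
  proof (intro conjI ballI)
    show "\<rho> g \<in> carrier_mat ?k ?k" for g by (simp add: \<rho>_def)
    show "\<rho> \<one> = 1\<^sub>m ?k"
    proof (rule eq_matI)
      fix i j assume "i < dim_row (1\<^sub>m ?k :: complex mat)" "j < dim_col (1\<^sub>m ?k :: complex mat)"
      then have ij: "i < ?k" "j < ?k" by auto
      have "\<rho> \<one> $$ (i,j) = (if e i = e j then 1 else 0)"
        using ij unfolding \<rho>_def \<pi>1 by (subst index_mat(1)) (simp_all only: split Q.l_one[OF ec[OF ij(2)]])
      then show "\<rho> \<one> $$ (i,j) = 1\<^sub>m ?k $$ (i,j)" using einj[OF ij] ij by simp
    qed (auto simp: \<rho>_def)
    fix g h assume gh: "g \<in> carrier G" "h \<in> carrier G"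
    show "\<rho> (g \<otimes> h) = \<rho> g * \<rho> h"
    proof (rule eq_matI)
      fix i j assume "i < dim_row (\<rho> g * \<rho> h)" "j < dim_col (\<rho> g * \<rho> h)"
      then have ij: "i < ?k" "j < ?k" by (auto simp: \<rho>_def)
      have "?\<pi> h \<otimes>\<^bsub>G Mod N\<^esub> e j \<in> carrier (G Mod N)" by (rule Q.m_closed[OF \<pi>[OF gh(2)] ec[OF ij(2)]])
      then obtain b where b: "b < ?k" "e b = ?\<pi> h \<otimes>\<^bsub>G Mod N\<^esub> e j" using esurj by blast
      have "(\<rho> g * \<rho> h) $$ (i,j) = (\<Sum>a<?k. \<rho> g $$ (i,a) * (if e a = e b then 1 else 0))"
        using ij b(2) by (simp add: \<rho>_def scalar_prod_def atLeast0LessThan del: mult_FactGroup)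
      also have "\<dots> = (\<Sum>a<?k. if a = b then \<rho> g $$ (i,a) else 0)"
        using einj[OF _ b(1)] by (intro sum.cong) auto
      also have "\<dots> = \<rho> g $$ (i,b)" using b(1) by simp
      also have "\<dots> = \<rho> (g \<otimes> h) $$ (i,j)"
        using ij b Q.m_assoc[OF \<pi>[OF gh(1)] \<pi>[OF gh(2)] ec[OF ij(2)]]
        by (simp add: \<rho>_def \<pi>m[OF gh] del: mult_FactGroup)
      finally show "\<rho> (g \<otimes> h) $$ (i,j) = (\<rho> g * \<rho> h) $$ (i,j)" by simp
    qed (auto simp: \<rho>_def)
  qed
  moreover have "mat_trace (\<rho> g) = (if g \<in> N then of_nat ?k else 0)" if g: "g \<in> carrier G" for g
  proof -
    have "e i = ?\<pi> g \<otimes>\<^bsub>G Mod N\<^esub> e i \<longleftrightarrow> g \<in> N" if i: "i < ?k" for i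
    proof -
      have "e i = ?\<pi> g \<otimes>\<^bsub>G Mod N\<^esub> e i \<longleftrightarrow> ?\<pi> g = \<one>\<^bsub>G Mod N\<^esub>"
        using Q.l_cancel_one'[of "e i" "?\<pi> g"] Q.r_cancel_one'[of "e i" "?\<pi> g"] ec[OF i] \<pi>[OF g] by auto
      also have "\<dots> \<longleftrightarrow> ?\<pi> g = N" by (simp add: FactGroup_def)
      also have "\<dots> \<longleftrightarrow> g \<in> N"
        using rcos_self[OF g N.subgroup_axioms] coset_join2[OF g N.subgroup_axioms] by auto
      finally show ?thesis .
    qed
    then show ?thesis by (simp add: mat_trace_def \<rho>_def del: mult_FactGroup)
  qed
  ultimately show thesis by (rule that)
qed

text \<open>The regular character of G/N contains each irreducible character above \<open>N\<close>
  as often as its degree, and no other; evaluation at the identity gives the sum of squares, and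
  finiteness because the constituents form a list.\<close>

lemma Irr_above_normal:
  assumes N: "N \<lhd> G"
  shows "finite {\<chi> \<in> Irr G. N \<subseteq> ker \<chi>}"
    and "(\<Sum>\<chi> | \<chi> \<in> Irr G \<and> N \<subseteq> ker \<chi>. (deg \<chi>)\<^sup>2) = idx N"
proof -
  interpret N: normal N G by (rule N)
  obtain \<rho> where \<rho>: "mat_rep G (idx N) \<rho>"
    and tr: "\<And>g. g \<in> carrier G \<Longrightarrow> mat_trace (\<rho> g) = (if g \<in> N then of_nat (idx N) else 0)"
    using coset_permutation_representation[OF N] by metis
  obtain xs where xs: "set xs \<subseteq> Irr G" and tx: "\<And>g. g \<in> carrier G \<Longrightarrow> mat_trace (\<rho> g) = (\<Sum>\<chi>\<leftarrow>xs. \<chi> g)"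
    using trace_sum_of_irreducibles[OF \<rho>] by metis
  have lag: "idx N * card N = card (carrier G)"
    using lagrange[OF N.subgroup_axioms] by (simp add: Coset.order_def)
  have G0: "card (carrier G) > 0" using fin by (auto simp: card_gt_0_iff)
  \<comment> \<open>The inner product with \<open>\<psi>\<close> is computed twice: by the explicit
    trace, which leaves a sum over \<open>N\<close>, and by orthogonality, which counts occurrences
    in \<open>xs\<close>.\<close>
  have cnt: "count_list xs \<psi> = (if N \<subseteq> ker \<psi> then deg \<psi> else 0)" if \<psi>: "\<psi> \<in> Irr G" for \<psi>
  proof -
    have "(\<Sum>g\<in>carrier G. mat_trace (\<rho> g) * \<psi> (inv g)) =
       (\<Sum>g\<in>N. of_nat (idx N) * \<psi> (inv g))"
      using fin N.subset tr by (intro sum.mono_neutral_cong_right) auto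
    also have "\<dots> = of_nat (idx N) * (\<Sum>g\<in>N. \<psi> (inv g))" by (simp add: sum_distrib_left)
    also have "(\<Sum>g\<in>N. \<psi> (inv g)) = (\<Sum>g\<in>N. \<psi> g)"
      using N.subset by (intro sum.reindex_bij_witness[of _ "\<lambda>g. inv g" "\<lambda>g. inv g"]) auto
    also have "of_nat (idx N) * \<dots> =
       of_nat (card (carrier G)) * of_nat (if N \<subseteq> ker \<psi> then deg \<psi> else 0)"
      unfolding Irr_normal_sum[OF \<psi> N] lag[symmetric] by simp
    finally have 1: "(\<Sum>g\<in>carrier G. mat_trace (\<rho> g) * \<psi> (inv g)) = \<dots>" .
    have "(\<Sum>g\<in>carrier G. (\<Sum>\<chi>\<leftarrow>ys. \<chi> g) * \<psi> (inv g)) = of_nat (card (carrier G)) * of_nat (count_list ys \<psi>)"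
      if "set ys \<subseteq> Irr G" for ys
      using that
    proof (induction ys)
      case (Cons \<chi> ys)
      then show ?case using Irr_norm[OF \<psi>] Irr_orthogonal[OF _ \<psi>, of \<chi>]
        by (auto simp: distrib_right sum.distrib algebra_simps)
    qed simp
    from this[OF xs] have "(\<Sum>g\<in>carrier G. mat_trace (\<rho> g) * \<psi> (inv g)) =
        of_nat (card (carrier G)) * of_nat (count_list xs \<psi>)"
      using tx by simp
    with 1 show ?thesis using G0 by (simp only: mult_cancel_left of_nat_eq_iff of_nat_eq_0_iff) auto
  qed
  have set: "set xs = {\<chi> \<in> Irr G. N \<subseteq> ker \<chi>}" (is "_ = ?I")
  proof (rule Set.set_eqI)
    fix \<chi>
    have "\<chi> \<in> set xs \<longleftrightarrow> count_list xs \<chi> \<noteq> 0" by (simp add: count_list_0_iff)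
    then show "\<chi> \<in> set xs \<longleftrightarrow> \<chi> \<in> ?I"
      using cnt[of \<chi>] chi_degree_pos[of \<chi>] xs by (cases "\<chi> \<in> Irr G") auto
  qed
  show fI: "finite ?I" using set by (metis List.finite_set)
  have "of_nat (idx N) = (\<Sum>\<chi>\<leftarrow>xs. \<chi> \<one>)"
    using tr[of \<one>] tx[of \<one>] by simp
  also have "\<dots> = (\<Sum>\<chi>\<in>?I. of_nat (count_list xs \<chi>) * \<chi> \<one>)"
    using set fI by (intro sum_list_by_count) auto
  also have "\<dots> = (\<Sum>\<chi>\<in>?I. of_nat ((deg \<chi>)\<^sup>2))"
    using cnt Irr_one by (intro sum.cong) (auto simp: power2_eq_square)
  also have "\<dots> = of_nat (\<Sum>\<chi>\<in>?I. (deg \<chi>)\<^sup>2)" by simp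
  finally show "(\<Sum>\<chi>\<in>?I. (deg \<chi>)\<^sup>2) = idx N" by (metis of_nat_eq_iff)
qed

lemma finite_Irr: "finite (Irr G)"
proof -
  have "{\<one>} \<subseteq> ker \<chi>" for \<chi> by (simp add: char_kernel_def)
  then show ?thesis using Irr_above_normal(1)[OF one_is_normal] by simp
qed

section \<open>Linear characters\<close>

text \<open>The matrices commute with one another, so each is scalar by Schur's lemma and every
  subspace is invariant.\<close>

lemma derived_in_kernel_imp_degree_one:
  assumes \<chi>: "\<chi> \<in> Irr G" and D: "derived G (carrier G) \<subseteq> ker \<chi>"
  shows "deg \<chi> = 1"
proof -
  obtain n \<rho> where \<rho>: "irrep n \<rho>" and d: "deg \<chi> = n" and n: "n > 0"
    and r: "mat_rep G n \<rho>" and k: "\<And>g. g \<in> ker \<chi> \<longleftrightarrow> g \<in> carrier G \<and> \<rho> g = 1\<^sub>m n"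
    by (rule IrrE[OF \<chi>]) (rule that)
  have m: "\<rho> (g \<otimes> h) = \<rho> g * \<rho> h" if "g \<in> carrier G" "h \<in> carrier G" for g h
    using r that by (auto simp: mat_rep_def)
  have c: "\<rho> g \<in> carrier_mat n n" if "g \<in> carrier G" for g
    using r that by (auto simp: mat_rep_def)
  have comm: "\<rho> g * \<rho> h = \<rho> h * \<rho> g" if gh: "g \<in> carrier G" "h \<in> carrier G" for g h
  proof -
    have "g \<otimes> h \<otimes> inv g \<otimes> inv h \<in> derived G (carrier G)"
      unfolding derived_def using gh by (intro generate.incl) blast
    then have "\<rho> (g \<otimes> h \<otimes> inv g \<otimes> inv h) = 1\<^sub>m n" using D k by blast
    moreover have "g \<otimes> h = (g \<otimes> h \<otimes> inv g \<otimes> inv h) \<otimes> (h \<otimes> g)"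
      using gh by (simp add: m_assoc) (simp add: m_assoc[symmetric])
    ultimately have "\<rho> (g \<otimes> h) = 1\<^sub>m n * \<rho> (h \<otimes> g)"
      using gh m[of "g \<otimes> h \<otimes> inv g \<otimes> inv h" "h \<otimes> g"] by simp
    then show ?thesis using m gh left_mult_one_mat[OF c[of "h \<otimes> g"]] by simp
  qed
  have scal: "\<exists>a. \<rho> g = a \<cdot>\<^sub>m 1\<^sub>m n" if g: "g \<in> carrier G" for g
    by (rule commuting_matrix_is_scalar[OF \<rho> c[OF g]]) (use comm g in auto)
  \<comment> \<open>The line spanned by the first unit vector; being invariant and nonzero it is the
    whole space.\<close>
  define W where "W = {v :: complex vec. v \<in> carrier_vec n \<and> ( \<forall>i. 0 < i \<and> i < n \<longrightarrow> v $ i = 0)}"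
  have "W = {0\<^sub>v n} \<or> W = carrier_vec n"
  proof (rule irreducible_invariant_subspace[OF \<rho>])
    show "\<rho> g *\<^sub>v w \<in> W" if g: "g \<in> carrier G" and w: "w \<in> W" for g w
    proof -
      obtain a where "\<rho> g = a \<cdot>\<^sub>m 1\<^sub>m n" using scal[OF g] by blast
      then have "\<rho> g *\<^sub>v w = a \<cdot>\<^sub>v w" using w by (auto simp: W_def)
      then show ?thesis using w by (auto simp: W_def)
    qed
  qed (auto simp: W_def)
  moreover have "unit_vec n 0 \<in> W" "unit_vec n 0 \<noteq> (0\<^sub>v n :: complex vec)" using n by (auto simp: W_def)
  ultimately have W: "W = carrier_vec n" by (metis singletonD)
  have "n = 1"
  proof (rule ccontr)
    assume "n \<noteq> 1"
    then have n1: "1 < n" using n by auto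
    have "(unit_vec n 1 :: complex vec) \<in> W" unfolding W by simp
    then have "(unit_vec n 1 :: complex vec) $ 1 = 0" using n1 by (auto simp: W_def)
    then show False using n1 by simp
  qed
  then show ?thesis using d by simp
qed

lemma linear_character_mult:
  assumes \<chi>: "\<chi> \<in> Irr G" "deg \<chi> = 1" and gh: "g \<in> carrier G" "h \<in> carrier G"
  shows "\<chi> (g \<otimes> h) = \<chi> g * \<chi> h"
proof -
  obtain n \<rho> where d: "deg \<chi> = n" and r: "mat_rep G n \<rho>"
    and v: "\<And>g. g \<in> carrier G \<Longrightarrow> \<chi> g = mat_trace (\<rho> g)"
    by (rule IrrE[OF \<chi>(1)]) (rule that)
  have n: "n = 1" using d \<chi>(2) by simp
  have "dim_row (\<rho> x) = 1" if "x \<in> carrier G" for x using r that n by (auto simp: mat_rep_def)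
  then have "\<chi> x = \<rho> x $$ (0,0)" if "x \<in> carrier G" for x using v that by (simp add: mat_trace_def)
  then show ?thesis using mat_rep_entry_mult[OF r gh, of 0 0] gh n by simp
qed

lemma linear_character_derived:
  assumes \<chi>: "\<chi> \<in> Irr G" "deg \<chi> = 1"
  shows "derived G (carrier G) \<subseteq> ker \<chi>"
  unfolding derived_def
proof (rule generate_subgroup_incl)
  show "subgroup (ker \<chi>) G" by (rule normal_imp_subgroup[OF char_kernel_normal[OF \<chi>(1)]])
  show "(\<Union>h1\<in>carrier G. \<Union>h2\<in>carrier G. {h1 \<otimes> h2 \<otimes> inv h1 \<otimes> inv h2}) \<subseteq> ker \<chi>"
  proof clarify
    fix g h assume gh: "g \<in> carrier G" "h \<in> carrier G"
    have i: "\<chi> x * \<chi> (inv x) = 1" if "x \<in> carrier G" for x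
      using linear_character_mult[OF \<chi> that inv_closed[OF that]] Irr_one[OF \<chi>(1)] \<chi>(2) that by simp
    have "\<chi> (g \<otimes> h \<otimes> inv g \<otimes> inv h) = (\<chi> g * \<chi> (inv g)) * (\<chi> h * \<chi> (inv h))"
      using gh by (simp add: linear_character_mult[OF \<chi>])
    then show "g \<otimes> h \<otimes> inv g \<otimes> inv h \<in> ker \<chi>"
      using gh i Irr_one[OF \<chi>(1)] \<chi>(2) by (simp add: char_kernel_def)
  qed
qed

end

section \<open>Finite groups modulo a normal subgroup\<close>

lemma (in group) pow_in_subgroup:
  "subgroup H G \<Longrightarrow> a \<in> H \<Longrightarrow> a [^] (i::nat) \<in> H"
  by (induction i) (auto intro: subgroup.m_closed subgroup.one_closed)

context normal
begin

lemma coset_mult: "a \<in> carrier G \<Longrightarrow> b \<in> carrier G \<Longrightarrow> H #> (a \<otimes> b) = (H #> a) \<otimes>\<^bsub>G Mod H\<^esub> (H #> b)"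
  by (simp add: rcos_sum)

lemma coset_closed: "a \<in> carrier G \<Longrightarrow> H #> a \<in> carrier (G Mod H)"
  by (auto simp: carrier_FactGroup)

lemma coset_eq_iff:
  assumes "a \<in> carrier G" "b \<in> carrier G"
  shows "H #> a = H #> b \<longleftrightarrow> a \<otimes> inv b \<in> H"
proof
  assume "H #> a = H #> b"
  then have "a \<in> H #> b" using rcos_self[OF assms(1) is_subgroup] by simp
  then show "a \<otimes> inv b \<in> H" using rcos_module_imp[OF is_group assms(2)] by simp
next
  assume "a \<otimes> inv b \<in> H"
  then have "a \<in> H #> b" using rcos_module_rev[OF is_group assms(2,1)] by simp
  then show "H #> a = H #> b" using repr_independence[OF _ assms(2) is_subgroup] by simp
qed

lemma coset_eq_self_iff: "a \<in> carrier G \<Longrightarrow> H #> a = H \<longleftrightarrow> a \<in> H"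
  using coset_eq_iff[of a \<one>] coset_mult_one subset by simp

lemma coset_pow_eq_iff:
  "a \<in> carrier G \<Longrightarrow> (H #> a) [^]\<^bsub>G Mod H\<^esub> (n::nat) = \<one>\<^bsub>G Mod H\<^esub> \<longleftrightarrow> a [^] n \<in> H"
  by (simp add: FactGroup_pow coset_eq_self_iff)

lemma pow_mod_in:
  assumes a: "a \<in> carrier G" "a [^] p \<in> H"
  shows "H #> (a [^] (i::nat)) = H #> (a [^] (i mod p))"
proof -
  have "a [^] i = (a [^] p) [^] (i div p) \<otimes> a [^] (i mod p)"
    using a by (simp add: nat_pow_pow nat_pow_mult mult.commute)
  moreover have "(a [^] p) [^] (i div p) \<in> H" by (rule pow_in_subgroup[OF is_subgroup a(2)])
  ultimately have "a [^] i \<otimes> inv (a [^] (i mod p)) \<in> H" using a by (simp add: m_assoc)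
  then show ?thesis using coset_eq_iff a by simp
qed

end


text \<open>The hypothesis \<open>e\<close> says that \<open>c\<close> is the commutator y x y^-1
  x^-1; the conclusion is the rule [y^n, x] = [y, x]^n for a commutator commuting with
  \<open>y\<close>.\<close>

lemma (in group) commutator_pow_left:
  assumes c: "x \<in> carrier G" "y \<in> carrier G" "c \<in> carrier G"
    and e: "y \<otimes> x = c \<otimes> (x \<otimes> y)" and cy: "c \<otimes> y = y \<otimes> c"
  shows "y [^] (n::nat) \<otimes> x = c [^] n \<otimes> (x \<otimes> y [^] n)"
proof (induction n)
  case (Suc n)
  have cn: "y [^] n \<otimes> c = c \<otimes> y [^] n"
    using group_commutes_pow[of y c n] c cy by simp
  have "y [^] Suc n \<otimes> x = y [^] n \<otimes> (y \<otimes> x)" using c by (simp add: m_assoc)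
  also have "\<dots> = (y [^] n \<otimes> c) \<otimes> (x \<otimes> y)" unfolding e using c by (simp add: m_assoc)
  also have "\<dots> = c \<otimes> (y [^] n \<otimes> x) \<otimes> y" unfolding cn using c by (simp add: m_assoc)
  also have "\<dots> = (c \<otimes> c [^] n) \<otimes> (x \<otimes> y [^] Suc n)" unfolding Suc.IH using c by (simp add: m_assoc)
  also have "c \<otimes> c [^] n = c [^] Suc n" using c group_commutes_pow[of c c n] by simp
  finally show ?case .
qed (use c in simp)

lemma (in group) commutator_pow_right:
  assumes c: "x \<in> carrier G" "y \<in> carrier G" "c \<in> carrier G"
    and e: "y \<otimes> x = c \<otimes> (x \<otimes> y)" and cx: "c \<otimes> x = x \<otimes> c"
  shows "y \<otimes> x [^] (n::nat) = c [^] n \<otimes> (x [^] n \<otimes> y)"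
proof (induction n)
  case (Suc n)
  have cn: "x [^] n \<otimes> c = c \<otimes> x [^] n"
    using group_commutes_pow[of x c n] c cx by simp
  have "y \<otimes> x [^] Suc n = (y \<otimes> x [^] n) \<otimes> x" using c by (simp add: m_assoc)
  also have "\<dots> = c [^] n \<otimes> (x [^] n \<otimes> (y \<otimes> x))" unfolding Suc.IH using c by (simp add: m_assoc)
  also have "\<dots> = c [^] n \<otimes> ((x [^] n \<otimes> c) \<otimes> (x \<otimes> y))" unfolding e using c by (simp add: m_assoc)
  also have "\<dots> = c [^] Suc n \<otimes> (x [^] Suc n \<otimes> y)" unfolding cn using c by (simp add: m_assoc)
  finally show ?case .
qed (use c in simp)

context normal
begin

lemma coset_mult_left_mem: "a \<in> H \<Longrightarrow> b \<in> carrier G \<Longrightarrow> H #> (a \<otimes> b) = H #> b"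
  by (simp add: coset_eq_iff m_assoc)

lemma coset_eq_mult_leftD:
  "a \<in> carrier G \<Longrightarrow> b \<in> carrier G \<Longrightarrow> H #> (a \<otimes> b) = H #> b \<Longrightarrow> a \<in> H"
  by (simp add: coset_eq_iff m_assoc)

text \<open>The two commutator rules read in G/H, where \<open>c\<close> has to commute with
  \<open>y\<close> or \<open>x\<close> only modulo \<open>H\<close>.\<close>

lemma commutator_pow_mod:
  assumes c: "x \<in> carrier G" "y \<in> carrier G" "c \<in> carrier G" and e: "y \<otimes> x = c \<otimes> (x \<otimes> y)"
  shows "H #> (c \<otimes> y) = H #> (y \<otimes> c) \<Longrightarrow> H #> (y [^] (n::nat) \<otimes> x) = H #> (c [^] n \<otimes> (x \<otimes> y [^] n))"
    and "H #> (c \<otimes> x) = H #> (x \<otimes> c) \<Longrightarrow> H #> (y \<otimes> x [^] (n::nat)) = H #> (c [^] n \<otimes> (x [^] n \<otimes> y))"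
proof -
  interpret Q: group "G Mod H" by (rule factorgroup_is_group)
  note Q = coset_closed[OF c(1)] coset_closed[OF c(2)] coset_closed[OF c(3)]
  note simps = coset_mult[symmetric] FactGroup_pow
  have e': "(H #> y) \<otimes>\<^bsub>G Mod H\<^esub> (H #> x) = (H #> c) \<otimes>\<^bsub>G Mod H\<^esub> ((H #> x) \<otimes>\<^bsub>G Mod H\<^esub> (H #> y))"
    using c e by (simp add: simps del: mult_FactGroup)
  show "H #> (y [^] n \<otimes> x) = H #> (c [^] n \<otimes> (x \<otimes> y [^] n))" if "H #> (c \<otimes> y) = H #> (y \<otimes> c)"
    using Q.commutator_pow_left[OF Q e', of n] that c by (simp add: simps del: mult_FactGroup)
  show "H #> (y \<otimes> x [^] n) = H #> (c [^] n \<otimes> (x [^] n \<otimes> y))" if "H #> (c \<otimes> x) = H #> (x \<otimes> c)"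
    using Q.commutator_pow_right[OF Q e', of n] that c by (simp add: simps del: mult_FactGroup)
qed

end

text \<open>The preimage in G of the centralizer of the coset of \<open>a\<close> in G/N;
  \<open>central_mod\<close> is likewise the preimage of the centre. Preimages keep everything
  inside one group while \<open>N\<close> varies.\<close>

definition (in group) commuting_mod :: "'a set \<Rightarrow> 'a \<Rightarrow> 'a set" where
  "commuting_mod N a = {g \<in> carrier G. N #> (a \<otimes> g) = N #> (g \<otimes> a)}"

definition (in group) central_mod :: "'a set \<Rightarrow> 'a set" where
  "central_mod N = {a \<in> carrier G. \<forall>g \<in> carrier G. N #> (a \<otimes> g) = N #> (g \<otimes> a)}"

text \<open>For normal \<open>N\<close>, the preimage of the cyclic subgroup of G/N generated by the
  coset of \<open>a\<close>; natural exponents reach inverses because G is finite.\<close>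

definition (in group) adjoin :: "'a \<Rightarrow> 'a set \<Rightarrow> 'a set" where
  "adjoin a N = (\<Union>i::nat. N #> (a [^] i))"

context finite_group
begin

lemma fin_sub: "H \<subseteq> carrier G \<Longrightarrow> finite H"
  using fin finite_subset by blast

lemma pow_card_carrier: "a \<in> carrier G \<Longrightarrow> a [^] card (carrier G) = \<one>"
  using pow_order_eq_1[of a] by (simp add: Coset.order_def)

lemma card_carrier_pos: "card (carrier G) > 0"
  using fin by (auto simp: card_gt_0_iff)

lemma closed_imp_subgroup:
  assumes "S \<subseteq> carrier G" "S \<noteq> {}" "\<And>a b. a \<in> S \<Longrightarrow> b \<in> S \<Longrightarrow> a \<otimes> b \<in> S"
  shows "subgroup S G"
proof (rule subgroupI)
  fix a assume a: "a \<in> S"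
  then have aG: "a \<in> carrier G" using assms by auto
  have pw: "a [^] Suc n \<in> S" for n by (induction n) (use a aG assms(3) in auto)
  \<comment> \<open>Doubling the order keeps the exponent \<open>Suc m\<close> of the inverse
    positive even in the trivial group.\<close>
  obtain m where m: "card (carrier G) + card (carrier G) = Suc (Suc m)"
    using card_carrier_pos by (metis Suc_pred add_gr_0 add_Suc add_Suc_right)
  have "a [^] Suc m \<otimes> a = a [^] (card (carrier G) + card (carrier G))" unfolding m using aG by simp
  also have "\<dots> = \<one>" using aG pow_card_carrier[OF aG] by (simp flip: nat_pow_mult)
  finally have "inv a = a [^] Suc m" using aG by (intro inv_equality) auto
  then show "inv a \<in> S" using pw by simp
qed (use assms in auto)

lemma index_mult_card: "subgroup H G \<Longrightarrow> idx H * card H = card (carrier G)"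
  using lagrange by (simp add: Coset.order_def)

lemma card_subgroup_pos: "subgroup H G \<Longrightarrow> card H > 0"
  using subgroup.one_closed[of H G] fin_sub[OF subgroup.subset] by (auto simp: card_gt_0_iff)

lemma index_pos: "subgroup H G \<Longrightarrow> idx H > 0"
  using index_mult_card card_carrier_pos by (metis mult_eq_0_iff neq0_conv)

lemma card_subgroup_dvd:
  assumes "subgroup H G" "subgroup K G" "H \<subseteq> K"
  shows "card H dvd card K"
proof -
  interpret K: group "G\<lparr>carrier := K\<rparr>" by (rule subgroup_imp_group[OF assms(2)])
  have "subgroup H (G\<lparr>carrier := K\<rparr>)" by (rule subgroup_incl[OF assms])
  from K.lagrange[OF this, symmetric] show ?thesis by (simp add: Coset.order_def)
qed

lemma subgroup_eq_if_card_le: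
  "subgroup H G \<Longrightarrow> subgroup K G \<Longrightarrow> H \<subseteq> K \<Longrightarrow> card K \<le> card H \<Longrightarrow> H = K"
  using card_seteq[of K H] fin_sub subgroup.subset by blast

lemma index_anti_mono:
  assumes "subgroup H G" "subgroup K G" "H \<subseteq> K"
  shows "idx K \<le> idx H"
proof -
  have "idx K * card H \<le> idx H * card H"
    using index_mult_card[OF assms(1)] index_mult_card[OF assms(2)]
      card_mono[OF fin_sub[OF subgroup.subset[OF assms(2)]] assms(3)] by (metis mult_le_mono2)
  then show ?thesis using card_subgroup_pos[OF assms(1)] by simp
qed

lemma card_coset: "subgroup H G \<Longrightarrow> a \<in> carrier G \<Longrightarrow> card (H #> a) = card H"
  using card_rcosets_equal[of "H #> a" H] rcosetsI subgroup.subset by metis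

lemma normalI:
  assumes "subgroup H G" "\<And>g h. g \<in> carrier G \<Longrightarrow> h \<in> H \<Longrightarrow> g \<otimes> h \<otimes> inv g \<in> H"
  shows "H \<lhd> G"
  using assms by (simp add: normal_inv_iff)

lemma prime_dvd_index:
  assumes N: "N \<lhd> G" and q: "prime q" and x: "x \<in> carrier G" "x \<notin> N" "x [^] q \<in> N"
  shows "q dvd idx N"
proof -
  interpret N: normal N G by (rule N)
  interpret Q: group "G Mod N" by (rule N.factorgroup_is_group)
  have xQ: "N #> x \<in> carrier (G Mod N)" by (rule N.coset_closed[OF x(1)])
  have "Q.ord (N #> x) dvd q" using Q.pow_eq_id[OF xQ] N.coset_pow_eq_iff[OF x(1)] x(3) by blast
  moreover have "Q.ord (N #> x) \<noteq> 1"
    using Q.pow_eq_id[OF xQ, of 1] N.coset_pow_eq_iff[OF x(1), of 1] x by auto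
  ultimately have "Q.ord (N #> x) = q" using q by (metis prime_nat_iff)
  then show ?thesis using Q.ord_dvd_group_order[OF xQ] by (simp add: Coset.order_def FactGroup_def)
qed

lemma index_dvd_pow_in:
  assumes N: "N \<lhd> G" and x: "x \<in> carrier G" and m: "idx N dvd m"
  shows "x [^] m \<in> N"
proof -
  interpret N: normal N G by (rule N)
  interpret Q: group "G Mod N" by (rule N.factorgroup_is_group)
  have xQ: "N #> x \<in> carrier (G Mod N)" by (rule N.coset_closed[OF x])
  have "Q.ord (N #> x) dvd m"
    using Q.ord_dvd_group_order[OF xQ] m by (simp add: Coset.order_def FactGroup_def) (metis dvd_trans)
  then show ?thesis using Q.pow_eq_id[OF xQ] N.coset_pow_eq_iff[OF x] by blast
qed

lemma Cauchy_mod: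
  assumes N: "N \<lhd> G" and q: "prime q" "q dvd idx N"
  obtains x where "x \<in> carrier G" "x \<notin> N" "x [^] q \<in> N"
proof -
  interpret N: normal N G by (rule N)
  interpret Q: group "G Mod N" by (rule N.factorgroup_is_group)
  have cQ: "carrier (G Mod N) = rcosets N" by (simp add: FactGroup_def)
  have fQ: "finite (carrier (G Mod N))"
    unfolding cQ using finite_subset[OF rcosets_subset_PowG[OF N.subgroup_axioms]] fin by simp
  \<comment> \<open>\<open>sylow_thm\<close> accepts any prime power dividing the order; exponent 1
    turns it into Cauchy's theorem.\<close>
  obtain m where "Coset.order (G Mod N) = q ^ 1 * m" using q(2) cQ by (auto simp: Coset.order_def)
  from sylow_thm[OF q(1) Q.group_axioms this fQ] obtain H where
    H: "subgroup H (G Mod N)" "card H = q" by auto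
  have "card H > 1" using q H(2) prime_gt_1_nat by simp
  then obtain X where X: "X \<in> H" "X \<noteq> N"
    by (metis (no_types, lifting) One_nat_def card.empty card_1_singleton_iff is_singletonI' is_singleton_def less_irrefl not_one_less_zero ex_in_conv)
  then have XQ: "X \<in> carrier (G Mod N)" using subgroup.subset[OF H(1)] by auto
  then obtain x where x: "x \<in> carrier G" "X = N #> x" by (auto simp: carrier_FactGroup)
  interpret K: group "(G Mod N)\<lparr>carrier := H\<rparr>" by (rule Q.subgroup_imp_group[OF H(1)])
  have "X [^]\<^bsub>(G Mod N)\<lparr>carrier := H\<rparr>\<^esub> Coset.order ((G Mod N)\<lparr>carrier := H\<rparr>) = \<one>\<^bsub>(G Mod N)\<lparr>carrier := H\<rparr>\<^esub>"
    using X by (intro K.pow_order_eq_1) auto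
  then have "X [^]\<^bsub>G Mod N\<^esub> q = \<one>\<^bsub>G Mod N\<^esub>"
    using H(2) by (simp add: Coset.order_def Q.nat_pow_consistent[symmetric])
  then have "x [^] q \<in> N" using N.coset_pow_eq_iff[OF x(1)] x(2) by blast
  moreover have "x \<notin> N" using X(2) x N.coset_eq_self_iff by auto
  ultimately show thesis using that x(1) by blast
qed

lemma commuting_mod_subgroup:
  assumes N: "N \<lhd> G" and a: "a \<in> carrier G"
  shows "subgroup (commuting_mod N a) G"
proof (rule closed_imp_subgroup)
  interpret N: normal N G by (rule N)
  interpret Q: group "G Mod N" by (rule N.factorgroup_is_group)
  show "commuting_mod N a \<noteq> {}" using a by (auto simp: commuting_mod_def)
  fix g h assume gh: "g \<in> commuting_mod N a" "h \<in> commuting_mod N a"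
  then have c: "g \<in> carrier G" "h \<in> carrier G" by (auto simp: commuting_mod_def)
  have e: "N #> (a \<otimes> g) = N #> (g \<otimes> a)" "N #> (a \<otimes> h) = N #> (h \<otimes> a)"
    using gh by (auto simp: commuting_mod_def)
  have "N #> (a \<otimes> (g \<otimes> h)) = (N #> (a \<otimes> g)) \<otimes>\<^bsub>G Mod N\<^esub> (N #> h)"
    using a c by (simp add: N.coset_mult[symmetric] m_assoc del: mult_FactGroup)
  also have "\<dots> = (N #> g) \<otimes>\<^bsub>G Mod N\<^esub> (N #> (a \<otimes> h))"
    unfolding e(1) using a c by (simp add: N.coset_mult[symmetric] m_assoc del: mult_FactGroup)
  also have "\<dots> = N #> ((g \<otimes> h) \<otimes> a)"
    unfolding e(2) using a c by (simp add: N.coset_mult[symmetric] m_assoc del: mult_FactGroup)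
  finally show "g \<otimes> h \<in> commuting_mod N a" using c by (simp add: commuting_mod_def)
qed (auto simp: commuting_mod_def)

lemma central_mod_iff: "a \<in> central_mod N \<longleftrightarrow> a \<in> carrier G \<and> commuting_mod N a = carrier G"
  by (auto simp: central_mod_def commuting_mod_def)

lemma central_mod_subgroup:
  assumes N: "N \<lhd> G"
  shows "subgroup (central_mod N) G"
proof (rule closed_imp_subgroup)
  show "central_mod N \<noteq> {}" by (auto simp: central_mod_def)
  fix a b assume "a \<in> central_mod N" "b \<in> central_mod N"
  then have "a \<in> carrier G" "b \<in> carrier G" "\<And>g. g \<in> carrier G \<Longrightarrow> a \<in> commuting_mod N g \<and> b \<in> commuting_mod N g"
    by (auto simp: central_mod_def commuting_mod_def)
  then have "a \<otimes> b \<in> commuting_mod N g" if "g \<in> carrier G" for g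
    using subgroup.m_closed[OF commuting_mod_subgroup[OF N that]] that by blast
  then show "a \<otimes> b \<in> central_mod N" using \<open>a \<in> carrier G\<close> \<open>b \<in> carrier G\<close>
    by (auto simp: central_mod_def commuting_mod_def)
qed (auto simp: central_mod_def)

lemma commutator_in_iff:
  assumes "N \<lhd> G" "a \<in> carrier G" "g \<in> carrier G"
  shows "a \<otimes> g \<otimes> inv a \<otimes> inv g \<in> N \<longleftrightarrow> g \<in> commuting_mod N a"
proof -
  interpret N: normal N G by (rule assms)
  have "a \<otimes> g \<otimes> inv (g \<otimes> a) = a \<otimes> g \<otimes> inv a \<otimes> inv g"
    using assms by (simp add: inv_mult_group m_assoc)
  then show ?thesis using N.coset_eq_iff[of "a \<otimes> g" "g \<otimes> a"] assms by (simp add: commuting_mod_def)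
qed

lemma central_mod_mono:
  assumes "N \<lhd> G" "L \<lhd> G" "N \<subseteq> L"
  shows "central_mod N \<subseteq> central_mod L" "a \<in> carrier G \<Longrightarrow> commuting_mod N a \<subseteq> commuting_mod L a"
proof -
  show *: "commuting_mod N a \<subseteq> commuting_mod L a" if "a \<in> carrier G" for a
    using commutator_in_iff[OF assms(1) that] commutator_in_iff[OF assms(2) that] assms(3)
    by (auto simp: commuting_mod_def)
  show "central_mod N \<subseteq> central_mod L"
    using * by (auto simp: central_mod_iff) (auto simp: commuting_mod_def)
qed

lemma derived_le_if_commutative_mod:
  assumes N: "N \<lhd> G" and "central_mod N = carrier G"
  shows "derived G (carrier G) \<subseteq> N"
  unfolding derived_def
proof (rule generate_subgroup_incl)
  show "subgroup N G" using N by (rule normal_imp_subgroup)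
  show "(\<Union>h1\<in>carrier G. \<Union>h2\<in>carrier G. {h1 \<otimes> h2 \<otimes> inv h1 \<otimes> inv h2}) \<subseteq> N"
  proof clarify
    fix g h assume "g \<in> carrier G" "h \<in> carrier G"
    then show "g \<otimes> h \<otimes> inv g \<otimes> inv h \<in> N"
      using commutator_in_iff[OF N, of g h] central_mod_iff[of g N] assms(2) by blast
  qed
qed

lemma adjoin_facts:
  assumes N: "N \<lhd> G" and a: "a \<in> carrier G"
  shows "subgroup (adjoin a N) G" "N \<subseteq> adjoin a N" "a \<in> adjoin a N"
    "x \<in> adjoin a N \<longleftrightarrow> x \<in> carrier G \<and> (\<exists>i::nat. N #> x = N #> (a [^] i))"
    "subgroup K G \<Longrightarrow> N \<subseteq> K \<Longrightarrow> a \<in> K \<Longrightarrow> adjoin a N \<subseteq> K"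
proof -
  interpret N: normal N G by (rule N)
  interpret Q: group "G Mod N" by (rule N.factorgroup_is_group)
  show iff: "x \<in> adjoin a N \<longleftrightarrow> x \<in> carrier G \<and> (\<exists>i::nat. N #> x = N #> (a [^] i))" for x
  proof
    assume "x \<in> adjoin a N"
    then obtain i :: nat where "x \<in> N #> (a [^] i)" by (auto simp: adjoin_def)
    then show "x \<in> carrier G \<and> (\<exists>i::nat. N #> x = N #> (a [^] i))"
      using repr_independence[OF _ _ N.is_subgroup, of x "a [^] i"] a r_coset_subset_G[OF N.subset, of "a [^] i"]
      by fastforce
  next
    assume "x \<in> carrier G \<and> (\<exists>i::nat. N #> x = N #> (a [^] i))"
    then show "x \<in> adjoin a N" using rcos_self[OF _ N.is_subgroup, of x] by (auto simp: adjoin_def)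
  qed
  show sub: "N \<subseteq> adjoin a N"
  proof
    fix x assume "x \<in> N"
    then show "x \<in> adjoin a N" unfolding iff
      using N.coset_eq_self_iff[of x] N.subset coset_mult_one[OF N.subset] by (auto intro: exI[of _ 0])
  qed
  show "a \<in> adjoin a N" unfolding iff using a by (auto intro!: exI[of _ 1])
  show "subgroup (adjoin a N) G"
  proof (rule closed_imp_subgroup)
    show "adjoin a N \<subseteq> carrier G" using iff by auto
    show "adjoin a N \<noteq> {}" using sub N.one_closed by blast
    fix u v assume "u \<in> adjoin a N" "v \<in> adjoin a N"
    then obtain i j :: nat where u: "u \<in> carrier G" "N #> u = N #> (a [^] i)"
      and v: "v \<in> carrier G" "N #> v = N #> (a [^] j)" unfolding iff by blast
    have "N #> (u \<otimes> v) = (N #> (a [^] i)) \<otimes>\<^bsub>G Mod N\<^esub> (N #> (a [^] j))"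
      using N.coset_mult[OF u(1) v(1)] u(2) v(2) by metis
    also have "\<dots> = N #> (a [^] (i + j))" using a by (simp add: N.coset_mult[symmetric] nat_pow_mult del: mult_FactGroup)
    finally show "u \<otimes> v \<in> adjoin a N" unfolding iff using u v by auto
  qed
  show "adjoin a N \<subseteq> K" if K: "subgroup K G" "N \<subseteq> K" "a \<in> K"
  proof
    fix x assume "x \<in> adjoin a N"
    then obtain i :: nat where "x \<in> N #> (a [^] i)" by (auto simp: adjoin_def)
    then obtain n where "n \<in> N" "x = n \<otimes> a [^] i" by (auto simp: r_coset_def)
    moreover have "a [^] i \<in> K" by (rule pow_in_subgroup[OF K(1,3)])
    ultimately show "x \<in> K" using subgroup.m_closed[OF K(1)] K(2) by auto
  qed
qed

lemma adjoin_card_le: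
  assumes N: "N \<lhd> G" and a: "a \<in> carrier G" "a [^] p \<in> N" and p: "p > 0"
  shows "card (adjoin a N) \<le> p * card N"
proof -
  interpret N: normal N G by (rule N)
  have "adjoin a N = (\<Union>i<p. N #> (a [^] i))"
  proof
    show "adjoin a N \<subseteq> (\<Union>i<p. N #> (a [^] i))"
      unfolding adjoin_def using N.pow_mod_in[OF a] p by (fastforce intro: mod_less_divisor)
  qed (auto simp: adjoin_def)
  also have "card \<dots> \<le> (\<Sum>i<p. card (N #> (a [^] i)))" by (rule card_UN_le) simp
  also have "\<dots> = p * card N" using card_coset[OF N.is_subgroup] a by simp
  finally show ?thesis .
qed

text \<open>Adjoining an element central modulo \<open>N\<close> yields a subgroup central modulo
  \<open>N\<close>; its normality follows as g h g^-1 differs from h by a commutator in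
  \<open>N\<close>.\<close>

lemma adjoin_normal:
  assumes N: "N \<lhd> G" and a: "a \<in> central_mod N"
  shows "adjoin a N \<lhd> G" "\<And>L. L \<lhd> G \<Longrightarrow> N \<subseteq> central_mod L \<Longrightarrow> a \<in> central_mod L \<Longrightarrow> adjoin a N \<subseteq> central_mod L"
    "adjoin a N \<subseteq> central_mod N"
proof -
  interpret N: normal N G by (rule N)
  interpret Q: group "G Mod N" by (rule N.factorgroup_is_group)
  have aG: "a \<in> carrier G" using a by (simp add: central_mod_def)
  note F = adjoin_facts[OF N aG]
  show "adjoin a N \<subseteq> central_mod L" if "L \<lhd> G" "N \<subseteq> central_mod L" "a \<in> central_mod L" for L
    using F(5)[OF central_mod_subgroup[OF that(1)] that(2,3)] .
  have "N \<subseteq> central_mod N"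
  proof
    fix n assume n: "n \<in> N"
    have "n \<otimes> g \<otimes> inv n \<otimes> inv g \<in> N" if g: "g \<in> carrier G" for g
    proof -
      have "n \<otimes> (g \<otimes> inv n \<otimes> inv g) \<in> N"
        using n g by (intro N.m_closed N.inv_op_closed2) auto
      then show ?thesis using n g by (simp add: m_assoc)
    qed
    then have "g \<in> commuting_mod N n" if "g \<in> carrier G" for g
      using commutator_in_iff[OF N _ that, of n] n that by auto
    then show "n \<in> central_mod N" using n by (auto simp: central_mod_def commuting_mod_def)
  qed
  then show c: "adjoin a N \<subseteq> central_mod N" using F(5)[OF central_mod_subgroup[OF N] _ a] by blast
  show "adjoin a N \<lhd> G"
  proof (rule normalI[OF F(1)])
    fix g h assume g: "g \<in> carrier G" and h: "h \<in> adjoin a N"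
    then have hG: "h \<in> carrier G" "h \<in> central_mod N" using c F(4) by auto
    then have "h \<otimes> g \<otimes> inv h \<otimes> inv g \<in> N"
      using commutator_in_iff[OF N hG(1) g] g by (auto simp: central_mod_def commuting_mod_def)
    then have "inv (h \<otimes> g \<otimes> inv h \<otimes> inv g) \<otimes> h \<in> adjoin a N"
      using subgroup.m_closed[OF F(1) subgroup.m_inv_closed[OF F(1)] h] F(2) by blast
    also have "inv (h \<otimes> g \<otimes> inv h \<otimes> inv g) \<otimes> h = g \<otimes> h \<otimes> inv g"
      using g hG by (simp add: inv_mult_group m_assoc)
    finally show "g \<otimes> h \<otimes> inv g \<in> adjoin a N" .
  qed
qed

end

section \<open>Finite p-groups\<close>

lemma prime_power_if_unique_prime_divisor:
  fixes n p :: nat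
  assumes "n > 0" "prime p" "\<And>q. prime q \<Longrightarrow> q dvd n \<Longrightarrow> q = p"
  obtains k where "n = p ^ k"
proof -
  obtain m where m: "n = p ^ multiplicity p n * m" "\<not> p dvd m"
    using multiplicity_decompose'[of n p] assms(1,2) by (metis not_prime_unit not_gr_zero)
  have "m = 1"
  proof (rule ccontr)
    assume "m \<noteq> 1"
    then obtain q where "prime q" "q dvd m" using prime_factor_nat by blast
    then show False using assms(3)[of q] m by (metis dvd_mult)
  qed
  then show thesis using that m(1) by simp
qed

locale p_group = finite_group G for G (structure) +
  fixes p n :: nat
  assumes p: "prime p" and card_G: "card (carrier G) = p ^ n"
begin

lemma p1: "p > 1" using p prime_gt_1_nat by blast

lemma card_sub: "subgroup H G \<Longrightarrow> \<exists>k. card H = p ^ k"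
  using card_subgroup_dvd[OF _ subgroup_self, of H] subgroup.subset card_G
  by (metis divides_primepow_nat p)

text \<open>Orders of subgroups are powers of p, so a strict inclusion costs a full factor p. The
  size contradictions below rest on this.\<close>

lemma card_jump:
  assumes "subgroup H G" "subgroup K G" "H \<subset> K"
  shows "p * card H \<le> card K"
proof -
  obtain a b where ab: "card H = p ^ a" "card K = p ^ b" using card_sub assms by meson
  have "card H < card K" using assms psubset_card_mono fin_sub subgroup.subset by metis
  then have "Suc a \<le> b" using ab p1 by (simp add: power_strict_increasing_iff Suc_le_eq)
  then have "p ^ Suc a \<le> p ^ b" using p1 by (intro power_increasing) auto
  then show ?thesis using ab by simp
qed

text \<open>The class equation inside \<open>N\<close>: without such an element all conjugacy
  classes in \<open>N\<close> other than that of the identity have size divisible by p, so p divides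
  both |N| and |N| - 1.\<close>

lemma central_element_in_normal:
  assumes N: "N \<lhd> G" "N \<noteq> {\<one>}"
  obtains z where "z \<in> N" "z \<noteq> \<one>" "\<And>g. g \<in> carrier G \<Longrightarrow> z \<otimes> g = g \<otimes> z"
proof (rule ccontr)
  note found = that
  assume nt: "\<not> thesis"
  interpret N: normal N G by (rule N)
  define \<phi> where "\<phi> = (\<lambda>g. \<lambda>h \<in> carrier G. g \<otimes> h \<otimes> inv g)"
  interpret A: group_action G "carrier G" \<phi> unfolding \<phi>_def by (rule action_by_conjugation)
  let ?C = "(\<lambda>x. orbit G \<phi> x) ` (N - {\<one>})"
  have NG: "x \<in> carrier G" if "x \<in> N" for x using that N.subset by auto
  have orb: "orbit G \<phi> x = {g \<otimes> x \<otimes> inv g | g. g \<in> carrier G}" if "x \<in> N" for x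
    using NG[OF that] by (auto simp: orbit_def \<phi>_def)
  have sub: "orbit G \<phi> x \<subseteq> N - {\<one>}" if x: "x \<in> N - {\<one>}" for x
  proof
    fix y assume "y \<in> orbit G \<phi> x"
    then obtain g where g: "g \<in> carrier G" "y = g \<otimes> x \<otimes> inv g" using orb x by auto
    have "y \<noteq> \<one>"
    proof
      assume "y = \<one>"
      then have "inv g \<otimes> (g \<otimes> x \<otimes> inv g) \<otimes> g = \<one>" using g by simp
      moreover have "inv g \<otimes> (g \<otimes> x \<otimes> inv g) \<otimes> g = x"
        using g NG x by (simp add: m_assoc) (simp add: m_assoc[symmetric])
      ultimately show False using x by simp
    qed
    then show "y \<in> N - {\<one>}" using g x N.inv_op_closed2 by auto
  qed
  have un: "\<Union>?C = N - {\<one>}"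
  proof
    show "\<Union>?C \<subseteq> N - {\<one>}" using sub by blast
    show "N - {\<one>} \<subseteq> \<Union>?C" using A.orbit_refl NG by blast
  qed
  have dv: "p dvd card c" if c: "c \<in> ?C" for c
  proof -
    obtain x where x: "x \<in> N" "x \<noteq> \<one>" "c = orbit G \<phi> x" using c by auto
    have "card c dvd p ^ n"
      using A.orbit_stabilizer_theorem[OF NG[OF x(1)]] x(3) card_G by (metis Coset.order_def dvd_triv_left)
    then obtain k where k: "card c = p ^ k" using p divides_primepow_nat by blast
    obtain g where g: "g \<in> carrier G" "x \<otimes> g \<noteq> g \<otimes> x" using nt found[OF x(1,2)] by blast
    have "g \<otimes> x \<otimes> inv g \<noteq> x"
    proof
      assume "g \<otimes> x \<otimes> inv g = x"
      then have "g \<otimes> x \<otimes> inv g \<otimes> g = x \<otimes> g" by simp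
      then show False using g NG[OF x(1)] by (simp add: m_assoc)
    qed
    moreover have "g \<otimes> x \<otimes> inv g \<in> c" using x g(1) orb by auto
    moreover have "x \<in> c" using A.orbit_refl[OF NG[OF x(1)]] x(3) by simp
    ultimately have "card c \<noteq> 1" by (auto simp: card_1_singleton_iff)
    then have "k \<noteq> 0" using k by auto
    then show ?thesis using k by simp
  qed
  have "p dvd card (\<Union>?C)"
  proof (rule dvd_partition)
    show "finite (\<Union>?C)" unfolding un using fin_sub[OF N.subset] by simp
    show "\<forall>c\<in>?C. p dvd card c" using dv by blast
    show "\<forall>c1\<in>?C. \<forall>c2\<in>?C. c1 \<noteq> c2 \<longrightarrow> c1 \<inter> c2 = {}"
    proof (intro ballI impI)
      fix c1 c2 assume "c1 \<in> ?C" "c2 \<in> ?C" "c1 \<noteq> c2"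
      moreover have "?C \<subseteq> orbits G (carrier G) \<phi>" using NG by (auto simp: orbits_def)
      ultimately show "c1 \<inter> c2 = {}" using A.disjoint_union by blast
    qed
  qed
  then have d1: "p dvd card N - 1" unfolding un using N.one_closed fin_sub[OF N.subset] by simp
  have "card N \<noteq> 1" using N(2) N.one_closed by (metis card_1_singletonE singletonD)
  then obtain k where "card N = p ^ k" "k \<noteq> 0" using card_sub[OF N.is_subgroup] by (metis power_0)
  then have d2: "p dvd card N" by simp
  have "card N \<ge> 1" using card_subgroup_pos[OF N.is_subgroup] by simp
  then have "p dvd 1" using d1 d2 by (metis dvd_diffD1)
  then show False using p1 by simp
qed

lemma quotient_p_group:
  assumes "N \<lhd> G"
  shows "\<exists>k. p_group (G Mod N) p k"
proof -
  interpret N: normal N G by (rule assms)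
  have cQ: "carrier (G Mod N) = rcosets N" by (simp add: FactGroup_def)
  have "idx N dvd p ^ n" using index_mult_card[OF N.is_subgroup] card_G by (metis dvd_triv_left)
  then obtain k where "idx N = p ^ k" using p divides_primepow_nat by blast
  moreover have "finite (rcosets N)"
    using finite_subset[OF rcosets_subset_PowG[OF N.subgroup_axioms]] fin by simp
  ultimately have "p_group (G Mod N) p k"
    using N.factorgroup_is_group cQ p by (auto simp: p_group_def p_group_axioms_def finite_group_def finite_group_axioms_def)
  then show ?thesis by blast
qed

text \<open>Take \<open>L\<close> maximal among the normal subgroups from \<open>M\<close> up to,
  but not including, \<open>D\<close>. The normal subgroup D/L of the p-group G/L contains a central
  subgroup of order p, which by maximality is all of D/L.\<close>

lemma maximal_normal_below:
  assumes D: "D \<lhd> G" and M: "M \<lhd> G" "M \<subset> D"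
  obtains L where "L \<lhd> G" "M \<subseteq> L" "L \<subset> D" "card D = p * card L" "D \<subseteq> central_mod L"
    "\<And>d. d \<in> D \<Longrightarrow> d [^] p \<in> L"
proof -
  interpret D: normal D G by (rule D)
  define S where "S = {L. L \<lhd> G \<and> M \<subseteq> L \<and> L \<subset> D}"
  have "finite S" "S \<noteq> {}"
    using M fin_sub[OF D.subset] by (auto simp: S_def intro: finite_subset[of _ "Pow D"])
  then have "Max (card ` S) \<in> card ` S" by (intro Max_in) auto
  then obtain L where L: "L \<in> S" and "card L = Max (card ` S)" by auto
  then have Lmax: "card K \<le> card L" if "K \<in> S" for K using \<open>finite S\<close> that by simp
  from L have LN: "L \<lhd> G" and MsL: "M \<subseteq> L" and LD: "L \<subset> D" by (auto simp: S_def)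
  interpret L: normal L G by (rule LN)
  obtain k where "p_group (G Mod L) p k" using quotient_p_group[OF LN] by blast
  then interpret Q: p_group "G Mod L" p k .
  let ?DQ = "(\<lambda>d. L #> d) ` D"
  have "?DQ \<lhd> G Mod L"
  proof (rule Q.normalI)
    show "subgroup ?DQ (G Mod L)"
    proof (rule Q.closed_imp_subgroup)
      show "?DQ \<subseteq> carrier (G Mod L)" using L.coset_closed D.subset by auto
      show "?DQ \<noteq> {}" using D.one_closed by blast
      fix a b assume "a \<in> ?DQ" "b \<in> ?DQ"
      then obtain d e where de: "d \<in> D" "e \<in> D" "a = L #> d" "b = L #> e" by auto
      then have "a \<otimes>\<^bsub>G Mod L\<^esub> b = L #> (d \<otimes> e)" using L.coset_mult[of d e] by simp
      then show "a \<otimes>\<^bsub>G Mod L\<^esub> b \<in> ?DQ" using de D.m_closed by blast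
    qed
    fix g h assume "g \<in> carrier (G Mod L)" "h \<in> ?DQ"
    then obtain u d where ud: "u \<in> carrier G" "d \<in> D" "g = L #> u" "h = L #> d"
      by (auto simp: carrier_FactGroup)
    have "inv\<^bsub>G Mod L\<^esub> g = L #> inv u"
      using ud L.inv_FactGroup[of g] L.rcos_inv[of u] L.coset_closed by simp
    then have "g \<otimes>\<^bsub>G Mod L\<^esub> h \<otimes>\<^bsub>G Mod L\<^esub> inv\<^bsub>G Mod L\<^esub> g = L #> (u \<otimes> d \<otimes> inv u)"
      using ud by (simp add: L.coset_mult del: mult_FactGroup)
    then show "g \<otimes>\<^bsub>G Mod L\<^esub> h \<otimes>\<^bsub>G Mod L\<^esub> inv\<^bsub>G Mod L\<^esub> g \<in> ?DQ"
      using D.inv_op_closed2[OF ud(1,2)] by blast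
  qed
  moreover have "?DQ \<noteq> {\<one>\<^bsub>G Mod L\<^esub>}"
  proof -
    obtain d where d: "d \<in> D" "d \<notin> L" using LD by blast
    then have "L #> d \<noteq> \<one>\<^bsub>G Mod L\<^esub>" using L.coset_eq_self_iff[of d] by simp
    then show ?thesis using d(1) by blast
  qed
  ultimately obtain z where z: "z \<in> ?DQ" "z \<noteq> \<one>\<^bsub>G Mod L\<^esub>"
    and zc: "\<And>g. g \<in> carrier (G Mod L) \<Longrightarrow> z \<otimes>\<^bsub>G Mod L\<^esub> g = g \<otimes>\<^bsub>G Mod L\<^esub> z"
    by (rule Q.central_element_in_normal) (rule that)
  obtain d where d: "d \<in> D" "z = L #> d" using z(1) by auto
  have dG: "d \<in> carrier G" using d by simp
  have dL: "d \<notin> L" using d z L.coset_eq_self_iff[OF dG] by simp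
  have dc: "d \<in> central_mod L"
    unfolding central_mod_def
  proof (intro CollectI conjI ballI dG)
    fix g assume g: "g \<in> carrier G"
    show "L #> (d \<otimes> g) = L #> (g \<otimes> d)"
      using zc[OF L.coset_closed[OF g]] d L.coset_mult[OF dG g] L.coset_mult[OF g dG] by simp
  qed
  \<comment> \<open>The last iterated p-th power of \<open>d\<close> outside \<open>L\<close> has
    order p modulo \<open>L\<close> and is still central there.\<close>
  define e where "e = (LEAST j. d [^] (p ^ j) \<in> L)"
  have ex: "d [^] (p ^ n) \<in> L" using pow_card_carrier[OF dG] card_G L.one_closed by simp
  then have e: "d [^] (p ^ e) \<in> L" unfolding e_def by (rule LeastI)
  have "e \<noteq> 0" using e dL dG by (metis nat_pow_eone power_0)
  then obtain e' where e': "e = Suc e'" by (cases e) auto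
  have ne': "d [^] (p ^ e') \<notin> L" using not_less_Least[of e' "\<lambda>j. d [^] (p ^ j) \<in> L"] e' by (auto simp: e_def)
  define w where "w = d [^] (p ^ e')"
  have wG: "w \<in> carrier G" using dG by (simp add: w_def)
  have wD: "w \<in> D" unfolding w_def by (rule pow_in_subgroup[OF D.is_subgroup d(1)])
  have wc: "w \<in> central_mod L" unfolding w_def by (rule pow_in_subgroup[OF central_mod_subgroup[OF LN] dc])
  have wp: "w [^] p \<in> L" using e dG by (simp add: w_def e' nat_pow_pow mult.commute)
  note F = adjoin_facts[OF LN wG]
  have "adjoin w L \<subseteq> D" using F(5)[OF D.is_subgroup] LD wD by blast
  moreover have "\<not> adjoin w L \<subset> D"
  proof
    assume "adjoin w L \<subset> D"
    then have "adjoin w L \<in> S" using adjoin_normal(1)[OF LN wc] MsL F(2) by (auto simp: S_def)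
    then have "card (adjoin w L) \<le> card L" by (rule Lmax)
    then have "L = adjoin w L" by (rule subgroup_eq_if_card_le[OF L.is_subgroup F(1,2)])
    then show False using F(3) ne' w_def by blast
  qed
  ultimately have aD: "adjoin w L = D" by blast
  show thesis
  proof (rule that[OF LN MsL LD])
    have "card D \<le> p * card L" using adjoin_card_le[OF LN wG wp] p1 aD by simp
    then show "card D = p * card L" using card_jump[OF L.is_subgroup D.is_subgroup LD] by simp
    show "D \<subseteq> central_mod L" using adjoin_normal(3)[OF LN wc] aD by simp
    \<comment> \<open>Modulo \<open>L\<close> the element is a power of \<open>w\<close>, whose p-th
      power lies in \<open>L\<close>.\<close>
    fix a assume "a \<in> D"
    then obtain i :: nat where a: "a \<in> carrier G" "L #> a = L #> (w [^] i)" using aD F(4)[of a] by blast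
    have "(L #> a) [^]\<^bsub>G Mod L\<^esub> p = L #> ((w [^] i) [^] p)" using a(2) wG by (simp add: L.FactGroup_pow)
    also have "(w [^] i) [^] p = (w [^] p) [^] i" using wG by (simp add: nat_pow_pow mult.commute)
    also have "L #> \<dots> = L" using pow_in_subgroup[OF L.is_subgroup wp] L.coset_eq_self_iff wG by simp
    finally show "a [^] p \<in> L" using L.coset_pow_eq_iff[OF a(1)] by simp
  qed
qed

end

section \<open>Kernels and codegrees\<close>

context finite_group
begin

abbreviation commutator_subgroup ("\<D>") where "\<D> \<equiv> derived G (carrier G)"

lemma derived_normal: "\<D> \<lhd> G"
  using derived_is_normal[of "carrier G"] normalI[OF subgroup_self] by simp

lemma kernel_subgroup: "\<chi> \<in> Irr G \<Longrightarrow> subgroup (ker \<chi>) G"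
  by (intro normal_imp_subgroup char_kernel_normal)

text \<open>Clears the complex quotient, so that codegrees can be handled through equations between
  natural numbers.\<close>

lemma codegree_eq_iff:
  assumes "\<chi> \<in> Irr G"
  shows "codegree G \<chi> = of_nat c \<longleftrightarrow> idx (ker \<chi>) = c * deg \<chi>"
proof -
  have "codegree G \<chi> = of_nat c \<longleftrightarrow>
      (of_nat (idx (ker \<chi>)) :: complex) = of_nat (c * deg \<chi>)"
    using chi_degree_pos[OF assms] by (simp add: codegree_def Irr_one[OF assms] field_simps)
  then show ?thesis by (simp only: of_nat_eq_iff)
qed

text \<open>For N = G the sum of squares equals 1, which leaves room for exactly one character, of
  degree 1.\<close>

lemma trivial_character:
  obtains \<chi> where "\<chi> \<in> Irr G" "ker \<chi> = carrier G" "deg \<chi> = 1"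
    "\<And>\<psi>. \<psi> \<in> Irr G \<Longrightarrow> ker \<psi> = carrier G \<Longrightarrow> \<psi> = \<chi>"
proof -
  define S where "S = {\<chi> \<in> Irr G. carrier G \<subseteq> ker \<chi>}"
  have N: "carrier G \<lhd> G" by (rule normalI[OF subgroup_self]) simp
  have i1: "idx (carrier G) = 1"
    using index_mult_card[OF subgroup_self] card_carrier_pos by simp
  have s: "(\<Sum>\<chi>\<in>S. (deg \<chi>)\<^sup>2) = 1" using Irr_above_normal(2)[OF N] i1 by (simp add: S_def)
  have f: "finite S" unfolding S_def by (rule Irr_above_normal(1)[OF N])
  have "card S = (\<Sum>\<chi>\<in>S. 1)" by simp
  also have "\<dots> \<le> (\<Sum>\<chi>\<in>S. (deg \<chi>)\<^sup>2)"
    using chi_degree_pos by (intro sum_mono) (auto simp: Suc_leI S_def)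
  finally have "card S \<le> 1" using s by simp
  moreover have "S \<noteq> {}" using s by auto
  then have "card S > 0" using f by (simp add: card_gt_0_iff)
  ultimately have "card S = 1" by simp
  then obtain \<chi> where \<chi>: "S = {\<chi>}" by (rule card_1_singletonE)
  have ks: "ker \<psi> \<subseteq> carrier G" for \<psi> by (auto simp: char_kernel_def)
  have "(deg \<chi>)\<^sup>2 = 1" using s unfolding \<chi> by simp
  then have d: "deg \<chi> = 1" by (simp add: power2_eq_square)
  have mem: "\<psi> \<in> S \<longleftrightarrow> \<psi> = \<chi>" for \<psi> unfolding \<chi> by simp
  have "\<chi> \<in> Irr G \<and> carrier G \<subseteq> ker \<chi>" using mem[of \<chi>] by (simp add: S_def)
  moreover have "\<psi> = \<chi>" if "\<psi> \<in> Irr G" "ker \<psi> = carrier G" for \<psi>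
    using mem[of \<psi>] that by (simp add: S_def)
  ultimately show thesis using that[of \<chi>] ks d by blast
qed

text \<open>The square is one term of the sum of squares for G modulo the kernel; the trivial
  character contributes another 1 unless it is the character itself, which makes the bound
  strict.\<close>

lemma degree_bound:
  assumes \<chi>: "\<chi> \<in> Irr G"
  shows "(deg \<chi>)\<^sup>2 \<le> idx (ker \<chi>)"
    and "ker \<chi> \<noteq> carrier G \<Longrightarrow> (deg \<chi>)\<^sup>2 < idx (ker \<chi>)"
proof -
  let ?K = "ker \<chi>" and ?S = "{\<psi> \<in> Irr G. ker \<chi> \<subseteq> ker \<psi>}"
  note N = char_kernel_normal[OF \<chi>]
  note s = Irr_above_normal[OF N]
  have "(\<Sum>\<psi>\<in>{\<chi>}. (deg \<psi>)\<^sup>2) \<le> (\<Sum>\<psi>\<in>?S. (deg \<psi>)\<^sup>2)"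
    using s(1) \<chi> by (intro sum_mono2) auto
  then show "(deg \<chi>)\<^sup>2 \<le> idx ?K" using s(2) by simp
  assume ne: "?K \<noteq> carrier G"
  obtain \<tau> where \<tau>: "\<tau> \<in> Irr G" "ker \<tau> = carrier G" "deg \<tau> = 1"
    by (rule trivial_character) (rule that)
  have "(\<Sum>\<psi>\<in>{\<chi>,\<tau>}. (deg \<psi>)\<^sup>2) \<le> (\<Sum>\<psi>\<in>?S. (deg \<psi>)\<^sup>2)"
    using s(1) \<chi> \<tau> by (intro sum_mono2) (auto simp: char_kernel_def)
  moreover have "\<chi> \<noteq> \<tau>" using ne \<tau> by auto
  ultimately show "(deg \<chi>)\<^sup>2 < idx ?K" using s(2) \<tau>(3) by simp
qed

lemma kernel_intersection_normal:
  assumes "S \<subseteq> Irr G"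
  shows "{x \<in> carrier G. \<forall>\<chi>\<in>S. x \<in> ker \<chi>} \<lhd> G" (is "?J \<lhd> G")
proof -
  have sub: "subgroup (ker \<chi>) G" if "\<chi> \<in> S" for \<chi> using that assms kernel_subgroup by auto
  have nor: "ker \<chi> \<lhd> G" if "\<chi> \<in> S" for \<chi> using that assms char_kernel_normal by auto
  show ?thesis
  proof (rule normalI)
    show "subgroup ?J G"
    proof (rule closed_imp_subgroup)
      show "?J \<noteq> {}" using subgroup.one_closed[OF sub] by auto
    qed (use subgroup.m_closed[OF sub] in auto)
    show "g \<otimes> h \<otimes> inv g \<in> ?J" if "g \<in> carrier G" "h \<in> ?J" for g h
      using that normal.inv_op_closed2[OF nor] by auto
  qed
qed

text \<open>The intersection \<open>J\<close> of the kernels above \<open>N\<close> has the same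
  characters above it as \<open>N\<close>, hence the same index, and so it equals
  \<open>N\<close>.\<close>

lemma mem_if_in_all_kernels:
  assumes N: "N \<lhd> G" and x: "x \<in> carrier G"
    and all: "\<And>\<chi>. \<chi> \<in> Irr G \<Longrightarrow> N \<subseteq> ker \<chi> \<Longrightarrow> x \<in> ker \<chi>"
  shows "x \<in> N"
proof -
  define S where "S = {\<chi> \<in> Irr G. N \<subseteq> ker \<chi>}"
  define J where "J = {x \<in> carrier G. \<forall>\<chi>\<in>S. x \<in> ker \<chi>}"
  have J: "J \<lhd> G" unfolding J_def by (rule kernel_intersection_normal) (auto simp: S_def)
  have NJ: "N \<subseteq> J" using normal_imp_subgroup[OF N] subgroup.subset by (fastforce simp: J_def S_def)
  have "{\<chi> \<in> Irr G. J \<subseteq> ker \<chi>} = S"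
    using NJ by (auto simp: S_def J_def)
  then have "idx J = idx N"
    using Irr_above_normal(2)[OF J] Irr_above_normal(2)[OF N] by (simp add: S_def)
  then have "card J = card N"
    using index_mult_card[OF normal_imp_subgroup[OF J]] index_mult_card[OF normal_imp_subgroup[OF N]]
      index_pos[OF normal_imp_subgroup[OF N]] by (metis mult_left_cancel neq0_conv)
  then have "N = J"
    by (intro subgroup_eq_if_card_le normal_imp_subgroup J N NJ) simp
  moreover have "x \<in> J" using x all by (auto simp: J_def S_def)
  ultimately show ?thesis by simp
qed

text \<open>
  Compare the sums of squares over \<open>G/M\<close> and \<open>G/L\<close> for a normal subgroup \<open>M\<close> that is maximal
  with \<open>q\<close> dividing \<open>|G/M|\<close>, where \<open>L\<close> is the normal subgroup generated by \<open>M\<close> and an element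
  of order \<open>q\<close> modulo \<open>M\<close>: the additional characters have degree divisible by \<open>q\<close>.
\<close>

lemma prime_divisor_of_order:
  assumes p: "prime p" and cod: "\<And>\<chi>. \<chi> \<in> Irr G \<Longrightarrow> \<exists>i. idx (ker \<chi>) = p ^ i * deg \<chi>"
    and q: "prime q" "q dvd card (carrier G)"
  shows "q = p"
proof (rule ccontr)
  assume qp: "q \<noteq> p"
  define S where "S = {M. M \<lhd> G \<and> q dvd idx M}"
  have "{\<one>} \<in> S"
    using one_is_normal q(2) index_mult_card[OF triv_subgroup] by (auto simp: S_def)
  moreover have "finite S"
    using fin by (intro finite_subset[of S "Pow (carrier G)"]) (auto simp: S_def dest: normal_imp_subgroup subgroup.subset)
  ultimately have "Max (card ` S) \<in> card ` S" by (intro Max_in) auto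
  then obtain M where MS: "M \<in> S" and "card M = Max (card ` S)" by auto
  then have Mmax: "card K \<le> card M" if "K \<in> S" for K using \<open>finite S\<close> that by simp
  have M: "M \<lhd> G" "q dvd idx M" using MS by (auto simp: S_def)
  obtain x where x: "x \<in> carrier G" "x \<notin> M" "x [^] q \<in> M" by (rule Cauchy_mod[OF M(1) q(1) M(2)])
  define I where "I = {\<chi> \<in> Irr G. M \<subseteq> ker \<chi>}"
  define I' where "I' = {\<chi> \<in> I. x \<in> ker \<chi>}"
  \<comment> \<open>Describing the normal closure as an intersection of kernels makes the set of
    characters above \<open>L\<close> exactly \<open>I'\<close>.\<close>
  define L where "L = {y \<in> carrier G. \<forall>\<chi>\<in>I'. y \<in> ker \<chi>}"
  have L: "L \<lhd> G" unfolding L_def by (rule kernel_intersection_normal) (auto simp: I_def I'_def)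
  have xL: "x \<in> L" using x by (simp add: L_def I'_def)
  have MsL: "M \<subseteq> L" using subgroup.subset[OF normal_imp_subgroup[OF M(1)]] by (auto simp: L_def I'_def I_def)
  have I'L: "{\<chi> \<in> Irr G. L \<subseteq> ker \<chi>} = I'"
    using xL MsL by (auto simp: I_def I'_def L_def)
  have "card M < card L"
    using MsL xL x(2) fin_sub[OF subgroup.subset[OF normal_imp_subgroup[OF L]]] by (intro psubset_card_mono) auto
  then have "\<not> q dvd idx L" using Mmax[of L] L by (auto simp: S_def)
  moreover have "q dvd idx L"
  proof -
    have fI: "finite I" unfolding I_def by (rule Irr_above_normal(1)[OF M(1)])
    have "(\<Sum>\<chi>\<in>I. (deg \<chi>)\<^sup>2) = (\<Sum>\<chi>\<in>I'. (deg \<chi>)\<^sup>2) + (\<Sum>\<chi>\<in>I - I'. (deg \<chi>)\<^sup>2)"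
      using fI by (subst sum.subset_diff[of I' I]) (auto simp: I'_def)
    moreover have "(\<Sum>\<chi>\<in>I. (deg \<chi>)\<^sup>2) = idx M"
      using Irr_above_normal(2)[OF M(1)] by (simp add: I_def)
    moreover have "(\<Sum>\<chi>\<in>I'. (deg \<chi>)\<^sup>2) = idx L"
      using Irr_above_normal(2)[OF L] I'L by simp
    moreover have "q dvd (\<Sum>\<chi>\<in>I - I'. (deg \<chi>)\<^sup>2)"
    proof (rule dvd_sum)
      fix \<chi> assume "\<chi> \<in> I - I'"
      then have \<chi>: "\<chi> \<in> Irr G" "M \<subseteq> ker \<chi>" "x \<notin> ker \<chi>" by (auto simp: I_def I'_def)
      have "q dvd idx (ker \<chi>)"
        using \<chi> x by (intro prime_dvd_index[OF char_kernel_normal[OF \<chi>(1)] q(1) x(1)]) auto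
      moreover obtain i where "idx (ker \<chi>) = p ^ i * deg \<chi>" using cod[OF \<chi>(1)] by blast
      ultimately have "q dvd p ^ i \<or> q dvd deg \<chi>" using q(1) by (simp add: prime_dvd_mult_iff)
      moreover have "\<not> q dvd p ^ i" using q(1) p qp prime_dvd_power primes_dvd_imp_eq by blast
      ultimately show "q dvd (deg \<chi>)\<^sup>2" by (simp add: power2_eq_square)
    qed
    ultimately show ?thesis using M(2) by (metis dvd_add_left_iff)
  qed
  ultimately show False by blast
qed

lemma linear_characters_above:
  assumes N: "N \<lhd> G" and D: "\<D> \<subseteq> N"
  shows "card {\<chi> \<in> Irr G. N \<subseteq> ker \<chi>} = idx N"
proof -
  have "(\<Sum>\<chi> | \<chi> \<in> Irr G \<and> N \<subseteq> ker \<chi>. (deg \<chi>)\<^sup>2) =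
      (\<Sum>\<chi> | \<chi> \<in> Irr G \<and> N \<subseteq> ker \<chi>. 1)"
    using D derived_in_kernel_imp_degree_one by (intro sum.cong) auto
  then show ?thesis using Irr_above_normal(2)[OF N] by simp
qed

section \<open>Power subgroups\<close>

text \<open>The preimage in G of the m-th powers in the abelian quotient by \<open>\<D>\<close>,
  that is, the subgroup generated by \<open>\<D>\<close> and all m-th powers.\<close>

definition powers :: "nat \<Rightarrow> 'a set" where
  "powers m = (\<Union>h\<in>carrier G. \<D> #> (h [^] m))"

lemma powers_iff:
  "x \<in> powers m \<longleftrightarrow> x \<in> carrier G \<and> (\<exists>h\<in>carrier G. \<D> #> x = \<D> #> (h [^] m))"
proof -
  interpret D: normal \<D> G by (rule derived_normal)
  show ?thesis
  proof
    assume "x \<in> powers m"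
    then obtain h where h: "h \<in> carrier G" "x \<in> \<D> #> (h [^] m)" by (auto simp: powers_def)
    then have "\<D> #> x = \<D> #> (h [^] m)"
      using repr_independence[OF h(2) _ D.is_subgroup] by simp
    moreover have "x \<in> carrier G" using r_coset_subset_G[OF D.subset, of "h [^] m"] h by auto
    ultimately show "x \<in> carrier G \<and> (\<exists>h\<in>carrier G. \<D> #> x = \<D> #> (h [^] m))" using h by blast
  next
    assume "x \<in> carrier G \<and> (\<exists>h\<in>carrier G. \<D> #> x = \<D> #> (h [^] m))"
    then show "x \<in> powers m" using rcos_self[OF _ D.is_subgroup, of x] by (auto simp: powers_def)
  qed
qed

lemma powers_normal: "powers m \<lhd> G" and derived_le_powers: "\<D> \<subseteq> powers m"
proof -
  interpret D: normal \<D> G by (rule derived_normal)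
  interpret Q: comm_group "G Mod \<D>" by (rule derived_quot_is_comm_group)
  show sub: "\<D> \<subseteq> powers m"
  proof
    fix x assume x: "x \<in> \<D>"
    then have "\<D> #> x = \<D> #> (\<one> [^] m)" using D.coset_eq_self_iff[of x] coset_mult_one[OF D.subset] D.subset by auto
    then show "x \<in> powers m" unfolding powers_iff using x D.subset by blast
  qed
  have sg: "subgroup (powers m) G"
  proof (rule closed_imp_subgroup)
    show "powers m \<noteq> {}" using sub D.one_closed by blast
    fix a b assume "a \<in> powers m" "b \<in> powers m"
    then obtain g h where a: "a \<in> carrier G" "g \<in> carrier G" "\<D> #> a = \<D> #> (g [^] m)"
      and b: "b \<in> carrier G" "h \<in> carrier G" "\<D> #> b = \<D> #> (h [^] m)" unfolding powers_iff by blast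
    have "\<D> #> (a \<otimes> b) = (\<D> #> (g [^] m)) \<otimes>\<^bsub>G Mod \<D>\<^esub> (\<D> #> (h [^] m))"
      using D.coset_mult[OF a(1) b(1)] a(3) b(3) by metis
    also have "\<dots> = (\<D> #> g) [^]\<^bsub>G Mod \<D>\<^esub> m \<otimes>\<^bsub>G Mod \<D>\<^esub> (\<D> #> h) [^]\<^bsub>G Mod \<D>\<^esub> m"
      using a b by (simp add: D.FactGroup_pow)
    also have "\<dots> = ((\<D> #> g) \<otimes>\<^bsub>G Mod \<D>\<^esub> (\<D> #> h)) [^]\<^bsub>G Mod \<D>\<^esub> m"
      by (rule Q.nat_pow_distrib[symmetric]) (use a b D.coset_closed in auto)
    also have "\<dots> = \<D> #> ((g \<otimes> h) [^] m)"
      using a b D.FactGroup_pow[of "g \<otimes> h" m] by (simp add: D.coset_mult del: mult_FactGroup)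
    finally show "a \<otimes> b \<in> powers m" unfolding powers_iff using a b by blast
  qed (simp add: powers_iff subset_iff)
  show "powers m \<lhd> G"
  proof (rule normalI[OF sg])
    fix g h assume g: "g \<in> carrier G" and h: "h \<in> powers m"
    then have hG: "h \<in> carrier G" by (simp add: powers_iff)
    have "g \<otimes> h \<otimes> inv g \<otimes> inv h \<in> \<D>"
      unfolding derived_def using g hG by (intro generate.incl) blast
    then have "g \<otimes> h \<otimes> inv g \<otimes> inv h \<otimes> h \<in> powers m"
      using subgroup.m_closed[OF sg _ h] sub by blast
    then show "g \<otimes> h \<otimes> inv g \<in> powers m" using g hG by (simp add: m_assoc)
  qed
qed

lemma powers_le_kernel_iff:
  assumes \<chi>: "\<chi> \<in> Irr G"
  shows "powers m \<subseteq> ker \<chi> \<longleftrightarrow>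
    deg \<chi> = 1 \<and> (\<forall>h\<in>carrier G. h [^] m \<in> ker \<chi>)"
proof
  assume P: "powers m \<subseteq> ker \<chi>"
  then have "deg \<chi> = 1"
    using derived_in_kernel_imp_degree_one[OF \<chi>] derived_le_powers by blast
  moreover have "h [^] m \<in> powers m" if "h \<in> carrier G" for h
    unfolding powers_iff using that by auto
  ultimately show "deg \<chi> = 1 \<and> (\<forall>h\<in>carrier G. h [^] m \<in> ker \<chi>)" using P by blast
next
  assume a: "deg \<chi> = 1 \<and> (\<forall>h\<in>carrier G. h [^] m \<in> ker \<chi>)"
  note D = linear_character_derived[OF \<chi> conjunct1[OF a]]
  show "powers m \<subseteq> ker \<chi>"
  proof
    fix x assume "x \<in> powers m"
    then obtain h d where "h \<in> carrier G" "d \<in> \<D>" "x = d \<otimes> h [^] m"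
      by (auto simp: powers_def r_coset_def)
    then show "x \<in> ker \<chi>" using a D subgroup.m_closed[OF kernel_subgroup[OF \<chi>]] by blast
  qed
qed

text \<open>A linear character takes its values among the m-th roots of unity, of which there are at
  most m, and two elements with equal value lie in the same coset of the kernel.\<close>

lemma linear_character_index_le:
  assumes \<chi>: "\<chi> \<in> Irr G" "deg \<chi> = 1" and m: "m > 0"
    and pw: "\<And>h. h \<in> carrier G \<Longrightarrow> h [^] m \<in> ker \<chi>"
  shows "idx (ker \<chi>) \<le> m"
proof -
  let ?K = "ker \<chi>"
  interpret K: normal ?K G by (rule char_kernel_normal[OF \<chi>(1)])
  note mult = linear_character_mult[OF \<chi>]
  have one: "\<chi> \<one> = 1" using Irr_one[OF \<chi>(1)] \<chi>(2) by simp
  have pow: "\<chi> (h [^] k) = \<chi> h ^ k" if h: "h \<in> carrier G" for h and k :: nat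
  proof (induction k)
    case (Suc k)
    then show ?case using mult[OF nat_pow_closed[OF h] h, of k] by simp
  qed (use one in simp)
  have "\<chi> h ^ m = 1" if h: "h \<in> carrier G" for h
  proof -
    have "\<chi> (h [^] m) = \<chi> \<one>" using pw[OF h] unfolding char_kernel_def by blast
    then show ?thesis unfolding pow[OF h] one .
  qed
  then have sub: "\<chi> ` carrier G \<subseteq> {z. z ^ m = 1}" by blast
  have rt: "finite {z :: complex. z ^ m = 1}" "card {z :: complex. z ^ m = 1} \<le> m"
    by (rule finite_roots_unity card_roots_unity, use m in simp)+
  have c: "card (\<chi> ` carrier G) \<le> m" by (rule le_trans[OF card_mono[OF rt(1) sub] rt(2)])
  \<comment> \<open>Sends a value to the coset of some element having it, so the cosets are an image
    of the set of values.\<close>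
  let ?F = "\<lambda>z. ?K #> (SOME x. x \<in> carrier G \<and> \<chi> x = z)"
  have "rcosets ?K \<subseteq> ?F ` (\<chi> ` carrier G)"
  proof
    fix C assume "C \<in> rcosets ?K"
    then obtain x where x: "x \<in> carrier G" "C = ?K #> x" by (auto simp: RCOSETS_def)
    define y where "y = (SOME y. y \<in> carrier G \<and> \<chi> y = \<chi> x)"
    have "y \<in> carrier G \<and> \<chi> y = \<chi> x" unfolding y_def by (rule someI[of _ x]) (use x in simp)
    then have y: "y \<in> carrier G" "\<chi> y = \<chi> x" by auto
    have "\<chi> (x \<otimes> inv y) = \<chi> (y \<otimes> inv y)"
      unfolding mult[OF x(1) inv_closed[OF y(1)]] mult[OF y(1) inv_closed[OF y(1)]] y(2) ..
    also have "y \<otimes> inv y = \<one>" using y(1) by (rule r_inv)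
    finally have "x \<otimes> inv y \<in> ?K" unfolding char_kernel_def using x(1) y(1) by blast
    then have "C = ?K #> y" using x y K.coset_eq_iff by simp
    then show "C \<in> ?F ` (\<chi> ` carrier G)" using x(1) by (auto simp: y_def)
  qed
  then have "idx ?K \<le> card (?F ` (\<chi> ` carrier G))" using fin by (intro card_mono) auto
  also have "\<dots> \<le> card (\<chi> ` carrier G)" using fin by (intro card_image_le) auto
  finally show ?thesis using c by simp
qed

text \<open>A linear character has codegree at most p^i exactly if it is trivial on all p^i-th
  powers, that is, lies above \<open>powers (p ^ i)\<close>. This is the bridge from codegree counts
  to the structure of the quotient by \<open>\<D>\<close>.\<close>

lemma powers_index:
  assumes p: "prime p" and e: "\<And>\<chi>. \<chi> \<in> Irr G \<Longrightarrow> idx (ker \<chi>) = p ^ e \<chi> * deg \<chi>"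
  shows "card {\<chi> \<in> Irr G. deg \<chi> = 1 \<and> e \<chi> \<le> i} = idx (powers (p ^ i))"
proof -
  have "deg \<chi> = 1 \<and> e \<chi> \<le> i \<longleftrightarrow> powers (p ^ i) \<subseteq> ker \<chi>" if \<chi>: "\<chi> \<in> Irr G" for \<chi>
  proof
    assume a: "deg \<chi> = 1 \<and> e \<chi> \<le> i"
    then have "idx (ker \<chi>) dvd p ^ i" using e[OF \<chi>] by (simp add: le_imp_power_dvd)
    then show "powers (p ^ i) \<subseteq> ker \<chi>"
      using a index_dvd_pow_in[OF char_kernel_normal[OF \<chi>]] powers_le_kernel_iff[OF \<chi>] by blast
  next
    assume "powers (p ^ i) \<subseteq> ker \<chi>"
    then have d: "deg \<chi> = 1" and h: "\<And>h. h \<in> carrier G \<Longrightarrow> h [^] (p ^ i) \<in> ker \<chi>"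
      using powers_le_kernel_iff[OF \<chi>] by auto
    have "p ^ e \<chi> \<le> p ^ i"
      using linear_character_index_le[OF \<chi> d _ h] e[OF \<chi>] d p prime_gt_0_nat by simp
    then have "e \<chi> \<le> i" using prime_gt_1_nat[OF p] by (simp add: power_increasing_iff)
    then show "deg \<chi> = 1 \<and> e \<chi> \<le> i" using d by simp
  qed
  then have "{\<chi> \<in> Irr G. deg \<chi> = 1 \<and> e \<chi> \<le> i} = {\<chi> \<in> Irr G. powers (p ^ i) \<subseteq> ker \<chi>}"
    by blast
  then show ?thesis using linear_characters_above[OF powers_normal derived_le_powers] by simp
qed

end

section \<open>Abelian p-groups with two generators\<close>

text \<open>The hypotheses say |G : G^p| = p^2 and |G^p : G^(p^2)| at most p. An \<open>x\<close>
  whose p-th power generates G^p modulo G^(p^2) makes G^p cyclic, and an element outside the group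
  generated by \<open>x\<close> can be corrected to have p-th power 1.\<close>

lemma (in p_group) two_generators:
  assumes comm: "comm_group G"
    and c1: "card (carrier G) = p * p * card ((\<lambda>b. b [^] p) ` carrier G)"
    and c2: "card ((\<lambda>b. b [^] p) ` carrier G) \<le> p * card ((\<lambda>b. b [^] (p * p)) ` carrier G)"
  obtains x y where "x \<in> carrier G" "y \<in> carrier G" "y [^] p = \<one>"
    "\<And>g. g \<in> carrier G \<Longrightarrow> \<exists>(i::nat) (j::nat). g = x [^] i \<otimes> y [^] j"
    "\<And>g. g \<in> carrier G \<Longrightarrow> \<exists>i :: nat. g [^] p = (x [^] p) [^] i"
proof -
  interpret comm_group G by (rule comm)
  let ?A = "(\<lambda>b. b [^] p) ` carrier G" and ?B = "(\<lambda>b. b [^] (p * p)) ` carrier G"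
  have sg: "subgroup ((\<lambda>b. b [^] m) ` carrier G) G" for m :: nat
  proof (rule closed_imp_subgroup)
    fix a b assume "a \<in> (\<lambda>b. b [^] m) ` carrier G" "b \<in> (\<lambda>b. b [^] m) ` carrier G"
    then obtain c d where "c \<in> carrier G" "d \<in> carrier G" "a = c [^] m" "b = d [^] m" by auto
    then have "a \<otimes> b = (c \<otimes> d) [^] m" "c \<otimes> d \<in> carrier G" by (auto simp: nat_pow_distrib)
    then show "a \<otimes> b \<in> (\<lambda>b. b [^] m) ` carrier G" by blast
  qed auto
  have nor: "N \<lhd> G" if "subgroup N G" for N using that by (rule subgroup_imp_normal)
  have pp: "b [^] (p * p) = (b [^] p) [^] p" if "b \<in> carrier G" for b using that by (simp add: nat_pow_pow)
  have BA: "?B \<subseteq> ?A" using pp by auto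
  have adj: "\<exists>i::nat. \<exists>n\<in>N. x = n \<otimes> a [^] i" if "x \<in> adjoin a N" for x a N
    using that by (auto simp: adjoin_def r_coset_def)
  have cA: "card ?A > 0" by (rule card_subgroup_pos[OF sg])
  \<comment> \<open>If the two power groups agree, any \<open>x\<close> outside G^p works with
    exponent 0. Otherwise choose \<open>x\<close> with x^p outside G^(p^2), whose index in G^p is
    then p.\<close>
  have "\<exists>x\<in>carrier G. x \<notin> ?A \<and> (\<forall>b\<in>carrier G. \<exists>i::nat. \<exists>c\<in>carrier G. b [^] p = (x [^] p) [^] i \<otimes> c [^] (p * p))"
  proof (cases "?B = ?A")
    case True
    have "card ?A < card (carrier G)" using c1 cA p1 less_1_mult[OF p1 p1] by simp
    then have "?A \<noteq> carrier G" by auto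
    then obtain x where x: "x \<in> carrier G" "x \<notin> ?A" using subgroup.subset[OF sg[of p]] by blast
    have "\<exists>i::nat. \<exists>c\<in>carrier G. b [^] p = (x [^] p) [^] i \<otimes> c [^] (p * p)" if b: "b \<in> carrier G" for b
    proof -
      have "b [^] p \<in> ?B" unfolding True using b by blast
      then obtain c where "c \<in> carrier G" "b [^] p = c [^] (p * p)" by blast
      then show ?thesis using x by (intro exI[of _ 0]) auto
    qed
    then show ?thesis using x by blast
  next
    case False
    then obtain x where x: "x \<in> carrier G" "x [^] p \<notin> ?B" using BA by blast
    then have xA: "x \<notin> ?A" using pp by auto
    let ?K = "adjoin (x [^] p) ?B"
    have xp: "x [^] p \<in> carrier G" using x by simp
    note F = adjoin_facts[OF nor[OF sg[of "p * p"]] xp]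
    have KA: "?K \<subseteq> ?A" using x(1) by (intro F(5)[OF sg BA] imageI)
    have "?B \<subset> ?K" using F(2,3) x(2) by blast
    then have "card ?A \<le> card ?K" using c2 card_jump[OF sg[of "p * p"] F(1)] by simp
    then have K: "?K = ?A" by (rule subgroup_eq_if_card_le[OF F(1) sg KA])
    have "\<exists>i::nat. \<exists>c\<in>carrier G. b [^] p = (x [^] p) [^] i \<otimes> c [^] (p * p)" if b: "b \<in> carrier G" for b
    proof -
      have "b [^] p \<in> ?K" unfolding K using b by blast
      then obtain i :: nat and n where "n \<in> ?B" "b [^] p = n \<otimes> (x [^] p) [^] i" using adj by blast
      then show ?thesis using x by (auto simp: m_comm)
    qed
    then show ?thesis using x xA by blast
  qed
  then obtain x where x: "x \<in> carrier G" "x \<notin> ?A"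
    and star: "\<And>b. b \<in> carrier G \<Longrightarrow> \<exists>i::nat. \<exists>c\<in>carrier G. b [^] p = (x [^] p) [^] i \<otimes> c [^] (p * p)" by blast
  \<comment> \<open>Substituting the relation \<open>star\<close> for c^p repeatedly raises the
    power in the error term until it exceeds the exponent of the group.\<close>
  have it: "\<exists>i::nat. \<exists>c\<in>carrier G. b [^] p = (x [^] p) [^] i \<otimes> c [^] (p ^ Suc k)" if b: "b \<in> carrier G" for b k
  proof (induction k)
    case 0
    show ?case using b x by (intro exI[of _ 0] bexI[of _ b]) auto
  next
    case (Suc k)
    then obtain i :: nat and c where c: "c \<in> carrier G" "b [^] p = (x [^] p) [^] i \<otimes> c [^] (p ^ Suc k)" by blast
    obtain j :: nat and d where d: "d \<in> carrier G" "c [^] p = (x [^] p) [^] j \<otimes> d [^] (p * p)" using star[OF c(1)] by blast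
    have "c [^] (p ^ Suc k) = (c [^] p) [^] (p ^ k)" using c by (simp add: nat_pow_pow)
    also have "\<dots> = (x [^] p) [^] (j * p ^ k) \<otimes> d [^] (p ^ Suc (Suc k))"
      using d x by (simp add: nat_pow_distrib nat_pow_pow mult.assoc)
    finally have "b [^] p = (x [^] p) [^] (i + j * p ^ k) \<otimes> d [^] (p ^ Suc (Suc k))"
      using c d x by (simp add: m_assoc nat_pow_mult[symmetric])
    then show ?case using d by blast
  qed
  have pw: "\<exists>i::nat. b [^] p = (x [^] p) [^] i" if b: "b \<in> carrier G" for b
  proof -
    obtain i :: nat and c where c: "c \<in> carrier G" "b [^] p = (x [^] p) [^] i \<otimes> c [^] (p ^ Suc n)" using it[OF b] by blast
    have "c [^] (p ^ Suc n) = (c [^] (p ^ n)) [^] p" using c by (simp add: nat_pow_pow mult.commute)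
    also have "\<dots> = \<one>" using pow_card_carrier[OF c(1)] card_G by simp
    finally show ?thesis using c x by auto
  qed
  define X where "X = adjoin x {\<one>}"
  note FX = adjoin_facts[OF one_is_normal x(1), folded X_def]
  have Xiff: "g \<in> X \<longleftrightarrow> (\<exists>i::nat. g = x [^] i)" for g
    using x by (auto simp: X_def adjoin_def r_coset_def)
  have AX: "?A \<subseteq> X" using pw Xiff x by (auto simp: nat_pow_pow)
  note FA = adjoin_facts[OF nor[OF sg[of p]] x(1)]
  \<comment> \<open>The cyclic group generated by \<open>x\<close> has order at most p |G^p|, less
    than |G| = p^2 |G^p|, so some \<open>z\<close> lies outside.\<close>
  have "card X \<le> card (adjoin x ?A)"
    using FA(1,2,3) fin_sub[OF subgroup.subset[OF FA(1)]] subgroup.one_closed[OF FA(1)]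
    by (intro card_mono FX(5)) auto
  also have "\<dots> \<le> p * card ?A" using x p1 by (intro adjoin_card_le[OF nor[OF sg]]) auto
  also have "\<dots> < card (carrier G)" using c1 cA p1 by simp
  finally have "X \<noteq> carrier G" by auto
  then obtain z where z: "z \<in> carrier G" "z \<notin> X" using subgroup.subset[OF FX(1)] by blast
  obtain i :: nat where i: "z [^] p = (x [^] p) [^] i" using pw[OF z(1)] by blast
  \<comment> \<open>Since z^p = (x^i)^p, this quotient has trivial p-th power.\<close>
  define y where "y = z \<otimes> inv (x [^] i)"
  have y: "y \<in> carrier G" using x z by (simp add: y_def)
  have zy: "z = y \<otimes> x [^] i" using x z by (simp add: y_def m_assoc)
  have yX: "y \<notin> X" using z(2) zy subgroup.m_closed[OF FX(1)] Xiff by metis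
  have "(x [^] p) [^] i = y [^] p \<otimes> (x [^] p) [^] i"
    using i x y by (simp add: zy nat_pow_distrib nat_pow_pow mult.commute)
  then have yp: "y [^] p = \<one>" using x y by (simp add: r_cancel_one')
  note FY = adjoin_facts[OF nor[OF FX(1)] y]
  \<comment> \<open>Here \<open>x\<close> lying outside G^p is used: two strict inclusions, from G^p
    to \<open>X\<close> and on to \<open>adjoin y X\<close>, already account for p^2 |G^p| = |G|
    elements.\<close>
  have "p * card ?A \<le> card X" using AX FX(3) x(2) by (intro card_jump[OF sg FX(1)]) blast
  then have "p * p * card ?A \<le> p * card X" unfolding mult.assoc by (rule mult_le_mono2)
  also have "\<dots> \<le> card (adjoin y X)" using FY(2,3) yX by (intro card_jump[OF FX(1) FY(1)]) blast
  finally have "card (carrier G) \<le> card (adjoin y X)" by (simp add: c1)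
  then have full: "adjoin y X = carrier G"
    by (intro subgroup_eq_if_card_le[OF FY(1) subgroup_self] subgroup.subset[OF FY(1)])
  show thesis
  proof (rule that[OF x(1) y yp _ pw])
    fix g assume "g \<in> carrier G"
    then have "g \<in> adjoin y X" using full by simp
    then obtain j :: nat and h where h: "h \<in> X" "g = h \<otimes> y [^] j" using adj by blast
    then obtain i :: nat where "h = x [^] i" using Xiff[of h] by auto
    then show "\<exists>(i::nat) (j::nat). g = x [^] i \<otimes> y [^] j" using h(2) by auto
  qed
qed

section \<open>Groups with the codegrees of the abelian group\<close>

context finite_group
begin

lemma pow_card_subgroup:
  assumes H: "subgroup H G" "a \<in> H" shows "a [^] card H = \<one>"
proof -
  interpret H: group "G\<lparr>carrier := H\<rparr>" by (rule subgroup_imp_group[OF H(1)])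
  have "a [^]\<^bsub>G\<lparr>carrier := H\<rparr>\<^esub> Coset.order (G\<lparr>carrier := H\<rparr>) = \<one>\<^bsub>G\<lparr>carrier := H\<rparr>\<^esub>"
    using H by (intro H.pow_order_eq_1) auto
  then show ?thesis by (simp add: Coset.order_def nat_pow_consistent[symmetric])
qed

lemma normal_Int:
  assumes "M \<lhd> G" "N \<lhd> G" shows "M \<inter> N \<lhd> G"
proof (rule normalI)
  show "subgroup (M \<inter> N) G" by (intro subgroups_Inter_pair normal_imp_subgroup assms)
  show "g \<otimes> h \<otimes> inv g \<in> M \<inter> N" if "g \<in> carrier G" "h \<in> M \<inter> N" for g h
    using that normal.inv_op_closed2[OF assms(1) that(1)] normal.inv_op_closed2[OF assms(2) that(1)] by simp
qed

text \<open>
  If \<open>G\<close> is generated by \<open>x\<close>, \<open>y\<close> and its commutator subgroup, which is central modulo \<open>M\<close>,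
  then modulo \<open>M\<close> the commutator subgroup is generated by \<open>c = [y,x]\<close>, and
  \<open>c ^ p = [y ^ p, x] = 1\<close>.
\<close>

lemma class_two_bound:
  assumes x: "x \<in> carrier G" and y: "y \<in> carrier G" "y [^] p \<in> \<D>" and p: "p > 0"
    and gen: "\<And>H. subgroup H G \<Longrightarrow> x \<in> H \<Longrightarrow> y \<in> H \<Longrightarrow> \<D> \<subseteq> H \<Longrightarrow> H = carrier G"
    and M: "M \<lhd> G" "\<D> \<subseteq> central_mod M"
  shows "card \<D> \<le> p * card M" "x [^] p \<in> central_mod M"
proof -
  interpret M: normal M G by (rule M(1))
  define c where "c = y \<otimes> x \<otimes> inv y \<otimes> inv x"
  have c: "c \<in> carrier G" using x y by (simp add: c_def)
  have cD: "c \<in> \<D>" unfolding derived_def c_def using x y(1) by (intro generate.incl) blast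
  have yx: "y \<otimes> x = c \<otimes> (x \<otimes> y)" using x y by (simp add: c_def m_assoc) (simp add: m_assoc[symmetric])
  have comm: "M #> (d \<otimes> g) = M #> (g \<otimes> d)" if "d \<in> \<D>" "g \<in> carrier G" for d g
    using that M(2) by (auto simp: central_mod_def)
  have "M #> (c [^] p \<otimes> (x \<otimes> y [^] p)) = M #> (y [^] p \<otimes> x)"
    by (rule M.commutator_pow_mod(1)[OF x y(1) c yx comm[OF cD y(1)], symmetric])
  also have "\<dots> = M #> (x \<otimes> y [^] p)" by (rule comm[OF y(2) x])
  finally have cp: "c [^] p \<in> M"
    using c x y(1) by (intro M.coset_eq_mult_leftD[of "c [^] p" "x \<otimes> y [^] p"]) auto
  \<comment> \<open>The rule in the other argument gives [y, x^p] = c^p, which lies in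
    \<open>M\<close>; so x^p commutes modulo \<open>M\<close> with a generating set.\<close>
  have "M #> (y \<otimes> x [^] p) = M #> (c [^] p \<otimes> (x [^] p \<otimes> y))"
    by (rule M.commutator_pow_mod(2)[OF x y(1) c yx comm[OF cD x]])
  also have "\<dots> = M #> (x [^] p \<otimes> y)" using cp x y(1) by (intro M.coset_mult_left_mem) auto
  finally have "M #> (y \<otimes> x [^] p) = M #> (x [^] p \<otimes> y)" .
  then have "y \<in> commuting_mod M (x [^] p)" using y(1) by (simp add: commuting_mod_def)
  moreover have "x \<in> commuting_mod M (x [^] p)"
    using x group_commutes_pow[of x x p] by (simp add: commuting_mod_def)
  moreover have "\<D> \<subseteq> commuting_mod M g" if "g \<in> carrier G" for g
    using M(2) that by (auto simp: central_mod_def commuting_mod_def)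
  ultimately show "x [^] p \<in> central_mod M"
    using gen[OF commuting_mod_subgroup[OF M(1)]] x by (simp add: central_mod_iff)
  have cM: "c \<in> central_mod M" using cD M(2) by blast
  \<comment> \<open>Modulo \<open>L\<close> the elements \<open>x\<close> and \<open>y\<close>
    commute and the commutator subgroup is central, so G/L is abelian and \<open>L\<close> contains
    \<open>\<D>\<close>.\<close>
  define L where "L = adjoin c M"
  note F = adjoin_facts[OF M(1) c, folded L_def]
  have L: "L \<lhd> G" unfolding L_def by (rule adjoin_normal(1)[OF M(1) cM])
  have DL: "\<D> \<subseteq> central_mod L" using M(2) central_mod_mono(1)[OF M(1) L F(2)] by blast
  then have DL': "\<D> \<subseteq> commuting_mod L g" if "g \<in> carrier G" for g
    using that by (auto simp: central_mod_def commuting_mod_def)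
  have xy: "x \<in> commuting_mod L y" using commutator_in_iff[OF L y(1) x] F(3) by (simp add: c_def)
  then have yx': "y \<in> commuting_mod L x" using x y by (auto simp: commuting_mod_def)
  have "x \<in> central_mod L"
    using gen[OF commuting_mod_subgroup[OF L x] _ yx' DL'[OF x]] x by (simp add: central_mod_iff commuting_mod_def)
  moreover have "y \<in> central_mod L"
    using gen[OF commuting_mod_subgroup[OF L y(1)] xy _ DL'[OF y(1)]] y by (simp add: central_mod_iff commuting_mod_def)
  ultimately have "central_mod L = carrier G" using gen[OF central_mod_subgroup[OF L] _ _ DL] by blast
  then have "\<D> \<subseteq> L" by (rule derived_le_if_commutative_mod[OF L])
  then have "card \<D> \<le> card L" using fin_sub[OF subgroup.subset[OF F(1)]] by (intro card_mono)
  also have "\<dots> \<le> p * card M" unfolding L_def by (rule adjoin_card_le[OF M(1) c cp p])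
  finally show "card \<D> \<le> p * card M" .
qed

lemma card_powers:
  "card (powers m) = card \<D> * card ((\<lambda>b. b [^]\<^bsub>G Mod \<D>\<^esub> m) ` carrier (G Mod \<D>))"
proof -
  interpret D: normal \<D> G by (rule derived_normal)
  interpret Q: group "G Mod \<D>" by (rule D.factorgroup_is_group)
  let ?C = "(\<lambda>b. b [^]\<^bsub>G Mod \<D>\<^esub> m) ` carrier (G Mod \<D>)"
  have C: "?C \<subseteq> rcosets \<D>" using Q.nat_pow_closed by (auto simp: FactGroup_def)
  have un: "powers m = \<Union>?C"
    unfolding powers_def carrier_FactGroup image_image by (simp add: D.FactGroup_pow)
  have "card \<D> * card ?C = card (\<Union>?C)"
  proof (rule card_partition)
    show "finite (\<Union>?C)" unfolding un[symmetric]
      by (rule fin_sub[OF subgroup.subset[OF normal_imp_subgroup[OF powers_normal]]])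
    show "finite ?C" using finite_subset[OF subset_trans[OF C rcosets_subset_PowG[OF D.is_subgroup]]] fin by simp
    show "card c = card \<D>" if "c \<in> ?C" for c
      using card_rcosets_equal[OF subsetD[OF C that] D.subset] by simp
    show "c1 \<inter> c2 = {}" if "c1 \<in> ?C" "c2 \<in> ?C" "c1 \<noteq> c2" for c1 c2
      using pairwiseD[OF rcos_disjoint[OF D.is_subgroup] subsetD[OF C that(1)] subsetD[OF C that(2)] that(3)]
      by (simp add: disjnt_def)
  qed
  then show ?thesis using un by simp
qed

end

text \<open>All that is kept of the pseudo-algebra: \<open>e \<chi>\<close> is the exponent of the
  codegree, and the cumulative counts p^(i+1), for i = 1, 2, 3, are those of the abelian group. The
  order p^n itself is left open.\<close>

locale cod_p_group = p_group G p n for G (structure) and p n +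
  fixes e :: "('a \<Rightarrow> complex) \<Rightarrow> nat"
  assumes index_kernel: "\<chi> \<in> Irr G \<Longrightarrow> idx (ker \<chi>) = p ^ e \<chi> * deg \<chi>"
    and e_le: "\<chi> \<in> Irr G \<Longrightarrow> e \<chi> \<le> 3"
    and count1: "card {\<chi> \<in> Irr G. e \<chi> \<le> 1} = p ^ 2"
    and count2: "card {\<chi> \<in> Irr G. e \<chi> \<le> 2} = p ^ 3"
    and count3: "card (Irr G) = p ^ 4"
begin

section \<open>Degrees and power subgroup indices from the codegree counts\<close>

lemma index_power: assumes "subgroup H G" obtains k where "idx H = p ^ k"
  using index_mult_card[OF assms] card_G p by (metis divides_primepow_nat dvd_triv_left)

lemma degree_power: assumes "\<chi> \<in> Irr G" obtains k where "deg \<chi> = p ^ k"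
proof -
  obtain k where "idx (ker \<chi>) = p ^ k" by (rule index_power[OF kernel_subgroup[OF assms]])
  then have "deg \<chi> dvd p ^ k" using index_kernel[OF assms] by (metis dvd_triv_right)
  then show thesis using that p divides_primepow_nat by blast
qed

text \<open>A nonzero exponent forces a proper kernel, and the strict inequality chi(1)^2 < p^e
  chi(1) can be divided by chi(1).\<close>

lemma degree_less:
  assumes \<chi>: "\<chi> \<in> Irr G" "e \<chi> \<noteq> 0" shows "deg \<chi> < p ^ e \<chi>"
proof -
  have "ker \<chi> \<noteq> carrier G"
  proof
    assume k: "ker \<chi> = carrier G"
    have "idx (carrier G) = 1"
      using index_mult_card[OF subgroup_self] card_carrier_pos by simp
    then have "p ^ e \<chi> = 1" using index_kernel[OF \<chi>(1)] k by simp
    then show False using \<chi>(2) p1 by simp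
  qed
  then have "(deg \<chi>)\<^sup>2 < p ^ e \<chi> * deg \<chi>"
    using degree_bound(2)[OF \<chi>(1)] index_kernel[OF \<chi>(1)] by simp
  then show ?thesis by (simp add: power2_eq_square)
qed

lemma degree_one_if_e_le_1:
  assumes \<chi>: "\<chi> \<in> Irr G" "e \<chi> \<le> 1" shows "deg \<chi> = 1"
proof (cases "e \<chi> = 0")
  case True
  then have "(deg \<chi>)\<^sup>2 \<le> deg \<chi>"
    using degree_bound(1)[OF \<chi>(1)] index_kernel[OF \<chi>(1)] by simp
  then show ?thesis using chi_degree_pos[OF \<chi>(1)] by (simp add: power2_eq_square)
next
  case False
  then have "e \<chi> = 1" using \<chi>(2) by simp
  moreover obtain k where "deg \<chi> = p ^ k" by (rule degree_power[OF \<chi>(1)])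
  ultimately have "p ^ k < p ^ 1" "deg \<chi> = p ^ k" using degree_less[OF \<chi>(1) False] by auto
  then show ?thesis using p1 power_less_imp_less_exp[of p k 1] by simp
qed

lemma nonlinear_degree:
  assumes \<chi>: "\<chi> \<in> Irr G" "deg \<chi> \<noteq> 1" shows "p dvd deg \<chi>"
proof -
  obtain k where k: "deg \<chi> = p ^ k" by (rule degree_power[OF \<chi>(1)])
  then have "k \<noteq> 0" using \<chi>(2) by (metis power_0)
  then show ?thesis using k by simp
qed

lemma degree_if_e_eq_2:
  assumes \<chi>: "\<chi> \<in> Irr G" "e \<chi> = 2" "deg \<chi> \<noteq> 1" shows "deg \<chi> = p"
proof -
  obtain k where k: "deg \<chi> = p ^ k" by (rule degree_power[OF \<chi>(1)])
  then have "k \<noteq> 0" using \<chi>(3) by (metis power_0)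
  moreover have "p ^ k < p ^ 2" using degree_less[OF \<chi>(1)] \<chi>(2) k by simp
  then have "k < 2" using p1 power_less_imp_less_exp by blast
  ultimately show ?thesis using k by (simp add: less_2_cases_iff)
qed

text \<open>All characters of codegree at most p are linear, so here the linear count is the full
  count. For p^2 only an upper bound is available at this stage.\<close>

lemma index_P1: "idx (powers p) = p ^ 2"
proof -
  have "{\<chi> \<in> Irr G. deg \<chi> = 1 \<and> e \<chi> \<le> 1} = {\<chi> \<in> Irr G. e \<chi> \<le> 1}"
    using degree_one_if_e_le_1 by blast
  then show ?thesis using powers_index[OF p index_kernel, of 1] count1 by simp
qed

lemma index_P2: "idx (powers (p * p)) = card {\<chi> \<in> Irr G. deg \<chi> = 1 \<and> e \<chi> \<le> 2}"
  using powers_index[OF p index_kernel, of 2] by (simp add: power2_eq_square)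

lemma index_P2_le: "idx (powers (p * p)) \<le> p ^ 3"
  unfolding index_P2 count2[symmetric] using finite_Irr by (intro card_mono) auto

lemma linear_iff: "\<chi> \<in> Irr G \<Longrightarrow> deg \<chi> = 1 \<longleftrightarrow> \<D> \<subseteq> ker \<chi>"
  using derived_in_kernel_imp_degree_one linear_character_derived by blast

lemma index_D: "idx \<D> = card {\<chi> \<in> Irr G. deg \<chi> = 1}"
  unfolding linear_characters_above[OF derived_normal order_refl, symmetric]
  using linear_iff by (metis (no_types, lifting))

lemma sum_squares: "(\<Sum>\<chi>\<in>Irr G. (deg \<chi>)\<^sup>2) = card (carrier G)"
proof -
  have "{\<chi> \<in> Irr G. {\<one>} \<subseteq> ker \<chi>} = Irr G" by (auto simp: char_kernel_def)
  moreover have "idx {\<one>} = card (carrier G)" using index_mult_card[OF triv_subgroup] by simp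
  ultimately show ?thesis using Irr_above_normal(2)[OF one_is_normal] by simp
qed

text \<open>Lifts the generators of the abelianization to G. The hypotheses of
  \<open>two_generators\<close> come from index p^2 for \<open>powers p\<close> and index at most
  p^3 for \<open>powers (p * p)\<close>.\<close>

lemma generators:
  obtains x y where "x \<in> carrier G" "y \<in> carrier G" "y [^] p \<in> \<D>"
    "\<And>g. g \<in> carrier G \<Longrightarrow> \<exists>(i::nat) (j::nat). \<D> #> g = \<D> #> (x [^] i \<otimes> y [^] j)"
    "\<And>g. g \<in> carrier G \<Longrightarrow> \<exists>i::nat. \<D> #> (g [^] p) = \<D> #> ((x [^] p) [^] i)"
    "\<And>H. subgroup H G \<Longrightarrow> x \<in> H \<Longrightarrow> y \<in> H \<Longrightarrow> \<D> \<subseteq> H \<Longrightarrow> H = carrier G"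
proof -
  interpret D: normal \<D> G by (rule derived_normal)
  obtain k where "p_group (G Mod \<D>) p k" using quotient_p_group[OF derived_normal] by blast
  then interpret Q: p_group "G Mod \<D>" p k .
  let ?a = "card ((\<lambda>b. b [^]\<^bsub>G Mod \<D>\<^esub> p) ` carrier (G Mod \<D>))"
  let ?b = "card ((\<lambda>b. b [^]\<^bsub>G Mod \<D>\<^esub> (p * p)) ` carrier (G Mod \<D>))"
  have cQ: "card (carrier (G Mod \<D>)) = idx \<D>" by (simp add: FactGroup_def)
  have D0: "card \<D> > 0" by (rule card_subgroup_pos[OF D.is_subgroup])
  have i: "idx H * card H = idx \<D> * card \<D>" if "H \<lhd> G" for H
    using index_mult_card[OF normal_imp_subgroup[OF that]] index_mult_card[OF D.is_subgroup] by simp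
  have "p ^ 2 * (card \<D> * ?a) = idx \<D> * card \<D>"
    using i[OF powers_normal[of p]] unfolding index_P1 card_powers .
  then have c1: "card (carrier (G Mod \<D>)) = p * p * ?a"
    using D0 cQ by (simp add: power2_eq_square)
  have "idx \<D> * card \<D> = idx (powers (p * p)) * (card \<D> * ?b)"
    using i[OF powers_normal[of "p * p"], symmetric] unfolding card_powers .
  also have "\<dots> \<le> p ^ 3 * (card \<D> * ?b)" using index_P2_le by (rule mult_le_mono1)
  finally have "idx \<D> * card \<D> \<le> (p ^ 3 * ?b) * card \<D>" by (simp add: ac_simps)
  then have "p * p * ?a \<le> p ^ 3 * ?b" using D0 c1 cQ by simp
  then have c2: "?a \<le> p * ?b" using p1 by (simp add: power3_eq_cube)
  obtain X Y where XY: "X \<in> carrier (G Mod \<D>)" "Y \<in> carrier (G Mod \<D>)" "Y [^]\<^bsub>G Mod \<D>\<^esub> p = \<one>\<^bsub>G Mod \<D>\<^esub>"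
    and g: "\<And>g. g \<in> carrier (G Mod \<D>) \<Longrightarrow> \<exists>(i::nat) (j::nat). g = X [^]\<^bsub>G Mod \<D>\<^esub> i \<otimes>\<^bsub>G Mod \<D>\<^esub> Y [^]\<^bsub>G Mod \<D>\<^esub> j"
    and h: "\<And>g. g \<in> carrier (G Mod \<D>) \<Longrightarrow> \<exists>i::nat. g [^]\<^bsub>G Mod \<D>\<^esub> p = (X [^]\<^bsub>G Mod \<D>\<^esub> p) [^]\<^bsub>G Mod \<D>\<^esub> i"
    by (rule Q.two_generators[OF derived_quot_is_comm_group c1 c2]) (rule that)
  from XY obtain x y where x: "x \<in> carrier G" "X = \<D> #> x" and y: "y \<in> carrier G" "Y = \<D> #> y"
    by (auto simp: carrier_FactGroup)
  have gg: "\<exists>(i::nat) (j::nat). \<D> #> u = \<D> #> (x [^] i \<otimes> y [^] j)" if u: "u \<in> carrier G" for u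
  proof -
    obtain i j :: nat where "\<D> #> u = X [^]\<^bsub>G Mod \<D>\<^esub> i \<otimes>\<^bsub>G Mod \<D>\<^esub> Y [^]\<^bsub>G Mod \<D>\<^esub> j"
      using g[OF D.coset_closed[OF u]] by blast
    also have "\<dots> = \<D> #> (x [^] i \<otimes> y [^] j)"
      unfolding x(2) y(2) D.FactGroup_pow[OF x(1)] D.FactGroup_pow[OF y(1)]
      using x(1) y(1) by (intro D.coset_mult[symmetric]) auto
    finally show ?thesis by blast
  qed
  show thesis
  proof (rule that[OF x(1) y(1) _ gg])
    show "y [^] p \<in> \<D>" using XY(3) D.coset_pow_eq_iff[OF y(1)] y(2) by blast
    show "\<exists>i::nat. \<D> #> (u [^] p) = \<D> #> ((x [^] p) [^] i)" if u: "u \<in> carrier G" for u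
    proof -
      obtain i :: nat where "(\<D> #> u) [^]\<^bsub>G Mod \<D>\<^esub> p = (X [^]\<^bsub>G Mod \<D>\<^esub> p) [^]\<^bsub>G Mod \<D>\<^esub> i"
        using h[OF D.coset_closed[OF u]] by blast
      then show ?thesis unfolding x(2) using D.FactGroup_pow u x(1) by (metis nat_pow_closed)
    qed
    show "H = carrier G" if H: "subgroup H G" "x \<in> H" "y \<in> H" "\<D> \<subseteq> H" for H
    proof (rule subset_antisym[OF subgroup.subset[OF H(1)]], rule subsetI)
      fix u assume u: "u \<in> carrier G"
      obtain i j :: nat where "\<D> #> u = \<D> #> (x [^] i \<otimes> y [^] j)" using gg[OF u] by blast
      then have "u \<in> \<D> #> (x [^] i \<otimes> y [^] j)" using rcos_self[OF u D.is_subgroup] by simp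
      then obtain d where d: "d \<in> \<D>" "u = d \<otimes> (x [^] i \<otimes> y [^] j)" by (auto simp: r_coset_def)
      have "x [^] i \<otimes> y [^] j \<in> H"
        by (intro subgroup.m_closed[OF H(1)] pow_in_subgroup[OF H(1)] H)
      then show "u \<in> H" using d H(4) subgroup.m_closed[OF H(1)] by blast
    qed
  qed
qed

text \<open>Modulo \<open>\<D>\<close> every p-th power is a power of x^p, so x^p in
  \<open>\<D>\<close> makes the abelianization elementary abelian.\<close>

lemma powers_eq_derived:
  assumes x: "x \<in> carrier G" and pw: "\<And>g. g \<in> carrier G \<Longrightarrow> \<exists>i::nat. \<D> #> (g [^] p) = \<D> #> ((x [^] p) [^] i)"
    and xD: "x [^] p \<in> \<D>"
  shows "powers p = \<D>"
proof (rule subset_antisym[OF _ derived_le_powers], rule subsetI)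
  interpret D: normal \<D> G by (rule derived_normal)
  fix u assume "u \<in> powers p"
  then obtain g where u: "u \<in> carrier G" "g \<in> carrier G" "\<D> #> u = \<D> #> (g [^] p)"
    unfolding powers_iff by blast
  obtain j :: nat where "\<D> #> (g [^] p) = \<D> #> ((x [^] p) [^] j)" using pw[OF u(2)] by blast
  moreover have "(x [^] p) [^] j \<in> \<D>" by (rule pow_in_subgroup[OF D.is_subgroup xD])
  ultimately have "\<D> #> u = \<D>" using u(3) D.coset_eq_self_iff[of "(x [^] p) [^] j"] x by simp
  then show "u \<in> \<D>" using D.coset_eq_self_iff[OF u(1)] by simp
qed

lemma P2_le_P1: "powers (p * p) \<subseteq> powers p"
proof
  fix u assume "u \<in> powers (p * p)"
  then obtain h where h: "u \<in> carrier G" "h \<in> carrier G" "\<D> #> u = \<D> #> (h [^] (p * p))"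
    unfolding powers_iff by blast
  have "h [^] (p * p) = (h [^] p) [^] p" using h(2) by (simp add: nat_pow_pow)
  then show "u \<in> powers p" unfolding powers_iff using h by auto
qed

lemma index_P2_cases:
  "idx (powers (p * p)) = p ^ 2 \<or> idx (powers (p * p)) = p ^ 3"
proof -
  note sg = normal_imp_subgroup[OF powers_normal]
  obtain k where k: "idx (powers (p * p)) = p ^ k" by (rule index_power[OF sg])
  have "p ^ 2 \<le> p ^ k" using index_anti_mono[OF sg sg P2_le_P1] index_P1 k by simp
  then have "2 \<le> k" using p1 by (simp only: power_increasing_iff)
  moreover have "p ^ k \<le> p ^ 3" using index_P2_le k by simp
  then have "k \<le> 3" using p1 by (simp only: power_increasing_iff)
  ultimately have "k = 2 \<or> k = 3" by arith
  then show ?thesis using k by auto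
qed

text \<open>This index would make G/G' elementary abelian. Two kernels of nonlinear characters of
  codegree p^2 must then coincide, because G' is central modulo their intersection and so has order
  at most p over it; but a quotient of order p^3 cannot carry p^2 characters of degree p.\<close>

lemma index_P2_neq: "idx (powers (p * p)) \<noteq> p ^ 2"
proof
  assume i2: "idx (powers (p * p)) = p ^ 2"
  interpret D: normal \<D> G by (rule derived_normal)
  interpret Q: group "G Mod \<D>" by (rule D.factorgroup_is_group)
  note sgP = normal_imp_subgroup[OF powers_normal]
  have "p ^ 2 * card (powers (p * p)) = p ^ 2 * card (powers p)"
    using index_mult_card[OF sgP, of p] index_mult_card[OF sgP, of "p * p"] i2 index_P1 by simp
  then have "card (powers p) \<le> card (powers (p * p))" using p1 by simp
  then have P12: "powers (p * p) = powers p"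
    by (rule subgroup_eq_if_card_le[OF sgP sgP P2_le_P1])
  obtain x y where x: "x \<in> carrier G" and y: "y \<in> carrier G" "y [^] p \<in> \<D>"
    and pw: "\<And>g. g \<in> carrier G \<Longrightarrow> \<exists>i::nat. \<D> #> (g [^] p) = \<D> #> ((x [^] p) [^] i)"
    and gen: "\<And>H. subgroup H G \<Longrightarrow> x \<in> H \<Longrightarrow> y \<in> H \<Longrightarrow> \<D> \<subseteq> H \<Longrightarrow> H = carrier G"
    by (rule generators) (rule that)
  \<comment> \<open>Modulo \<open>\<D>\<close>: x^p = h^(p^2) and h^p = (x^p)^i, so x^p =
    (x^p)^(ip). Iterating n times puts the factor p^n = |G| into the exponent, so x^p is
    trivial.\<close>
  have "x [^] p \<in> powers p" unfolding powers_iff using x by auto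
  then obtain h where h: "h \<in> carrier G" "\<D> #> (x [^] p) = \<D> #> (h [^] (p * p))"
    unfolding P12[symmetric] powers_iff by blast
  obtain i :: nat where i: "\<D> #> (h [^] p) = \<D> #> ((x [^] p) [^] i)" using pw[OF h(1)] by blast
  let ?U = "\<D> #> (x [^] p)"
  have U: "?U \<in> carrier (G Mod \<D>)" using D.coset_closed x by simp
  have "?U = (\<D> #> (h [^] p)) [^]\<^bsub>G Mod \<D>\<^esub> p"
    using h D.FactGroup_pow[of "h [^] p" p] by (simp add: nat_pow_pow)
  also have "\<dots> = ?U [^]\<^bsub>G Mod \<D>\<^esub> (i * p)"
    unfolding i using D.FactGroup_pow[of "x [^] p" i] x U by (simp add: Q.nat_pow_pow[symmetric])
  finally have U1: "?U [^]\<^bsub>G Mod \<D>\<^esub> (i * p) = ?U" by simp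
  have "?U [^]\<^bsub>G Mod \<D>\<^esub> ((i * p) ^ m) = ?U" for m
  proof (induction m)
    case (Suc m)
    have "?U [^]\<^bsub>G Mod \<D>\<^esub> ((i * p) ^ Suc m) = (?U [^]\<^bsub>G Mod \<D>\<^esub> (i * p)) [^]\<^bsub>G Mod \<D>\<^esub> ((i * p) ^ m)"
      unfolding power_Suc by (rule Q.nat_pow_pow[OF U, symmetric])
    then show ?case unfolding U1 Suc.IH .
  qed (simp only: power_0 Q.nat_pow_eone[OF U])
  from this[of n] have "?U = ?U [^]\<^bsub>G Mod \<D>\<^esub> (p ^ n * i ^ n)" by (simp add: power_mult_distrib mult.commute)
  also have "\<dots> = \<D> #> ((x [^] p) [^] (p ^ n * i ^ n))" using x by (simp add: D.FactGroup_pow)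
  also have "(x [^] p) [^] (p ^ n * i ^ n) = ((x [^] p) [^] card (carrier G)) [^] (i ^ n)"
    using x card_G by (simp add: nat_pow_pow mult.assoc)
  also have "\<dots> = \<one>" using pow_card_carrier[of "x [^] p"] x by simp
  finally have "\<D> #> (x [^] p) = \<D>" using D.subset coset_mult_one by simp
  then have xD: "x [^] p \<in> \<D>" using D.coset_eq_self_iff x by simp
  have "powers p = \<D>" by (rule powers_eq_derived[OF x pw xD])
  then have iD: "idx \<D> = p ^ 2" using index_P1 by simp
  \<comment> \<open>There are only p^2 linear characters, and those of codegree at most p already
    exhaust them; hence every character of codegree p^2 is nonlinear.\<close>
  have lin: "{\<chi> \<in> Irr G. deg \<chi> = 1} = {\<chi> \<in> Irr G. e \<chi> \<le> 1}"
  proof (rule card_subset_eq[symmetric])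
    show "finite {\<chi> \<in> Irr G. deg \<chi> = 1}" using finite_Irr by simp
    show "{\<chi> \<in> Irr G. e \<chi> \<le> 1} \<subseteq> {\<chi> \<in> Irr G. deg \<chi> = 1}" using degree_one_if_e_le_1 by blast
    show "card {\<chi> \<in> Irr G. e \<chi> \<le> 1} = card {\<chi> \<in> Irr G. deg \<chi> = 1}" using index_D iD count1 by simp
  qed
  \<comment> \<open>Its size is p^3 - p^2, which is at least p^2 since p is at least 2.\<close>
  define E where "E = {\<chi> \<in> Irr G. e \<chi> = 2}"
  have "{\<chi> \<in> Irr G. e \<chi> \<le> 2} = {\<chi> \<in> Irr G. e \<chi> \<le> 1} \<union> E" by (auto simp: E_def)
  moreover have "{\<chi> \<in> Irr G. e \<chi> \<le> 1} \<inter> E = {}" by (auto simp: E_def)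
  ultimately have "p ^ 3 = p ^ 2 + card E"
    using count1 count2 card_Un_disjoint[of "{\<chi> \<in> Irr G. e \<chi> \<le> 1}" E] finite_Irr by (simp add: E_def)
  moreover have "p ^ 3 \<ge> 2 * p ^ 2" using p1 by (simp add: power3_eq_cube power2_eq_square)
  ultimately have cE: "card E \<ge> p ^ 2" by simp
  have Edeg: "deg \<chi> = p" "idx (ker \<chi>) = p ^ 3" if "\<chi> \<in> E" for \<chi>
  proof -
    have \<chi>: "\<chi> \<in> Irr G" "e \<chi> = 2" using that by (auto simp: E_def)
    have "deg \<chi> \<noteq> 1" using lin \<chi> by (metis (mono_tags, lifting) mem_Collect_eq numeral_le_one_iff semiring_norm(69))
    then show d: "deg \<chi> = p" by (rule degree_if_e_eq_2[OF \<chi>])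
    show "idx (ker \<chi>) = p ^ 3"
      using index_kernel[OF \<chi>(1)] d \<chi>(2) by (simp add: power3_eq_cube power2_eq_square)
  qed
  have Eker: "ker \<chi> \<subseteq> \<D>" "card \<D> = p * card (ker \<chi>)" "\<D> \<subseteq> central_mod (ker \<chi>)"
    if \<chi>E: "\<chi> \<in> E" for \<chi>
  proof -
    have \<chi>: "\<chi> \<in> Irr G" using \<chi>E by (simp add: E_def)
    let ?N = "ker \<chi>"
    have N: "?N \<lhd> G" by (rule char_kernel_normal[OF \<chi>])
    define S where "S = {\<psi> \<in> Irr G. ?N \<subseteq> ker \<psi>}"
    define T where "T = {\<psi> \<in> S. deg \<psi> = 1}"
    have fS: "finite S" using finite_Irr by (simp add: S_def)
    have "p ^ 3 = (\<Sum>\<psi>\<in>S. (deg \<psi>)\<^sup>2)" using Irr_above_normal(2)[OF N] Edeg(2)[OF \<chi>E] by (simp add: S_def)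
    also have "\<dots> = (\<Sum>\<psi>\<in>T. (deg \<psi>)\<^sup>2) + (\<Sum>\<psi>\<in>S - T. (deg \<psi>)\<^sup>2)"
      using fS by (subst sum.subset_diff[of T S]) (auto simp: T_def)
    also have "(\<Sum>\<psi>\<in>T. (deg \<psi>)\<^sup>2) = card T" by (simp add: T_def)
    finally have s: "p ^ 3 = card T + (\<Sum>\<psi>\<in>S - T. (deg \<psi>)\<^sup>2)" .
    \<comment> \<open>Nonlinear degrees are divisible by p, so p^2 divides the number of linear
      characters above \<open>?N\<close>. The trivial one makes that number positive, so all p^2
      linear characters lie above \<open>?N\<close>, whence \<open>?N\<close> is contained in
      \<open>\<D>\<close>.\<close>
    have "p ^ 2 dvd (\<Sum>\<psi>\<in>S - T. (deg \<psi>)\<^sup>2)"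
      using nonlinear_degree by (intro dvd_sum dvd_power_same) (auto simp: S_def T_def)
    moreover have "p ^ 2 dvd p ^ 3" by (rule le_imp_power_dvd) simp
    ultimately have dv: "p ^ 2 dvd card T" using s by (metis dvd_add_left_iff)
    obtain \<tau> where "\<tau> \<in> Irr G" "ker \<tau> = carrier G" "deg \<tau> = 1"
      by (rule trivial_character) (rule that)
    then have "\<tau> \<in> T" using subgroup.subset[OF kernel_subgroup[OF \<chi>]] by (simp add: T_def S_def)
    then have "card T > 0" using fS by (auto simp: card_gt_0_iff T_def)
    then have "p ^ 2 \<le> card T" using dv by (rule dvd_imp_le[rotated])
    then have T: "T = {\<chi> \<in> Irr G. deg \<chi> = 1}"
      using finite_Irr index_D iD by (intro card_seteq) (auto simp: T_def S_def)
    show ND: "?N \<subseteq> \<D>"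
    proof
      fix u assume u: "u \<in> ?N"
      show "u \<in> \<D>"
      proof (rule mem_if_in_all_kernels[OF derived_normal])
        show "u \<in> carrier G" using u by (simp add: char_kernel_def)
        fix \<psi> assume \<psi>: "\<psi> \<in> Irr G" "\<D> \<subseteq> ker \<psi>"
        then have "\<psi> \<in> T" unfolding T using linear_iff[OF \<psi>(1)] by simp
        then show "u \<in> ker \<psi>" using u by (auto simp: T_def S_def)
      qed
    qed
    have "p ^ 2 * card \<D> = p ^ 2 * (p * card ?N)"
      using index_mult_card[OF D.is_subgroup] index_mult_card[OF kernel_subgroup[OF \<chi>]] iD Edeg(2)[OF \<chi>E]
      by (simp add: power3_eq_cube power2_eq_square mult.assoc)
    then show cD: "card \<D> = p * card ?N" using p1 by simp
    have N0: "card ?N > 0" by (rule card_subgroup_pos[OF kernel_subgroup[OF \<chi>]])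
    then have "card ?N < card \<D>" unfolding cD using p1 by simp
    then have "?N \<subset> \<D>" using ND less_irrefl psubsetI by metis
    \<comment> \<open>As \<open>\<D>\<close> has order p over \<open>?N\<close>, the group
      \<open>L\<close> is forced to be \<open>?N\<close>, over which \<open>\<D>\<close> is
      therefore central.\<close>
    then obtain L where L: "L \<lhd> G" "?N \<subseteq> L" "card \<D> = p * card L" "\<D> \<subseteq> central_mod L"
      using maximal_normal_below[OF derived_normal N] by metis
    have "?N = L"
      using cD L(3) p1 by (intro subgroup_eq_if_card_le[OF kernel_subgroup[OF \<chi>] normal_imp_subgroup[OF L(1)] L(2)]) simp
    then show "\<D> \<subseteq> central_mod ?N" using L(4) by simp
  qed
  have "E \<noteq> {}" using cE p1 by auto
  then obtain \<chi> where \<chi>E: "\<chi> \<in> E" by blast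
  then have \<chi>: "\<chi> \<in> Irr G" by (simp add: E_def)
  let ?N = "ker \<chi>"
  have same: "ker \<psi> = ?N" if \<psi>E: "\<psi> \<in> E" for \<psi>
  proof -
    have \<psi>: "\<psi> \<in> Irr G" using \<psi>E by (simp add: E_def)
    \<comment> \<open>Centrality modulo both kernels gives centrality modulo the intersection. The
      bound p for \<open>\<D>\<close> over \<open>?M\<close> then leaves no room between
      \<open>?M\<close> and either kernel.\<close>
    let ?M = "ker \<psi> \<inter> ?N"
    note K = char_kernel_normal[OF \<chi>] char_kernel_normal[OF \<psi>]
    have M: "?M \<lhd> G" by (rule normal_Int[OF K(2,1)])
    have "\<D> \<subseteq> central_mod ?M"
    proof
      fix d assume d: "d \<in> \<D>"
      then have dG: "d \<in> carrier G" using D.subset by auto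
      have "g \<in> commuting_mod ?M d" if g: "g \<in> carrier G" for g
      proof -
        have "g \<in> commuting_mod ?N d" "g \<in> commuting_mod (ker \<psi>) d"
          using Eker(3)[OF \<chi>E] Eker(3)[OF \<psi>E] d g by (auto simp: central_mod_iff)
        then show ?thesis
          using commutator_in_iff[OF M dG g] commutator_in_iff[OF K(1) dG g] commutator_in_iff[OF K(2) dG g] by blast
      qed
      then show "d \<in> central_mod ?M" using dG by (auto simp: central_mod_def commuting_mod_def)
    qed
    then have "card \<D> \<le> p * card ?M"
      using class_two_bound(1)[OF x y _ gen M] p1 by simp
    then have le: "card ?N \<le> card ?M" "card (ker \<psi>) \<le> card ?M"
      using Eker(2)[OF \<chi>E] Eker(2)[OF \<psi>E] p1 by auto
    note sg = normal_imp_subgroup[OF M] normal_imp_subgroup[OF K(1)] normal_imp_subgroup[OF K(2)]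
    show ?thesis
      using subgroup_eq_if_card_le[OF sg(1,2) Int_lower2 le(1)]
        subgroup_eq_if_card_le[OF sg(1,3) Int_lower1 le(2)] by (rule trans[OF sym, rotated])
  qed
  \<comment> \<open>All characters in \<open>E\<close> contribute p^2 to the sum of squares of one
    quotient of order p^3.\<close>
  have "p ^ 2 * p ^ 2 \<le> card E * p ^ 2" using cE by (rule mult_le_mono1)
  also have "\<dots> = (\<Sum>\<psi>\<in>E. (deg \<psi>)\<^sup>2)" using Edeg(1) by simp
  also have "\<dots> \<le> (\<Sum>\<psi> | \<psi> \<in> Irr G \<and> ?N \<subseteq> ker \<psi>. (deg \<psi>)\<^sup>2)"
    using finite_Irr same by (intro sum_mono2) (auto simp: E_def)
  also have "\<dots> = p ^ 3" using Irr_above_normal(2)[OF char_kernel_normal[OF \<chi>]] Edeg(2)[OF \<chi>E] by simp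
  finally have "p ^ 4 \<le> p ^ 3" by (simp add: power_add[symmetric])
  then show False using p1 by (simp only: power_increasing_iff)
qed

section \<open>The remaining case: characters of codegree p^2 are linear\<close>

lemma index_P2_eq: "idx (powers (p * p)) = p ^ 3"
  using index_P2_cases index_P2_neq by blast

text \<open>\<open>index_P2\<close> counts the linear characters among those of codegree at most
  p^2; both numbers are now p^3, so none of the latter is nonlinear.\<close>

lemma linear_if_e_le_2: assumes "\<chi> \<in> Irr G" "e \<chi> \<le> 2" shows "deg \<chi> = 1"
proof -
  have "{\<chi> \<in> Irr G. deg \<chi> = 1 \<and> e \<chi> \<le> 2} = {\<chi> \<in> Irr G. e \<chi> \<le> 2}"
    using finite_Irr index_P2 index_P2_eq count2 by (intro card_subset_eq) auto
  then show ?thesis using assms by blast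
qed

text \<open>A character above \<open>N\<close> with codegree p^3 has kernel index p^3 times its
  degree, so the bound on the index makes it linear too; \<open>\<D>\<close> then lies in every
  kernel above \<open>N\<close>.\<close>

lemma derived_le_if_index_le:
  assumes N: "N \<lhd> G" "idx N \<le> p ^ 3" shows "\<D> \<subseteq> N"
proof
  fix d assume d: "d \<in> \<D>"
  show "d \<in> N"
  proof (rule mem_if_in_all_kernels[OF N(1)])
    show "d \<in> carrier G" using d subgroup.subset[OF normal_imp_subgroup[OF derived_normal]] by auto
    fix \<chi> assume \<chi>: "\<chi> \<in> Irr G" "N \<subseteq> ker \<chi>"
    have le: "idx (ker \<chi>) \<le> p ^ 3"
      using index_anti_mono[OF normal_imp_subgroup[OF N(1)] kernel_subgroup[OF \<chi>(1)] \<chi>(2)] N(2) by simp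
    have "deg \<chi> = 1"
    proof (cases "e \<chi> \<le> 2")
      case False
      then have "e \<chi> = 3" using e_le[OF \<chi>(1)] by simp
      then have "p ^ 3 * deg \<chi> \<le> p ^ 3 * 1" using le index_kernel[OF \<chi>(1)] by simp
      then have "deg \<chi> \<le> 1" using p1 by simp
      then show ?thesis using chi_degree_pos[OF \<chi>(1)] by simp
    qed (rule linear_if_e_le_2[OF \<chi>(1)])
    then show "d \<in> ker \<chi>" using linear_iff[OF \<chi>(1)] d by blast
  qed
qed

text \<open>Otherwise there are two steps of index p below \<open>\<D>\<close>, to \<open>M\<close>
  and on to \<open>M1\<close>. The element x^(p^2) generates \<open>\<D>\<close> modulo
  \<open>M\<close> and is central modulo \<open>M1\<close>, so \<open>class_two_bound\<close>
  applies to \<open>M1\<close> and contradicts the order p^2 of the quotient.\<close>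

lemma card_derived_le:
  assumes iD: "idx \<D> = p ^ 3" shows "card \<D> \<le> p"
proof (rule ccontr)
  assume "\<not> card \<D> \<le> p"
  then have big: "p < card \<D>" by simp
  interpret D: normal \<D> G by (rule derived_normal)
  note sgP = normal_imp_subgroup[OF powers_normal]
  obtain x y where x: "x \<in> carrier G" and y: "y \<in> carrier G" "y [^] p \<in> \<D>"
    and pw: "\<And>g. g \<in> carrier G \<Longrightarrow> \<exists>i::nat. \<D> #> (g [^] p) = \<D> #> ((x [^] p) [^] i)"
    and gen: "\<And>H. subgroup H G \<Longrightarrow> x \<in> H \<Longrightarrow> y \<in> H \<Longrightarrow> \<D> \<subseteq> H \<Longrightarrow> H = carrier G"
    by (rule generators) (rule that)
  have p0: "p > 0" using p1 by simp
  have "{\<one>} \<subset> \<D>" using big p1 D.one_closed by (metis card_1_singleton_iff One_nat_def empty_subsetI insert_subset less_asym psubsetI)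
  then obtain M where M: "M \<lhd> G" "M \<subset> \<D>" "card \<D> = p * card M" "\<D> \<subseteq> central_mod M"
    using maximal_normal_below[OF derived_normal one_is_normal] by metis
  interpret M: normal M G by (rule M(1))
  have "card M > 1" using big M(3) by (metis less_irrefl linorder_neqE_nat mult.right_neutral mult_0_right not_less_zero less_one)
  then have "{\<one>} \<subset> M" using M.one_closed by (metis card_1_singleton_iff One_nat_def empty_subsetI insert_subset less_irrefl psubsetI)
  then obtain M1 where M1: "M1 \<lhd> G" "M1 \<subset> M" "card M = p * card M1" "M \<subseteq> central_mod M1"
    and M1p: "\<And>d. d \<in> M \<Longrightarrow> d [^] p \<in> M1"
    using maximal_normal_below[OF M(1) one_is_normal] by metis
  interpret M1: normal M1 G by (rule M1(1))
  \<comment> \<open>\<open>\<D>\<close> and \<open>powers (p * p)\<close> have the same index p^3,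
    so they coincide and x^(p^2) lies in \<open>\<D>\<close>.\<close>
  have "p ^ 3 * card (powers (p * p)) = p ^ 3 * card \<D>"
    using index_mult_card[OF sgP, of "p * p"] index_mult_card[OF D.is_subgroup] iD index_P2_eq by simp
  then have "card (powers (p * p)) \<le> card \<D>" using p1 by simp
  then have P2D: "\<D> = powers (p * p)"
    by (rule subgroup_eq_if_card_le[OF D.is_subgroup sgP derived_le_powers])
  define w where "w = x [^] p"
  have w: "w \<in> carrier G" using x by (simp add: w_def)
  have "x [^] (p * p) \<in> \<D>" by (subst P2D, subst powers_iff) (use x in auto)
  then have wpD: "w [^] p \<in> \<D>" using x by (simp add: w_def nat_pow_pow)
  \<comment> \<open>Otherwise G/G' would be elementary abelian, with order p^2 by
    \<open>index_P1\<close>.\<close>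
  have wD: "w \<notin> \<D>"
  proof
    assume wD: "w \<in> \<D>"
    have "powers p = \<D>"
      using wD unfolding w_def by (intro powers_eq_derived[OF x pw])
    then have "p ^ 3 = p ^ 2" using iD index_P1 by simp
    then show False using p1 by (simp only: power_inject_exp)
  qed
  have wM: "w \<in> central_mod M" unfolding w_def by (rule class_two_bound(2)[OF x y p0 gen M(1,4)])
  \<comment> \<open>Otherwise \<open>adjoin w M\<close> would be a normal subgroup of index p^3, its
    quotient would be abelian, and by order it would equal \<open>\<D>\<close>, although it contains
    \<open>w\<close>.\<close>
  have wpM: "w [^] p \<notin> M"
  proof
    assume wp: "w [^] p \<in> M"
    define L where "L = adjoin w M"
    note F = adjoin_facts[OF M(1) w, folded L_def]
    have L: "L \<lhd> G" unfolding L_def by (rule adjoin_normal(1)[OF M(1) wM])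
    have "card L \<le> card \<D>" using adjoin_card_le[OF M(1) w wp p0] M(3) by (simp add: L_def)
    moreover have "card \<D> \<le> card L"
      unfolding M(3) using F(2,3) wD M(2) by (intro card_jump[OF M.is_subgroup F(1)]) blast
    ultimately have cL: "card L = card \<D>" by simp
    then have "idx L * card \<D> = p ^ 3 * card \<D>"
      using index_mult_card[OF F(1)] index_mult_card[OF D.is_subgroup] iD by simp
    then have "idx L \<le> p ^ 3" using big by simp
    then have "\<D> \<subseteq> L" by (rule derived_le_if_index_le[OF L])
    then have "\<D> = L" using cL by (intro subgroup_eq_if_card_le[OF D.is_subgroup F(1)]) simp_all
    then show False using F(3) wD by simp
  qed
  define u where "u = w [^] p"
  have u: "u \<in> carrier G" using w by (simp add: u_def)
  note F = adjoin_facts[OF M(1) u]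
  have "adjoin u M \<subseteq> \<D>" using F(5)[OF D.is_subgroup] M(2) wpD by (simp add: u_def psubset_imp_subset)
  moreover have "card \<D> \<le> card (adjoin u M)"
    unfolding M(3) using F(2,3) wpM by (intro card_jump[OF M.is_subgroup F(1)]) (auto simp: u_def)
  ultimately have uD: "adjoin u M = \<D>" by (rule subgroup_eq_if_card_le[OF F(1) D.is_subgroup])
  \<comment> \<open>For any g the commutator c = [w, g] lies in \<open>M\<close>, hence is central
    modulo \<open>M1\<close> and has its p-th power in \<open>M1\<close>; so [w^p, g] = c^p is
    trivial there.\<close>
  have "u \<in> central_mod M1"
    unfolding central_mod_def
  proof (intro CollectI conjI ballI u)
    fix g assume g: "g \<in> carrier G"
    define c where "c = w \<otimes> g \<otimes> inv w \<otimes> inv g"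
    have c: "c \<in> carrier G" using w g by (simp add: c_def)
    have "g \<in> commuting_mod M w" using wM g by (auto simp: central_mod_def commuting_mod_def)
    then have cM: "c \<in> M" unfolding c_def using commutator_in_iff[OF M(1) w g] by blast
    then have cc: "c \<in> central_mod M1" using M1(4) by blast
    have wg: "w \<otimes> g = c \<otimes> (g \<otimes> w)" using w g by (simp add: c_def m_assoc) (simp add: m_assoc[symmetric])
    have "M1 #> (u \<otimes> g) = M1 #> (c [^] p \<otimes> (g \<otimes> u))"
      unfolding u_def using cc w by (intro M1.commutator_pow_mod(1)[OF g w c wg]) (simp add: central_mod_def)
    also have "\<dots> = M1 #> (g \<otimes> u)" using M1p[OF cM] g u by (intro M1.coset_mult_left_mem) auto
    finally show "M1 #> (u \<otimes> g) = M1 #> (g \<otimes> u)" .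
  qed
  then have DM1: "\<D> \<subseteq> central_mod M1"
    using adjoin_normal(2)[OF M(1) _ M1(1,4)] uD M(4) F(3) by auto
  \<comment> \<open>This clashes with |G'| = p |M| = p^2 |M1|.\<close>
  have "card \<D> \<le> p * card M1" by (rule class_two_bound(1)[OF x y p0 gen M1(1) DM1])
  then have "card M \<le> card M1" using M(3) p1 by simp
  moreover have "card M1 > 0" by (rule card_subgroup_pos[OF M1.is_subgroup])
  ultimately show False using M1(3) p1 by simp
qed

lemma all_linear_imp: assumes "\<And>\<chi>. \<chi> \<in> Irr G \<Longrightarrow> deg \<chi> = 1"
  shows "card (carrier G) = p ^ 4" "\<D> = {\<one>}"
proof -
  have "(\<Sum>\<chi>\<in>Irr G. (deg \<chi>)\<^sup>2) = card (Irr G)" using assms by simp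
  then show c: "card (carrier G) = p ^ 4" using sum_squares count3 by simp
  have "{\<chi> \<in> Irr G. deg \<chi> = 1} = Irr G" using assms by blast
  then have "idx \<D> = p ^ 4" using index_D count3 by simp
  then have "p ^ 4 * card \<D> = p ^ 4 * 1"
    using index_mult_card[OF normal_imp_subgroup[OF derived_normal]] c by simp
  then have "card \<D> = 1" using p1 by simp
  then show "\<D> = {\<one>}"
    using subgroup.one_closed[OF normal_imp_subgroup[OF derived_normal]] by (metis card_1_singletonE singletonD)
qed

text \<open>The index of \<open>\<D>\<close> is the number of linear characters, so it is p^3 or
  p^4. In the first case the bound on \<open>\<D>\<close> gives |G| at most |Irr G|, and comparison
  with the sum of squares excludes degrees above 1; in the second, all p^4 characters are already
  linear.\<close>

lemma all_linear: assumes "\<chi> \<in> Irr G" shows "deg \<chi> = 1"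
proof -
  note sgD = normal_imp_subgroup[OF derived_normal]
  obtain k where k: "idx \<D> = p ^ k" by (rule index_power[OF sgD])
  have "p ^ 3 \<le> p ^ k"
    using index_anti_mono[OF sgD normal_imp_subgroup[OF powers_normal] derived_le_powers, of "p * p"]
      index_P2_eq k by simp
  then have k3: "3 \<le> k" using p1 by (simp only: power_increasing_iff)
  have "card {\<chi> \<in> Irr G. deg \<chi> = 1} \<le> p ^ 4"
    unfolding count3[symmetric] using finite_Irr by (intro card_mono) auto
  then have "p ^ k \<le> p ^ 4" using k index_D by simp
  then have "k \<le> 4" using p1 by (simp only: power_increasing_iff)
  then consider "k = 3" | "k = 4" using k3 by arith
  then show ?thesis
  proof cases
    case 1
    then have iD: "idx \<D> = p ^ 3" using k by simp
    have "card (carrier G) = p ^ 3 * card \<D>" using index_mult_card[OF sgD] iD by simp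
    also have "\<dots> \<le> p ^ 3 * p" using card_derived_le[OF iD] by (rule mult_le_mono2)
    also have "\<dots> = card (Irr G)" unfolding count3 by (simp add: power_Suc[symmetric] mult.commute del: power_Suc)
    finally have le: "(\<Sum>\<chi>\<in>Irr G. (deg \<chi>)\<^sup>2) \<le> (\<Sum>\<chi>\<in>Irr G. 1)" using sum_squares by simp
    show ?thesis
    proof (rule ccontr)
      assume "deg \<chi> \<noteq> 1"
      then have "1 < deg \<chi>" using chi_degree_pos[OF assms] by simp
      then have "1 < (deg \<chi>)\<^sup>2" by (rule one_less_power) simp
      then have "(\<Sum>\<chi>\<in>Irr G. 1) < (\<Sum>\<chi>\<in>Irr G. (deg \<chi>)\<^sup>2)"
        using finite_Irr assms chi_degree_pos by (intro sum_strict_mono_ex1) (auto simp: Suc_leI)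
      then show False using le by simp
    qed
  next
    case 2
    then have "{\<chi> \<in> Irr G. deg \<chi> = 1} = Irr G"
      using finite_Irr k index_D count3 by (intro card_subset_eq) auto
    then show ?thesis using assms by blast
  qed
qed

theorem abelian_generators:
  obtains x y where "card (carrier G) = p ^ 4" "comm_group G" "x \<in> carrier G" "y \<in> carrier G"
    "x [^] (p ^ 3) = \<one>" "y [^] p = \<one>" "\<And>g. g \<in> carrier G \<Longrightarrow> \<exists>(i::nat) (j::nat). g = x [^] i \<otimes> y [^] j"
proof -
  have c: "card (carrier G) = p ^ 4" "\<D> = {\<one>}"
    by (rule all_linear_imp, rule all_linear, assumption)+
  note sgP = normal_imp_subgroup[OF powers_normal]
  obtain x y where x: "x \<in> carrier G" and y: "y \<in> carrier G" "y [^] p \<in> \<D>"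
    and g: "\<And>g. g \<in> carrier G \<Longrightarrow> \<exists>(i::nat) (j::nat). \<D> #> g = \<D> #> (x [^] i \<otimes> y [^] j)"
    by (rule generators) (rule that)
  have one: "{\<one>} #> a = {a}" if "a \<in> carrier G" for a using that by (simp add: r_coset_def)
  have "comm_group G"
  proof (rule group_comm_groupI)
    fix a b assume ab: "a \<in> carrier G" "b \<in> carrier G"
    have "a \<otimes> b \<otimes> inv a \<otimes> inv b \<in> \<D>"
      unfolding derived_def using ab by (intro generate.incl) blast
    then have "a \<otimes> b \<otimes> inv (b \<otimes> a) = \<one>" using ab c(2) by (simp add: inv_mult_group m_assoc)
    then show "a \<otimes> b = b \<otimes> a" using ab inv_solve_right' by (metis inv_closed inv_equality inv_inv m_closed)
  qed
  moreover have "x [^] (p ^ 3) = \<one>"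
  proof -
    \<comment> \<open>The subgroup of p-th powers has order p^4 / p^2 = p^2, so x^p has order
      dividing p^2.\<close>
    have "p ^ 2 * card (powers p) = p ^ 2 * p ^ 2"
      using index_mult_card[OF sgP, of p] index_P1 c(1) by (simp flip: power_add)
    then have cP: "card (powers p) = p ^ 2" using p1 by (simp only: mult_cancel_left) simp
    have "x [^] p \<in> powers p" unfolding powers_iff using x by auto
    then have "(x [^] p) [^] (p ^ 2) = \<one>" using pow_card_subgroup[OF sgP] cP by metis
    then show ?thesis using x by (simp add: nat_pow_pow power3_eq_cube power2_eq_square mult.assoc)
  qed
  moreover have "y [^] p = \<one>" using y c(2) by simp
  moreover have "\<exists>(i::nat) (j::nat). u = x [^] i \<otimes> y [^] j" if u: "u \<in> carrier G" for u
    using g[OF u] u x y(1) unfolding c(2) by (auto simp: one)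
  ultimately show thesis using that c(1) x y(1) by blast
qed

end

section \<open>The pseudo-algebra of the abelian group\<close>

lemma Cod_eq_fst_image: "Cod G = fst ` group_pseudo_algebra G"
proof
  show "Cod G \<subseteq> fst ` group_pseudo_algebra G"
  proof
    fix d assume "d \<in> Cod G"
    then have "(d, codegree_mult G d) \<in> group_pseudo_algebra G" unfolding group_pseudo_algebra_def by blast
    then show "d \<in> fst ` group_pseudo_algebra G" by (rule rev_image_eqI) simp
  qed
qed (auto simp: group_pseudo_algebra_def)

lemma pseudo_algebra_memI: "d \<in> Cod G \<Longrightarrow> (d, codegree_mult G d) \<in> group_pseudo_algebra G"
  unfolding group_pseudo_algebra_def by blast

lemma pseudo_algebra_multiplicity:
  "(d, m) \<in> group_pseudo_algebra G \<Longrightarrow> m = codegree_mult G d"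
  by (auto simp: group_pseudo_algebra_def)

text \<open>Partitions the characters by codegree; the set \<open>S\<close> is arbitrary so that
  cumulative counts can be formed later.\<close>

lemma codegree_count_sum:
  assumes "finite (Irr G)"
  shows "card {\<chi> \<in> Irr G. codegree G \<chi> \<in> S} = (\<Sum>d\<in>Cod G \<inter> S. codegree_mult G d)"
proof -
  define X where "X = {\<chi> \<in> Irr G. codegree G \<chi> \<in> S}"
  have C: "Cod G = codegree G ` Irr G" by (auto simp: Cod_def)
  have fib: "{\<chi> \<in> X. codegree G \<chi> = d} = {\<chi> \<in> Irr G. codegree G \<chi> = d}" if "d \<in> Cod G \<inter> S" for d
    using that by (auto simp: X_def)
  have "card X = (\<Sum>\<chi>\<in>X. 1)" by simp
  also have "\<dots> = (\<Sum>d\<in>Cod G \<inter> S. \<Sum>\<chi>\<in>{\<chi> \<in> X. codegree G \<chi> = d}. 1)"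
    by (rule sum.group[symmetric]) (use assms in \<open>auto simp: X_def C\<close>)
  also have "\<dots> = (\<Sum>d\<in>Cod G \<inter> S. codegree_mult G d)"
    by (intro sum.cong refl) (simp only: fib codegree_mult_def card_eq_sum)
  finally show ?thesis by (simp add: X_def)
qed

lemma codegree_count_eq:
  assumes fin: "finite (Irr G)" "finite (Irr H)" and eq: "group_pseudo_algebra G = group_pseudo_algebra H"
  shows "Cod G = Cod H"
    and "card {\<chi> \<in> Irr G. codegree G \<chi> \<in> S} = card {\<chi> \<in> Irr H. codegree H \<chi> \<in> S}"
proof -
  show c: "Cod G = Cod H" unfolding Cod_eq_fst_image eq ..
  have "codegree_mult G d = codegree_mult H d" if "d \<in> Cod G" for d
  proof (rule pseudo_algebra_multiplicity)
    show "(d, codegree_mult G d) \<in> group_pseudo_algebra H"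
      using pseudo_algebra_memI[OF that] unfolding eq .
  qed
  then show "card {\<chi> \<in> Irr G. codegree G \<chi> \<in> S} = card {\<chi> \<in> Irr H. codegree H \<chi> \<in> S}"
    unfolding codegree_count_sum[OF fin(1)] codegree_count_sum[OF fin(2)] c[symmetric]
    by (intro sum.cong) auto
qed

abbreviation (input) cyc_prod :: "nat \<Rightarrow> (int \<times> int) monoid" where
  "cyc_prod p \<equiv> integer_mod_group (p ^ 3) \<times>\<times> integer_mod_group p"

lemma cyc_prod_group: "group (cyc_prod p)"
  by (intro DirProd_group) simp_all

lemma cyc_prod_comm_group: "comm_group (cyc_prod p)"
proof (rule group.group_comm_groupI[OF cyc_prod_group])
  fix x y assume "x \<in> carrier (cyc_prod p)" "y \<in> carrier (cyc_prod p)"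
  show "x \<otimes>\<^bsub>cyc_prod p\<^esub> y = y \<otimes>\<^bsub>cyc_prod p\<^esub> x"
    by (simp add: mult_DirProd' add.commute)
qed

lemma cyc_prod_carrier: "p > 0 \<Longrightarrow> carrier (cyc_prod p) = {0..<int p ^ 3} \<times> {0..<int p}"
  by (simp add: carrier_integer_mod_group)

lemma cyc_prod_pow: "(a, b) [^]\<^bsub>cyc_prod p\<^esub> (m::nat) = ((int m * a) mod int p ^ 3, (int m * b) mod int p)"
proof (induction m)
  case (Suc m)
  have "(a, b) [^]\<^bsub>cyc_prod p\<^esub> Suc m = (a, b) [^]\<^bsub>cyc_prod p\<^esub> m \<otimes>\<^bsub>cyc_prod p\<^esub> (a, b)" by simp
  then show ?case unfolding Suc.IH by (simp add: mod_add_left_eq mod_add_right_eq algebra_simps)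
qed simp

text \<open>For i at least 1 the p^i-th power kills the second factor and maps the first onto the
  multiples of p^i modulo p^3.\<close>

lemma cyc_prod_powers_card:
  assumes p: "p > 0" and i: "1 \<le> i" "i \<le> 3"
  shows "card ((\<lambda>z. z [^]\<^bsub>cyc_prod p\<^esub> (p ^ i)) ` carrier (cyc_prod p)) = p ^ (3 - i)"
proof -
  have e: "int p ^ 3 = int p ^ i * int p ^ (3 - i)" using i by (simp flip: power_add)
  have f: "int p dvd int p ^ i" using i by (simp add: dvd_power)
  \<comment> \<open>Multiplying by p^i and reducing modulo p^3 amounts to reducing a modulo p^(3 -
    i) first; this yields an injective parametrization of the powers.\<close>
  have pw: "(a, b) [^]\<^bsub>cyc_prod p\<^esub> (p ^ i) = (int p ^ i * (a mod int p ^ (3 - i)), 0)" for a b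
    unfolding cyc_prod_pow of_nat_power e mult_mod_right using f by simp
  have "(\<lambda>z. z [^]\<^bsub>cyc_prod p\<^esub> (p ^ i)) ` carrier (cyc_prod p) = (\<lambda>k. (int p ^ i * k, 0)) ` {0..<int p ^ (3 - i)}"
  proof
    show "(\<lambda>z. z [^]\<^bsub>cyc_prod p\<^esub> (p ^ i)) ` carrier (cyc_prod p) \<subseteq> (\<lambda>k. (int p ^ i * k, 0)) ` {0..<int p ^ (3 - i)}"
    proof (rule image_subsetI)
      fix z :: "int \<times> int"
      obtain a b where z: "z = (a, b)" by (cases z)
      have "a mod int p ^ (3 - i) \<in> {0..<int p ^ (3 - i)}" using p by simp
      then show "z [^]\<^bsub>cyc_prod p\<^esub> (p ^ i) \<in> (\<lambda>k. (int p ^ i * k, 0)) ` {0..<int p ^ (3 - i)}"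
        unfolding z pw by blast
    qed
    show "(\<lambda>k. (int p ^ i * k, 0)) ` {0..<int p ^ (3 - i)} \<subseteq> (\<lambda>z. z [^]\<^bsub>cyc_prod p\<^esub> (p ^ i)) ` carrier (cyc_prod p)"
    proof (rule image_subsetI)
      fix k assume k: "k \<in> {0..<int p ^ (3 - i)}"
      have "int p ^ (3 - i) \<le> int p ^ 3" using p by (intro power_increasing) auto
      then have "(k, 0) \<in> carrier (cyc_prod p)" using k p unfolding cyc_prod_carrier[OF p] by simp
      moreover have "(int p ^ i * k, 0) = (k, 0) [^]\<^bsub>cyc_prod p\<^esub> (p ^ i)" unfolding pw using k by simp
      ultimately show "(int p ^ i * k, 0) \<in> (\<lambda>z. z [^]\<^bsub>cyc_prod p\<^esub> (p ^ i)) ` carrier (cyc_prod p)"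
        by (rule rev_image_eqI)
    qed
  qed
  moreover have "inj_on (\<lambda>k. (int p ^ i * k, 0 :: int)) {0..<int p ^ (3 - i)}"
    using p by (auto simp: inj_on_def)
  ultimately show ?thesis by (simp add: card_image nat_power_eq)
qed

text \<open>The characters of the abelian group are all linear, so \<open>powers_index\<close> turns
  each count into the index of the p^i-th powers, which is p^4 / p^(3 - i) = p^(i+1).\<close>

lemma cyc_prod_codegrees:
  fixes A (structure)
  assumes p: "prime p" and A: "group A" and iso: "A \<cong> cyc_prod p"
  shows "finite (Irr A)"
    and "\<And>\<chi>. \<chi> \<in> Irr A \<Longrightarrow> \<exists>j\<le>3. codegree A \<chi> = of_nat (p ^ j)"
    and "\<And>i. 1 \<le> i \<Longrightarrow> i \<le> 3 \<Longrightarrow> card {\<chi> \<in> Irr A. codegree A \<chi> \<in> (\<lambda>j. of_nat (p ^ j)) ` {..i}} = p ^ Suc i"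
proof -
  have p0: "p > 0" using p prime_gt_0_nat by blast
  have p1: "p > 1" using p prime_gt_1_nat by blast
  have iso': "cyc_prod p \<cong> A" by (rule group.iso_sym[OF A iso])
  have cT: "card (carrier (cyc_prod p)) = p ^ 4"
    unfolding cyc_prod_carrier[OF p0] by (simp add: card_cartesian_product nat_power_eq flip: power_Suc2)
  have cA: "card (carrier A) = p ^ 4" using iso_same_card[OF iso] cT by simp
  have "finite (carrier A)" using cA p0 by (metis card.infinite power_not_zero not_gr_zero)
  then interpret finite_group A using A by (simp add: finite_group_def finite_group_axioms_def)
  interpret comm_group A
    by (rule comm_group.iso_imp_comm_group[OF cyc_prod_comm_group iso']) (rule is_monoid)
  obtain h where h: "h \<in> iso (cyc_prod p) A" using iso' by (auto simp: is_iso_def)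
  then have hh: "h \<in> hom (cyc_prod p) A" and hb: "bij_betw h (carrier (cyc_prod p)) (carrier A)" by (auto simp: iso_def)
  have D: "derived A (carrier A) = {\<one>}" by (rule derived_eq_singleton) simp
  have cP: "card (powers (p ^ i)) = p ^ (3 - i)" if i: "1 \<le> i" "i \<le> 3" for i
  proof -
    have "powers (p ^ i) = (\<lambda>a. a [^] (p ^ i)) ` carrier A"
      unfolding powers_def D by (auto simp: r_coset_def)
    also have "\<dots> = (\<lambda>z. h z [^] (p ^ i)) ` carrier (cyc_prod p)"
      unfolding bij_betw_imp_surj_on[OF hb, symmetric] image_image ..
    also have "\<dots> = (\<lambda>z. h (z [^]\<^bsub>cyc_prod p\<^esub> (p ^ i))) ` carrier (cyc_prod p)"
      using Group.hom_nat_pow[OF hh _ cyc_prod_group A] by (intro image_cong) auto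
    also have "\<dots> = h ` (\<lambda>z. z [^]\<^bsub>cyc_prod p\<^esub> (p ^ i)) ` carrier (cyc_prod p)" by (simp add: image_image)
    finally have e: "powers (p ^ i) = \<dots>" .
    have sub: "(\<lambda>z. z [^]\<^bsub>cyc_prod p\<^esub> (p ^ i)) ` carrier (cyc_prod p) \<subseteq> carrier (cyc_prod p)"
      by (intro image_subsetI monoid.nat_pow_closed group.is_monoid[OF cyc_prod_group])
    have "inj_on h ((\<lambda>z. z [^]\<^bsub>cyc_prod p\<^esub> (p ^ i)) ` carrier (cyc_prod p))"
      using hb sub by (auto simp: bij_betw_def intro: inj_on_subset)
    then show ?thesis unfolding e using cyc_prod_powers_card[OF p0 i] by (simp add: card_image)
  qed
  show "finite (Irr A)" by (rule finite_Irr)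
  have deg: "chi_degree A \<chi> = 1" if "\<chi> \<in> Irr A" for \<chi>
    using derived_in_kernel_imp_degree_one[OF that] subgroup.one_closed[OF kernel_subgroup[OF that]] D by simp
  have ex: "\<exists>j\<le>3. card (rcosets (char_kernel A \<chi>)) = p ^ j" if \<chi>: "\<chi> \<in> Irr A" for \<chi>
  proof -
    have "card (rcosets (char_kernel A \<chi>)) dvd p ^ 4"
      using index_mult_card[OF kernel_subgroup[OF \<chi>]] cA by (metis dvd_triv_left)
    then obtain j where j: "card (rcosets (char_kernel A \<chi>)) = p ^ j" using p divides_primepow_nat by blast
    \<comment> \<open>The p^3-th powers are trivial, which bounds every codegree by p^3.\<close>
    have c1: "card (powers (p ^ 3)) = 1" using cP[of 3] by simp
    have "a [^] (p ^ 3) \<in> char_kernel A \<chi>" if a: "a \<in> carrier A" for a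
    proof -
      have "a [^] (p ^ 3) \<in> powers (p ^ 3)" unfolding powers_iff using a by auto
      moreover have "\<one> \<in> powers (p ^ 3)"
        by (rule subgroup.one_closed[OF normal_imp_subgroup[OF powers_normal]])
      ultimately have "a [^] (p ^ 3) = \<one>" using c1 by (metis card_1_singletonE singletonD)
      then show ?thesis using subgroup.one_closed[OF kernel_subgroup[OF \<chi>]] by simp
    qed
    then have "p ^ j \<le> p ^ 3" using linear_character_index_le[OF \<chi> deg[OF \<chi>], of "p ^ 3"] j p0 by simp
    then have "j \<le> 3" using p1 by (simp only: power_increasing_iff)
    then show ?thesis using j by blast
  qed
  then obtain e where e: "\<And>\<chi>. \<chi> \<in> Irr A \<Longrightarrow> e \<chi> \<le> 3 \<and> card (rcosets (char_kernel A \<chi>)) = p ^ e \<chi>" by metis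
  then have e': "card (rcosets (char_kernel A \<chi>)) = p ^ e \<chi> * chi_degree A \<chi>" if "\<chi> \<in> Irr A" for \<chi>
    using that deg by simp
  have cod: "codegree A \<chi> = of_nat (p ^ e \<chi>)" if "\<chi> \<in> Irr A" for \<chi>
    using codegree_eq_iff[OF that, of "p ^ e \<chi>"] e'[OF that] by blast
  show "\<exists>j\<le>3. codegree A \<chi> = of_nat (p ^ j)" if "\<chi> \<in> Irr A" for \<chi>
    using cod[OF that] e[OF that] by blast
  fix i :: nat assume i: "1 \<le> i" "i \<le> 3"
  have "codegree A \<chi> \<in> (\<lambda>j. of_nat (p ^ j)) ` {..i} \<longleftrightarrow> e \<chi> \<le> i" if "\<chi> \<in> Irr A" for \<chi>
    unfolding cod[OF that] image_iff of_nat_eq_iff using p1 by (auto simp: power_inject_exp)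
  then have "{\<chi> \<in> Irr A. codegree A \<chi> \<in> (\<lambda>j. of_nat (p ^ j)) ` {..i}} = {\<chi> \<in> Irr A. chi_degree A \<chi> = 1 \<and> e \<chi> \<le> i}"
    using deg by blast
  then have "card {\<chi> \<in> Irr A. codegree A \<chi> \<in> (\<lambda>j. of_nat (p ^ j)) ` {..i}} = card (rcosets (powers (p ^ i)))"
    using powers_index[OF p e', of i] by simp
  moreover have "card (rcosets (powers (p ^ i))) * p ^ (3 - i) = p ^ Suc i * p ^ (3 - i)"
  proof -
    have "p ^ Suc i * p ^ (3 - i) = p ^ 4" unfolding power_add[symmetric] using i by simp
    then show ?thesis
      using index_mult_card[OF normal_imp_subgroup[OF powers_normal], of "p ^ i"] cA cP[OF i] by simp
  qed
  ultimately show "card {\<chi> \<in> Irr A. codegree A \<chi> \<in> (\<lambda>j. of_nat (p ^ j)) ` {..i}} = p ^ Suc i"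
    using p0 by simp
qed

section \<open>From generators to the isomorphism\<close>

lemma (in group) pow_mod:
  assumes "x \<in> carrier G" "x [^] m = \<one>" shows "x [^] (i::nat) = x [^] (i mod m)"
proof -
  have "x [^] i = (x [^] m) [^] (i div m) \<otimes> x [^] (i mod m)"
    using assms(1) by (simp add: nat_pow_pow nat_pow_mult mult.commute)
  then show ?thesis using assms by simp
qed

text \<open>The relations make (a, b) to x^a y^b a homomorphism and the generators make it
  surjective; equality of the orders, p^3 times p, then makes it injective.\<close>

lemma iso_cyc_prod_if_generators:
  fixes G (structure)
  assumes G: "comm_group G" and p: "p > 0" and c: "card (carrier G) = p ^ 4"
    and x: "x \<in> carrier G" "x [^] (p ^ 3) = \<one>" and y: "y \<in> carrier G" "y [^] p = \<one>"
    and gen: "\<And>g. g \<in> carrier G \<Longrightarrow> \<exists>(i::nat) (j::nat). g = x [^] i \<otimes> y [^] j"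
  shows "cyc_prod p \<cong> G"
proof -
  interpret comm_group G by (rule G)
  define f where "f = (\<lambda>(a, b). x [^] nat a \<otimes> y [^] nat b)"
  have T: "carrier (cyc_prod p) = {0..<int (p ^ 3)} \<times> {0..<int p}" unfolding cyc_prod_carrier[OF p] by simp
  have red: "u [^] nat ((a + b) mod int m) = u [^] nat a \<otimes> u [^] nat b"
    if "u \<in> carrier G" "u [^] m = \<one>" "a \<ge> 0" "b \<ge> 0" for u a b and m :: nat
  proof -
    have "nat ((a + b) mod int m) = (nat a + nat b) mod m" using that by (simp add: nat_mod_distrib nat_add_distrib)
    then show ?thesis using pow_mod[OF that(1,2), of "nat a + nat b"] that(1) by (simp add: nat_pow_mult)
  qed
  have hom: "f \<in> hom (cyc_prod p) G"
  proof (rule homI)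
    fix u v assume "u \<in> carrier (cyc_prod p)" "v \<in> carrier (cyc_prod p)"
    then obtain a b c d where uv: "u = (a, b)" "v = (c, d)" "a \<ge> 0" "b \<ge> 0" "c \<ge> 0" "d \<ge> 0" unfolding T by auto
    show "f (u \<otimes>\<^bsub>cyc_prod p\<^esub> v) = f u \<otimes> f v"
      using red[OF x uv(3,5)] red[OF y uv(4,6)] x(1) y(1) by (simp add: uv f_def m_ac)
  qed (use x y in \<open>auto simp: f_def\<close>)
  have "carrier G \<subseteq> f ` carrier (cyc_prod p)"
  proof
    fix g assume "g \<in> carrier G"
    then obtain i j :: nat where "g = x [^] i \<otimes> y [^] j" using gen by blast
    then have "g = f (int (i mod p ^ 3), int (j mod p))"
      using pow_mod[OF x, of i] pow_mod[OF y, of j] by (simp add: f_def)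
    moreover have "(int (i mod p ^ 3), int (j mod p)) \<in> carrier (cyc_prod p)" unfolding T using p by simp
    ultimately show "g \<in> f ` carrier (cyc_prod p)" by blast
  qed
  then have im: "f ` carrier (cyc_prod p) = carrier G" using hom by (auto simp: hom_def)
  have "card (carrier (cyc_prod p)) = card (carrier G)"
    unfolding c T by (simp add: card_cartesian_product power_Suc2[symmetric] del: power_Suc of_nat_power)
  then have "inj_on f (carrier (cyc_prod p))"
    using im T by (intro eq_card_imp_inj_on) simp_all
  then show ?thesis using hom im by (auto simp: is_iso_def iso_def bij_betw_def)
qed

theorem mainTheorem6:
  fixes p :: nat
    and A :: "('a, 'b) monoid_scheme"
    and G :: "('c, 'd) monoid_scheme"
  assumes "prime p"
    and "group A"
    and "A \<cong> integer_mod_group (p ^ 3) \<times>\<times> integer_mod_group p"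
    and "group G"
    and "finite (carrier G)"
    and "group_pseudo_algebra G = group_pseudo_algebra A"
  shows "G \<cong> A"
proof -
  note p = assms(1)
  have p1: "p > 1" using p prime_gt_1_nat by blast
  note A = cyc_prod_codegrees[OF assms(1-3)]
  interpret finite_group G using assms(4,5) by (simp add: finite_group_def finite_group_axioms_def)
  note same = codegree_count_eq[OF finite_Irr A(1) assms(6)]
  have "\<exists>j\<le>3. codegree G \<chi> = of_nat (p ^ j)" if "\<chi> \<in> Irr G" for \<chi>
  proof -
    have "codegree G \<chi> \<in> Cod G" unfolding Cod_def using that by blast
    then have "codegree G \<chi> \<in> Cod A" unfolding same(1) .
    then obtain \<psi> where "\<psi> \<in> Irr A" "codegree G \<chi> = codegree A \<psi>" unfolding Cod_def by auto
    then show ?thesis using A(2) by simp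
  qed
  \<comment> \<open>Equality of the pseudo-algebras transfers both the possible codegrees and their
    cumulative counts; naming the exponents by a function \<open>e\<close> prepares the instance of
    \<open>cod_p_group\<close>.\<close>
  then obtain e where e: "\<And>\<chi>. \<chi> \<in> Irr G \<Longrightarrow> e \<chi> \<le> 3" "\<And>\<chi>. \<chi> \<in> Irr G \<Longrightarrow> codegree G \<chi> = of_nat (p ^ e \<chi>)" by metis
  have idx: "card (rcosets\<^bsub>G\<^esub> (char_kernel G \<chi>)) = p ^ e \<chi> * chi_degree G \<chi>" if "\<chi> \<in> Irr G" for \<chi>
    using codegree_eq_iff[OF that, of "p ^ e \<chi>"] e(2)[OF that] by blast
  have iff: "codegree G \<chi> \<in> (\<lambda>j. of_nat (p ^ j)) ` {..i} \<longleftrightarrow> e \<chi> \<le> i" if "\<chi> \<in> Irr G" for \<chi> i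
    unfolding e(2)[OF that] image_iff of_nat_eq_iff using p1 by (auto simp: power_inject_exp)
  have cnt: "card {\<chi> \<in> Irr G. e \<chi> \<le> i} = p ^ Suc i" if "1 \<le> i" "i \<le> 3" for i
  proof -
    have "{\<chi> \<in> Irr G. e \<chi> \<le> i} = {\<chi> \<in> Irr G. codegree G \<chi> \<in> (\<lambda>j. of_nat (p ^ j)) ` {..i}}"
      using iff by blast
    then show ?thesis using same(2)[of "(\<lambda>j. of_nat (p ^ j)) ` {..i}"] A(3)[OF that] by simp
  qed
  have "{\<chi> \<in> Irr G. e \<chi> \<le> 3} = Irr G" using e(1) by blast
  then have cI: "card (Irr G) = p ^ 4" using cnt[of 3] by simp
  have "q = p" if "prime q" "q dvd card (carrier G)" for q
    by (rule prime_divisor_of_order[OF p _ that]) (use idx in blast)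
  then obtain n where "card (carrier G) = p ^ n"
    using prime_power_if_unique_prime_divisor[OF card_carrier_pos p] by blast
  then interpret cod_p_group G p n e
    using p idx e(1) cnt[of 1] cnt[of 2] cI
    by unfold_locales (simp_all add: numeral_eq_Suc)
  obtain x y where "card (carrier G) = p ^ 4" "comm_group G" "x \<in> carrier G" "y \<in> carrier G"
    "x [^]\<^bsub>G\<^esub> (p ^ 3) = \<one>\<^bsub>G\<^esub>" "y [^]\<^bsub>G\<^esub> p = \<one>\<^bsub>G\<^esub>"
    "\<And>g. g \<in> carrier G \<Longrightarrow> \<exists>(i::nat) (j::nat). g = x [^]\<^bsub>G\<^esub> i \<otimes>\<^bsub>G\<^esub> y [^]\<^bsub>G\<^esub> j"
    by (rule abelian_generators) (rule that)
  then have "cyc_prod p \<cong> G" using p1 by (intro iso_cyc_prod_if_generators[of G p x y]) auto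
  then have "G \<cong> cyc_prod p" by (rule group.iso_sym[OF cyc_prod_group])
  moreover have "cyc_prod p \<cong> A" by (rule group.iso_sym[OF assms(2,3)])
  ultimately show ?thesis by (rule iso_trans)
qed

end
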